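(* Let $n\ge 2$, let $p,q\in\mathbb{R}^n$, and let $\Lambda=(\Lambda^{\mu}_{\ \nu})_{0\le\mu,\nu\le n}$ be any (proper) Lorentz transformation (depending on $p,q$) such that $\Lambda^{\mu}_{\ \nu}(p^\nu+q^\nu)=(\sqrt{s},0,\ldots,0)$. For any suitable integrable function $G:\mathbb{R}^n\times\mathbb{R}^n\times\mathbb{R}^n\times\mathbb{R}^n\to\mathbb{R}$ it holds that $$\frac{c}{p^0q^0}\int_{\mathbb{R}^n}\frac{dq'}{q'^0}\int_{\mathbb{R}^n}\frac{dp'}{p'^0}\,W(p,q|p',q')\,G(p,q,p',q')=\int_{\mathbb{S}^{n-1}}d\omega\; v_{M}(p,q)\,\sigma(\varrho,\theta)\,G(p,q,p',q'),$$ where $v_M$ is the Møller velocity $$v_M(p,q)=\frac{c}{4}\,\frac{\varrho\sqrt{s}}{p^0q^0}.$$ On the right-hand side $\omega=(\omega^1,\ldots,\omega^n)\in\mathbb{S}^{n-1}$, the angle $\theta$ is given by $$\cos\theta=\frac{k}{|k|}\cdot\omega,\qquad k^i=\Lambda^{i}_{\ \mu}(p^\mu-q^\mu)=\Lambda^i_{\ 0}(p^0-q^0)+\Lambda^i_{\ j}(p^j-q^j)\quad(i=1,\ldots,n),$$ and, with $L^{\mu\kappa}=-g^{\mu\lambda}\Lambda^{\kappa}_{\ \lambda}$, the post-collisional momenta are ($i=1,\ldots,n$) $$p'^{i}=L^{i0}\frac{\sqrt{s}}{2}-L^{ij}\omega_j\frac{\varrho}{2},\qquad q'^{i}=L^{i0}\frac{\sqrt{s}}{2}+L^{ij}\omega_j\frac{\varrho}{2},$$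 with corresponding energies $$p'^{0}=L^{00}\frac{\sqrt{s}}{2}-L^{0j}\omega_j\frac{\varrho}{2},\qquad q'^{0}=L^{00}\frac{\sqrt{s}}{2}+L^{0j}\omega_j\frac{\varrho}{2}$$ (sums over $j\in\{1,\ldots,n\}$ are implied).
   Context: Notation. $c$ denotes the speed of light. For a momentum $p=(p^1,\ldots,p^n)\in\mathbb{R}^n$ the energy is $p^0=\sqrt{c^2+|p|^2}$ and $p^\mu=(p^0,p)$; similarly for $q,p',q'$. Greek indices run over $0,\ldots,n$, Latin indices over $1,\ldots,n$; repeated indices are summed. The Minkowski metric is $(g_{\mu\nu})=\mathrm{diag}(-1,1,\ldots,1)$ with inverse $g^{\mu\nu}$; it raises and lowers indices, so $p^\mu q_\mu=-p^0q^0+p\cdot q$ and $\omega_j=\omega^j$. Set $$\varrho=\sqrt{(p^\mu-q^\mu)(p_\mu-q_\mu)}=\sqrt{2(p^0q^0-p\cdot q-c^2)},\qquad s=-(p^\mu+q^\mu)(p_\mu+q_\mu)=2(p^0q^0-p\cdot q+c^2),$$ so $s=\varrho^2+4c^2$. A real matrix $\Lambda=(\Lambda^\mu_{\ \nu})$ of size $(1+n)\times(1+n)$ is a (proper) Lorentz transformation if $\det\Lambda=1$ and $\Lambda^\kappa_{\ \mu}g_{\kappa\lambda}\Lambda^\lambda_{\ \nu}=g_{\mu\nu}$ for all $\mu,\nu$. The transition rate is $$W(p,q|p',q')=\frac12\Big(\frac{\varrho}{2}\Big)^{3-n}s\,\sigma(\varrho,\theta)\,\delta^{(1+n)}(p^\mu+q^\mu-p'^\mu-q'^\mu),$$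 where $\varrho=\varrho(p,q)$, $s=s(p,q)$, $\sigma(\varrho,\theta)$ is a given function (the differential cross-section), $\delta^{(1+n)}$ is the product of $1+n$ Dirac delta functions (one for each component $\mu=0,\ldots,n$), and on the left-hand side of the claim $\theta$ is the angle defined by $\cos\theta=(p^\mu-q^\mu)(p'_\mu-q'_\mu)/\varrho^2$, which is well defined under the conservation laws $p^\mu+q^\mu=p'^\mu+q'^\mu$. $d\omega$ is the surface measure on the unit sphere $\mathbb{S}^{n-1}\subset\mathbb{R}^n$. *)

theory Defs
  imports "HOL-Analysis.Analysis"
begin

section \<open>Minkowski space\<close>

text \<open>
  Space-time indices 0,...,n are the type \<open>'n option\<close>: \<open>None\<close> is the index 0 and
  \<open>Some i\<close> the spatial index i. Upper-index four-vectors are elements of \<open>real ^ 'n option\<close>.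
\<close>

definition minkowski :: "real ^ 'n::finite option ^ 'n option" where
  "minkowski = (\<chi> \<mu> \<nu>. if \<mu> = \<nu> then (if \<mu> = None then -1 else 1) else 0)"

definition mink_prod :: "real ^ 'n::finite option \<Rightarrow> real ^ 'n option \<Rightarrow> real" where
  "mink_prod x y = (\<Sum>\<mu>\<in>UNIV. \<Sum>\<nu>\<in>UNIV. minkowski $ \<mu> $ \<nu> * x $ \<mu> * y $ \<nu>)"

definition proper_lorentz :: "real ^ 'n::finite option ^ 'n option \<Rightarrow> bool" where
  "proper_lorentz \<Lambda> \<longleftrightarrow> det \<Lambda> = 1 \<and>
     (\<forall>\<mu> \<nu>. (\<Sum>\<kappa>\<in>UNIV. \<Sum>\<tau>\<in>UNIV. \<Lambda> $ \<kappa> $ \<mu> * minkowski $ \<kappa> $ \<tau> * \<Lambda> $ \<tau> $ \<nu>) = minkowski $ \<mu> $ \<nu>)"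

definition energy :: "real \<Rightarrow> real ^ 'n::finite \<Rightarrow> real" where
  "energy c p = sqrt (c\<^sup>2 + (norm p)\<^sup>2)"

definition four_momentum :: "real \<Rightarrow> real ^ 'n::finite \<Rightarrow> real ^ 'n option" where
  "four_momentum c p = (\<chi> \<mu>. case \<mu> of None \<Rightarrow> energy c p | Some i \<Rightarrow> p $ i)"

definition rel_momentum :: "real \<Rightarrow> real ^ 'n::finite \<Rightarrow> real ^ 'n \<Rightarrow> real" where
  "rel_momentum c p q =
     sqrt (mink_prod (four_momentum c p - four_momentum c q) (four_momentum c p - four_momentum c q))"

definition cm_energy2 :: "real \<Rightarrow> real ^ 'n::finite \<Rightarrow> real ^ 'n \<Rightarrow> real" where
  "cm_energy2 c p q =
     - mink_prod (four_momentum c p + four_momentum c q) (four_momentum c p + four_momentum c q)"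

definition moller_velocity :: "real \<Rightarrow> real ^ 'n::finite \<Rightarrow> real ^ 'n \<Rightarrow> real" where
  "moller_velocity c p q =
     c / 4 * (rel_momentum c p q * sqrt (cm_energy2 c p q) / (energy c p * energy c q))"

section \<open>Composition of a product of Dirac deltas with a map\<close>

definition dirac_sequence :: "(nat \<Rightarrow> real \<Rightarrow> real) \<Rightarrow> bool" where
  "dirac_sequence d \<longleftrightarrow>
     (\<forall>k. continuous_on UNIV (d k) \<and> (\<forall>x. 0 \<le> d k x) \<and> (d k has_integral 1) UNIV) \<and>
     (\<forall>\<epsilon>>0. \<forall>\<^sub>F k in sequentially. \<forall>x. \<epsilon> \<le> \<bar>x\<bar> \<longrightarrow> d k x = 0)"

text \<open>
  \<open>is_dirac_measure \<Phi> M\<close>: the distribution \<open>\<Prod>\<^sub>\<mu> \<delta>(\<Phi>\<^sub>\<mu>(x)) dx\<close> is the Radon measure M. Every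
  one-dimensional delta factor is replaced by its own Dirac sequence, and the limit against each
  continuous compactly supported test function must be the integral with respect to M. At most
  one M satisfies this, because such test functions separate Radon measures.
\<close>

definition is_dirac_measure :: "('a::euclidean_space \<Rightarrow> real ^ 'm::finite) \<Rightarrow> 'a measure \<Rightarrow> bool" where
  "is_dirac_measure \<Phi> M \<longleftrightarrow>
     sets M = sets borel \<and>
     (\<forall>K. compact K \<longrightarrow> emeasure M K < \<infinity>) \<and>
     (\<forall>d f. (\<forall>\<mu>. dirac_sequence (d \<mu>)) \<longrightarrow> continuous_on UNIV f \<longrightarrow>
        (\<exists>K. compact K \<and> (\<forall>x. x \<notin> K \<longrightarrow> f x = (0::real))) \<longrightarrow>
        (\<lambda>k. LINT x|lborel. (\<Prod>\<mu>\<in>UNIV. d \<mu> k (\<Phi> x $ \<mu>)) * f x)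
          \<longlonglongrightarrow> (LINT x|M. f x))"

text \<open>
  Integrating a function h against \<open>\<Prod>\<^sub>\<mu> \<delta>(\<Phi>\<^sub>\<mu>(x)) dx\<close> means \<open>LINT x|dirac_measure \<Phi>. h x\<close>.
\<close>

definition dirac_measure :: "('a::euclidean_space \<Rightarrow> real ^ 'm::finite) \<Rightarrow> 'a measure" where
  "dirac_measure \<Phi> = (THE M. is_dirac_measure \<Phi> M)"

section \<open>The transition rate\<close>

definition conservation_defect ::
  "real \<Rightarrow> real ^ 'n::finite \<Rightarrow> real ^ 'n \<Rightarrow> (real ^ 'n) \<times> (real ^ 'n) \<Rightarrow> real ^ 'n option" where
  "conservation_defect c p q = (\<lambda>(p', q').
     four_momentum c p + four_momentum c q - four_momentum c p' - four_momentum c q')"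

text \<open>
  The argument of \<open>arccos\<close> lies in [-1,1] whenever the conservation laws hold and p, q differ.
\<close>

definition scattering_angle ::
  "real \<Rightarrow> real ^ 'n::finite \<Rightarrow> real ^ 'n \<Rightarrow> real ^ 'n \<Rightarrow> real ^ 'n \<Rightarrow> real" where
  "scattering_angle c p q p' q' =
     arccos (mink_prod (four_momentum c p - four_momentum c q) (four_momentum c p' - four_momentum c q')
             / (rel_momentum c p q)\<^sup>2)"

text \<open>
  The transition rate is \<open>W(p,q|p',q') = transition_weight * \<delta>(conservation_defect)\<close>; its
  distributional factor, times \<open>dp' dq'\<close>, is the measure \<open>collision_measure\<close>.
\<close>

definition transition_weight ::
  "real \<Rightarrow> (real \<Rightarrow> real \<Rightarrow> real) \<Rightarrow> real ^ 'n::finite \<Rightarrow> real ^ 'n \<Rightarrow> real ^ 'n \<Rightarrow> real ^ 'n \<Rightarrow> real" where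
  "transition_weight c \<sigma> p q p' q' =
     1 / 2 * (rel_momentum c p q / 2) powi (3 - int CARD('n)) * cm_energy2 c p q
       * \<sigma> (rel_momentum c p q) (scattering_angle c p q p' q')"

definition collision_measure ::
  "real \<Rightarrow> real ^ 'n::finite \<Rightarrow> real ^ 'n \<Rightarrow> ((real ^ 'n) \<times> (real ^ 'n)) measure" where
  "collision_measure c p q = dirac_measure (conservation_defect c p q)"

section \<open>Surface measure and center-of-momentum variables\<close>

text \<open>
  Surface measure on the unit sphere, as a Borel measure on the whole space: a set A of unit
  vectors gets DIM times the Lebesgue measure of the cone \<open>{r *\<^sub>R x | 0 < r \<le> 1, x \<in> A}\<close>.
  Note that \<open>sgn x = x /\<^sub>R norm x\<close>.
\<close>

definition sphere_measure :: "'a::euclidean_space measure" where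
  "sphere_measure =
     distr (density lborel (\<lambda>x. ennreal (real DIM('a)) * indicator (cball 0 1 - {0}) x)) borel sgn"

definition cm_vector ::
  "real ^ 'n::finite option ^ 'n option \<Rightarrow> real \<Rightarrow> real ^ 'n \<Rightarrow> real ^ 'n \<Rightarrow> real ^ 'n" where
  "cm_vector \<Lambda> c p q =
     (\<chi> i. \<Sum>\<mu>\<in>UNIV. \<Lambda> $ Some i $ \<mu> * (four_momentum c p - four_momentum c q) $ \<mu>)"

definition cm_angle ::
  "real ^ 'n::finite option ^ 'n option \<Rightarrow> real \<Rightarrow> real ^ 'n \<Rightarrow> real ^ 'n \<Rightarrow> real ^ 'n \<Rightarrow> real" where
  "cm_angle \<Lambda> c p q \<omega> =
     arccos ((cm_vector \<Lambda> c p q /\<^sub>R norm (cm_vector \<Lambda> c p q)) \<bullet> \<omega>)"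

definition L_matrix :: "real ^ 'n::finite option ^ 'n option \<Rightarrow> real ^ 'n option ^ 'n option" where
  "L_matrix \<Lambda> = (\<chi> \<mu> \<kappa>. - (\<Sum>\<tau>\<in>UNIV. matrix_inv minkowski $ \<mu> $ \<tau> * \<Lambda> $ \<kappa> $ \<tau>))"

definition post_p4 ::
  "real ^ 'n::finite option ^ 'n option \<Rightarrow> real \<Rightarrow> real ^ 'n \<Rightarrow> real ^ 'n \<Rightarrow> real ^ 'n \<Rightarrow> real ^ 'n option" where
  "post_p4 \<Lambda> c p q \<omega> =
     (\<chi> \<mu>. L_matrix \<Lambda> $ \<mu> $ None * (sqrt (cm_energy2 c p q) / 2)
          - (\<Sum>j\<in>UNIV. L_matrix \<Lambda> $ \<mu> $ Some j * \<omega> $ j * (rel_momentum c p q / 2)))"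

definition post_q4 ::
  "real ^ 'n::finite option ^ 'n option \<Rightarrow> real \<Rightarrow> real ^ 'n \<Rightarrow> real ^ 'n \<Rightarrow> real ^ 'n \<Rightarrow> real ^ 'n option" where
  "post_q4 \<Lambda> c p q \<omega> =
     (\<chi> \<mu>. L_matrix \<Lambda> $ \<mu> $ None * (sqrt (cm_energy2 c p q) / 2)
          + (\<Sum>j\<in>UNIV. L_matrix \<Lambda> $ \<mu> $ Some j * \<omega> $ j * (rel_momentum c p q / 2)))"

definition spatial :: "real ^ 'n::finite option \<Rightarrow> real ^ 'n" where
  "spatial x = (\<chi> i. x $ Some i)"

abbreviation post_p ::
  "real ^ 'n::finite option ^ 'n option \<Rightarrow> real \<Rightarrow> real ^ 'n \<Rightarrow> real ^ 'n \<Rightarrow> real ^ 'n \<Rightarrow> real ^ 'n" where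
  "post_p \<Lambda> c p q \<omega> \<equiv> spatial (post_p4 \<Lambda> c p q \<omega>)"

abbreviation post_q ::
  "real ^ 'n::finite option ^ 'n option \<Rightarrow> real \<Rightarrow> real ^ 'n \<Rightarrow> real ^ 'n \<Rightarrow> real ^ 'n \<Rightarrow> real ^ 'n" where
  "post_q \<Lambda> c p q \<omega> \<equiv> spatial (post_q4 \<Lambda> c p q \<omega>)"

end

theory Submission
  imports Defs
begin

text \<open>
  Write \<open>B\<close> for the inverse of \<open>\<Lambda>\<close>, \<open>\<rho>\<close> for the relative momentum, \<open>r\<^sub>0 = \<rho> / 2\<close> and \<open>T p\<close> for the spatial part of \<open>B\<close> applied to the four-momentum of
  \<open>p\<close>. The post-collisional momenta are \<open>T (r\<^sub>0 \<omega>)\<close> and \<open>T (- r\<^sub>0 \<omega>)\<close>: in the center-of-momentum frame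
  two particles of equal mass fly apart with opposite momenta, and the energy \<open>\<surd>s / 2\<close> of each forces
  the length \<open>r\<^sub>0\<close>. So the product of the Dirac deltas is a measure carried by the image of a sphere, and
  the whole theorem is the computation of its density with respect to the surface measure. The density turns
  out to be \<open>p'\<^sup>0 q'\<^sup>0 r\<^sub>0\<^sup>n\<^sup>-\<^sup>2 / \<surd>s\<close>; multiplied by the transition weight and by
  \<open>c / (p\<^sup>0 q\<^sup>0 p'\<^sup>0 q'\<^sup>0)\<close> it gives the Moller velocity times the cross-section.

  The computation has two steps. The first is to pass to the center-of-momentum frame, which costs
  nothing because \<open>dp / p\<^sup>0\<close> is Lorentz invariant (\<open>nn_integral_mass_shell_lorentz\<close>). The reason
  for the invariance is linear, although \<open>T\<close> is not: up to a constant, the integral over the mass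
  shell is a Lebesgue integral over the solid cone \<open>{x. 0 < x\<^sup>0, 0 < - x\<^sup>\<mu>x\<^sub>\<mu> \<le> 1}\<close> of a function that
  is constant on rays, and linear maps preserving the Minkowski form and the direction of time preserve both
  the cone and Lebesgue measure. The Lorentz map destroys the product structure of the Dirac sequences, but the remaining
  argument only uses that the kernels are nonnegative, have integral 1, and live on shrinking balls.

  The second step is the limit in the center-of-momentum frame (\<open>cm_delta_limit\<close>). In the coordinates
  \<open>p' = r \<omega>\<close>, \<open>q' = - r \<omega> - w\<close> the momentum defect is exactly \<open>w\<close>, and the energy of the pair
  is strictly increasing in \<open>r\<close> as long as \<open>|w| < r\<close>. Substituting the energy for \<open>r\<close> shows that the kernels, weighted by the
  energy rate \<open>\<partial>/\<partial>r\<close>, form measures whose marginal on the sphere is exactly the surface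
  measure and which concentrate at \<open>w = 0\<close>, \<open>r = r\<^sub>0\<close>. What is left of the integrand is continuous, hence
  uniformly continuous on a compact neighbourhood, and converges to its value on the sphere.

  Finally, a measure with the defining property of the Dirac product is unique, because continuous
  functions with compact support separate Radon measures and Dirac sequences exist; so the measure found
  by the computation is the collision measure.
\<close>

section \<open>Linear maps preserving a quadratic form preserve Lebesgue measure\<close>

text \<open>
  The determinant formula for volumes of linear images refers to coordinates in a fixed order. This copy of
  an arbitrary finite index type carries an order pulled back from an enumeration, through which the formula
  reaches index types that have no order of their own, such as \<open>'n option\<close>.
\<close>
datatype 'a well_ordered = WO (unWO: 'a)

instance well_ordered :: (finite) finite
proof
  have "(UNIV :: 'a well_ordered set) = range WO"
    by (metis surjI well_ordered.collapse)
  then show "finite (UNIV :: 'a well_ordered set)"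
    by (metis finite_imageI finite_code)
qed

instantiation well_ordered :: (finite) linorder
begin
definition less_eq_well_ordered :: "'a well_ordered \<Rightarrow> 'a well_ordered \<Rightarrow> bool" where
  "x \<le> y \<longleftrightarrow> to_nat (unWO x) \<le> to_nat (unWO y)"
definition less_well_ordered :: "'a well_ordered \<Rightarrow> 'a well_ordered \<Rightarrow> bool" where
  "x < y \<longleftrightarrow> to_nat (unWO x) < to_nat (unWO y)"
instance
  by standard (auto simp: less_eq_well_ordered_def less_well_ordered_def well_ordered.expand)
end

instance well_ordered :: (finite) wellorder
proof
  fix P :: "'a well_ordered \<Rightarrow> bool" and a
  assume step: "\<And>x. (\<And>y. y < x \<Longrightarrow> P y) \<Longrightarrow> P x"
  show "P a"
    by (induction a rule: measure_induct_rule[of "\<lambda>x. to_nat (unWO x)"])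
       (auto intro: step simp: less_well_ordered_def)
qed

lemma bij_unWO: "bij (unWO :: 'a well_ordered \<Rightarrow> 'a)"
  by (metis bijI' well_ordered.collapse well_ordered.sel)

lemma prod_Basis_cart:
  fixes x :: "real ^ 'n::finite"
  shows "(\<Prod>b\<in>Basis. f (x \<bullet> b)) = (\<Prod>i\<in>UNIV. f (x $ i))"
proof -
  have B: "Basis = (\<lambda>i::'n. axis i (1::real)) ` UNIV"
    by (auto simp: Basis_vec_def)
  have "inj (\<lambda>i::'n. axis i (1::real))"
    by (auto simp: inj_on_def axis_eq_axis)
  then show ?thesis
    unfolding B by (subst prod.reindex) (simp_all add: inner_axis)
qed

text \<open>
  Renaming coordinates maps boxes to boxes of the same volume.
\<close>
lemma lborel_reindex:
  fixes h :: "'m::finite \<Rightarrow> 'n::finite"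
  assumes "bij h"
  shows "distr lborel borel (\<lambda>x. \<chi> i. x $ h i) = (lborel :: (real ^ 'm) measure)"
proof (rule lborel_eqI[symmetric])
  fix l u :: "real ^ 'm::_"
  assume le: "\<And>b. b \<in> Basis \<Longrightarrow> l \<bullet> b \<le> u \<bullet> b"
  have le': "l $ i \<le> u $ i" for i
    using le[of "axis i 1"] by (simp add: inner_axis)
  define l' u' where "l' = (\<chi> j. l $ inv h j)" and "u' = (\<chi> j. u $ inv h j)"
  have hinv: "inv h (h i) = i" "h (inv h j) = j" for i j
    using assms by (simp_all add: bij_is_inj bij_is_surj surj_f_inv_f)
  have pre: "(\<lambda>x. \<chi> i. x $ h i) -` box l u = box l' u'"
    by (auto simp: mem_box_cart l'_def u'_def) (metis hinv)+
  have "continuous_on UNIV (\<lambda>x. (\<chi> i. x $ h i) :: real ^ 'm)"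
    by (intro continuous_intros)
  then have m: "(\<lambda>x. (\<chi> i. x $ h i) :: real ^ 'm) \<in> borel_measurable borel"
    by (rule borel_measurable_continuous_onI)
  have "emeasure (distr lborel borel (\<lambda>x. \<chi> i. x $ h i)) (box l u) = emeasure lborel (box l' u')"
    using m by (subst emeasure_distr) (auto simp: pre)
  also have "\<dots> = ennreal (\<Prod>b\<in>Basis. (u' - l') \<bullet> b)"
  proof (rule emeasure_lborel_box)
    fix b :: "real ^ 'n" assume "b \<in> Basis"
    then obtain j where "b = axis j 1" by (auto simp: Basis_vec_def)
    then show "l' \<bullet> b \<le> u' \<bullet> b" by (simp add: inner_axis l'_def u'_def le')
  qed
  also have "(\<Prod>b\<in>Basis. (u' - l') \<bullet> b) = (\<Prod>j\<in>UNIV. (u - l) $ inv h j)"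
    by (subst prod_Basis_cart[where f = "\<lambda>x. x"]) (simp add: l'_def u'_def)
  also have "\<dots> = (\<Prod>i\<in>UNIV. (u - l) $ i)"
    by (rule prod.reindex_bij_betw) (use assms in \<open>simp add: bij_imp_bij_inv\<close>)
  also have "\<dots> = (\<Prod>b\<in>Basis. (u - l) \<bullet> b)"
    by (rule prod_Basis_cart[where f = "\<lambda>x. x", symmetric])
  finally show "emeasure (distr lborel borel (\<lambda>x. \<chi> i. x $ h i)) (box l u) = ennreal (\<Prod>b\<in>Basis. (u - l) \<bullet> b)" .
qed simp

lemma matrix_vector_mult_borel [measurable]:
  "(*v) (A :: real ^ 'n ^ 'm) \<in> borel_measurable borel"
  by (intro borel_measurable_continuous_onI linear_continuous_on) auto

lemma lborel_unimodular_wellorder: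
  fixes A :: "real ^ 'n::{finite,wellorder} ^ 'n::_"
  assumes "\<bar>det A\<bar> = 1"
  shows "distr lborel borel ((*v) A) = lborel"
proof (rule lborel_eqI[symmetric])
  fix l u :: "real ^ 'n::_"
  assume le: "\<And>b. b \<in> Basis \<Longrightarrow> l \<bullet> b \<le> u \<bullet> b"
  have inv: "invertible A" using assms by (auto simp: invertible_det_nz)
  then obtain C where AC: "A ** C = mat 1" "C ** A = mat 1"
    by (auto simp: invertible_def)
  have "det A * det C = 1"
    using AC by (metis det_I det_mul)
  then have detC: "\<bar>det C\<bar> = 1" using assms by (metis abs_mult abs_one mult_1)
  have pre: "(*v) A -` box l u = (*v) C ` box l u"
  proof (intro equalityI subsetI)
    fix x assume "x \<in> (*v) A -` box l u"
    then show "x \<in> (*v) C ` box l u"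
      by (intro image_eqI[of _ _ "A *v x"]) (auto simp: matrix_vector_mul_assoc AC)
  qed (auto simp: matrix_vector_mul_assoc AC)
  have meas: "(*v) C ` box l u \<in> lmeasurable"
             "measure lebesgue ((*v) C ` box l u) = measure lebesgue (box l u)"
    using measurable_linear_image[of "(*v) C" "box l u"] measure_linear_image[of "(*v) C" "box l u"] detC
    by (simp_all add: matrix_of_matrix_vector_mul)
  have "(*v) A -` box l u \<inter> space borel \<in> sets borel"
    by (intro measurable_sets[OF matrix_vector_mult_borel]) auto
  then have b: "(*v) C ` box l u \<in> sets borel" by (simp add: pre)
  have "emeasure (distr lborel borel ((*v) A)) (box l u) = emeasure lborel ((*v) C ` box l u)"
    by (subst emeasure_distr) (auto simp: pre)
  also have "\<dots> = emeasure lebesgue ((*v) C ` box l u)"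
    using b by simp
  also have "\<dots> = ennreal (measure lebesgue (box l u))"
    using meas by (simp add: emeasure_eq_measure2)
  also have "\<dots> = ennreal (\<Prod>b\<in>Basis. (u - l) \<bullet> b)"
    using le by (simp add: measure_lborel_box_eq)
  finally show "emeasure (distr lborel borel ((*v) A)) (box l u) = ennreal (\<Prod>b\<in>Basis. (u - l) \<bullet> b)" .
qed simp

text \<open>
  Taking determinants in \<open>A\<^sup>T g A = g\<close> gives \<open>det A = 1\<close> or \<open>det A = -1\<close>. The relation is a matrix
  identity, so it can be copied entry by entry to the well-ordered index type and the determinant taken there.
\<close>
lemma lborel_form_preserving:
  fixes A g :: "real ^ 'n::finite ^ 'n"
  assumes form: "transpose A ** g ** A = g" and gg: "g ** g = mat 1"
  shows "distr lborel borel ((*v) A) = lborel"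
proof -
  define R :: "real ^ 'n ^ 'n \<Rightarrow> real ^ 'n well_ordered ^ 'n well_ordered"
    where "R M = (\<chi> i j. M $ unWO i $ unWO j)" for M
  define r :: "real ^ 'n \<Rightarrow> real ^ 'n well_ordered" where "r x = (\<chi> i. x $ unWO i)" for x
  define r' :: "real ^ 'n well_ordered \<Rightarrow> real ^ 'n" where "r' x = (\<chi> i. x $ WO i)" for x
  have sum: "(\<Sum>k\<in>UNIV. f (unWO k)) = (\<Sum>k\<in>UNIV. f k)" for f :: "'n \<Rightarrow> real"
    by (rule sum.reindex_bij_betw[OF bij_unWO])
  have Rmul: "R (M ** N) = R M ** R N" for M N
    by (simp add: R_def matrix_matrix_mult_def vec_eq_iff sum[symmetric])
  have Rtr: "R (transpose M) = transpose (R M)" for M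
    by (simp add: R_def transpose_def)
  have R1: "R (mat 1) = mat 1"
    by (auto simp: R_def mat_def vec_eq_iff well_ordered.expand)
  have rmul: "r (M *v x) = R M *v r x" for M x
    by (simp add: R_def r_def matrix_vector_mult_def vec_eq_iff sum[symmetric])
  have r'r: "r' (r x) = x" for x by (simp add: r_def r'_def)
  have "det (R A) * det (R g) * det (R A) = det (R g)"
    using form by (metis Rmul Rtr det_mul det_transpose)
  moreover have "det (R g) \<noteq> 0"
    using gg by (metis R1 Rmul det_I det_mul mult_zero_left zero_neq_one)
  ultimately have "(det (R A))\<^sup>2 = 1"
    by (simp add: power2_eq_square)
  then have "\<bar>det (R A)\<bar> = 1" by (simp add: abs_square_eq_1)
  then have RA: "distr lborel borel ((*v) (R A)) = lborel"
    by (rule lborel_unimodular_wellorder)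
  have lr: "distr lborel borel r = lborel"
    unfolding r_def by (rule lborel_reindex[OF bij_unWO])
  have "bij (WO :: 'n \<Rightarrow> _)"
    by (metis bijI' well_ordered.collapse well_ordered.sel)
  then have lr': "distr lborel borel r' = lborel"
    unfolding r'_def by (rule lborel_reindex)
  have [measurable]: "r \<in> borel_measurable borel" "r' \<in> borel_measurable borel"
    unfolding r_def r'_def by (intro borel_measurable_continuous_onI continuous_intros)+
  have "(*v) A = (\<lambda>x. r' (R A *v r x))"
    by (simp add: rmul[symmetric] r'r fun_eq_iff)
  then have "distr lborel borel ((*v) A) = distr (distr (distr lborel borel r) borel ((*v) (R A))) borel r'"
    by (simp add: distr_distr o_def)
  then show ?thesis by (simp add: lr RA lr')
qed

section \<open>Splitting spacetime into time and space\<close>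

definition spacetime :: "real \<Rightarrow> real ^ 'n::finite \<Rightarrow> real ^ 'n option" where
  "spacetime t w = (\<chi> \<mu>. case \<mu> of None \<Rightarrow> t | Some i \<Rightarrow> w $ i)"

lemma spacetime_nth [simp]: "spacetime t w $ None = t" "spacetime t w $ Some i = w $ i"
  by (simp_all add: spacetime_def)

lemma spatial_nth [simp]: "spatial x $ i = x $ Some i"
  by (simp add: spatial_def)

lemma spatial_spacetime [simp]: "spatial (spacetime t w) = w"
  by (simp add: vec_eq_iff)

lemma vec_option_eq_iff: "x = y \<longleftrightarrow> x $ None = y $ None \<and> spatial x = spatial y"
  by (simp add: vec_eq_iff split_option_all)

lemma sum_UNIV_option: "(\<Sum>\<mu>\<in>UNIV. f \<mu>) = f None + (\<Sum>i\<in>(UNIV::'n::finite set). f (Some i))"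
  by (simp add: UNIV_option_conv sum.reindex)

lemma prod_UNIV_option: "(\<Prod>\<mu>\<in>UNIV. f \<mu>) = f None * (\<Prod>i\<in>(UNIV::'n::finite set). f (Some i))"
  by (simp add: UNIV_option_conv prod.reindex)

lemma continuous_on_spacetime [continuous_intros]:
  assumes "continuous_on S f" "continuous_on S g"
  shows "continuous_on S (\<lambda>x. spacetime (f x) (g x))"
  unfolding spacetime_def
proof (rule continuous_on_vec_lambda)
  show "continuous_on S (\<lambda>x. case i of None \<Rightarrow> f x | Some i \<Rightarrow> g x $ i)" for i
    using assms by (cases i) (auto intro!: continuous_intros)
qed

lemma continuous_on_spatial [continuous_intros]:
  assumes "continuous_on S f" shows "continuous_on S (\<lambda>x. spatial (f x))"
  unfolding spatial_def by (intro continuous_intros assms)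

lemma borel_measurable_spacetime [measurable]:
  "(\<lambda>z. spacetime (fst z) (snd z)) \<in> borel \<Otimes>\<^sub>M borel \<rightarrow>\<^sub>M borel"
  unfolding borel_prod by (intro borel_measurable_continuous_onI continuous_intros)

lemma borel_measurable_spatial [measurable]: "spatial \<in> borel_measurable borel"
  by (intro borel_measurable_continuous_onI continuous_intros)

lemma lborel_spacetime:
  "distr (lborel \<Otimes>\<^sub>M lborel) borel (\<lambda>z. spacetime (fst z) (snd z))
     = (lborel :: (real ^ 'n::finite option) measure)"
proof (rule lborel_eqI[symmetric])
  fix l u :: "real ^ 'n option"
  assume le: "\<And>b. b \<in> Basis \<Longrightarrow> l \<bullet> b \<le> u \<bullet> b"
  have le': "l $ i \<le> u $ i" for i
    using le[of "axis i 1"] by (simp add: inner_axis)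
  have pre: "(\<lambda>z. spacetime (fst z) (snd z)) -` box l u
     = box (l $ None) (u $ None) \<times> box (spatial l) (spatial u)"
    by (auto simp: mem_box_cart split_option_all)
  have "emeasure (distr (lborel \<Otimes>\<^sub>M lborel) borel (\<lambda>z. spacetime (fst z) (snd z))) (box l u)
     = emeasure lborel (box (l $ None) (u $ None)) * emeasure lborel (box (spatial l) (spatial u))"
    by (subst emeasure_distr) (auto simp: pre space_pair_measure lborel.emeasure_pair_measure_Times)
  also have "emeasure lborel (box (spatial l) (spatial u)) = ennreal (\<Prod>b\<in>Basis. (spatial u - spatial l) \<bullet> b)"
  proof (rule emeasure_lborel_box)
    fix b :: "real ^ 'n" assume "b \<in> Basis"
    then obtain j where "b = axis j 1" by (auto simp: Basis_vec_def)
    then show "spatial l \<bullet> b \<le> spatial u \<bullet> b" by (simp add: inner_axis le')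
  qed
  also have "(\<Prod>b\<in>Basis. (spatial u - spatial l) \<bullet> b) = (\<Prod>i\<in>UNIV. (u - l) $ Some i)"
    by (subst prod_Basis_cart[where f = "\<lambda>x. x"]) simp
  also have "emeasure lborel (box (l $ None) (u $ None)) = ennreal ((u - l) $ None)"
    using le' by simp
  also have "ennreal ((u - l) $ None) * ennreal (\<Prod>i\<in>UNIV. (u - l) $ Some i)
     = ennreal (\<Prod>\<mu>\<in>UNIV. (u - l) $ \<mu>)"
    using le' by (simp add: prod_UNIV_option ennreal_mult prod_nonneg)
  also have "(\<Prod>\<mu>\<in>UNIV. (u - l) $ \<mu>) = (\<Prod>b\<in>Basis. (u - l) \<bullet> b)"
    by (rule prod_Basis_cart[where f = "\<lambda>x. x", symmetric])
  finally show "emeasure (distr (lborel \<Otimes>\<^sub>M lborel) borel (\<lambda>z. spacetime (fst z) (snd z))) (box l u)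
     = ennreal (\<Prod>b\<in>Basis. (u - l) \<bullet> b)" .
qed simp

lemma nn_integral_spacetime:
  fixes F :: "real ^ 'n::finite option \<Rightarrow> ennreal"
  assumes [measurable]: "F \<in> borel_measurable borel"
  shows "(\<integral>\<^sup>+x. F x \<partial>lborel) = (\<integral>\<^sup>+w. \<integral>\<^sup>+t. F (spacetime t w) \<partial>lborel \<partial>lborel)"
proof -
  have "(\<integral>\<^sup>+x. F x \<partial>lborel) = (\<integral>\<^sup>+z. F (spacetime (fst z) (snd z)) \<partial>(lborel \<Otimes>\<^sub>M lborel))"
    by (subst lborel_spacetime[symmetric], subst nn_integral_distr) auto
  also have "\<dots> = (\<integral>\<^sup>+w. \<integral>\<^sup>+t. F (spacetime t w) \<partial>lborel \<partial>lborel)"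
    by (subst lborel_pair.nn_integral_snd[symmetric]) (auto simp: case_prod_beta')
  finally show ?thesis .
qed

section \<open>Polar coordinates\<close>

lemma nn_integral_lborel_affine:
  fixes F :: "'a::euclidean_space \<Rightarrow> ennreal"
  assumes [measurable]: "F \<in> borel_measurable borel" and "c \<noteq> 0"
  shows "(\<integral>\<^sup>+x. F x \<partial>lborel) = ennreal (\<bar>c\<bar> ^ DIM('a)) * (\<integral>\<^sup>+x. F (t + c *\<^sub>R x) \<partial>lborel)"
proof -
  have "(\<integral>\<^sup>+x. F x \<partial>lborel)
     = (\<integral>\<^sup>+x. F x \<partial>density (distr lborel borel (\<lambda>x. t + c *\<^sub>R x)) (\<lambda>_. ennreal (\<bar>c\<bar> ^ DIM('a))))"
    using lborel_affine[OF assms(2), of t] by simp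
  also have "\<dots> = ennreal (\<bar>c\<bar> ^ DIM('a)) * (\<integral>\<^sup>+x. F (t + c *\<^sub>R x) \<partial>lborel)"
    by (simp add: nn_integral_density nn_integral_distr nn_integral_cmult)
  finally show ?thesis .
qed

lemma nn_integral_lborel_scale:
  fixes F :: "'a::euclidean_space \<Rightarrow> ennreal"
  assumes "F \<in> borel_measurable borel" and "c \<noteq> 0"
  shows "(\<integral>\<^sup>+x. F x \<partial>lborel) = ennreal (\<bar>c\<bar> ^ DIM('a)) * (\<integral>\<^sup>+x. F (c *\<^sub>R x) \<partial>lborel)"
  using nn_integral_lborel_affine[OF assms, of 0] by simp

lemma nn_integral_power_tail:
  fixes a :: real
  assumes "a > 0" "d > 0"
  shows "(\<integral>\<^sup>+t. ennreal (real d * a ^ d / t ^ Suc d) * indicator {a..} t \<partial>lborel) = 1"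
proof -
  have "(\<integral>\<^sup>+t. ennreal (real d * a ^ d / t ^ Suc d) * indicator {a..} t \<partial>lborel)
     = ennreal (0 - (- ((a / a) ^ d)))"
  proof (rule nn_integral_FTC_atLeast[where F = "\<lambda>t. - ((a / t) ^ d)"])
    fix t assume "a \<le> t"
    then have "t > 0" using assms by simp
    obtain e where e: "d = Suc e" using assms(2) by (cases d) auto
    have "((\<lambda>t. a / t) has_real_derivative - (a / t\<^sup>2)) (at t)"
      using \<open>t > 0\<close> by (auto intro!: derivative_eq_intros simp: power2_eq_square)
    from DERIV_minus[OF DERIV_power[OF this, of d]]
    have "((\<lambda>t. - ((a / t) ^ d)) has_real_derivative - (real d * (- (a / t\<^sup>2) * (a / t) ^ e))) (at t)"
      by (simp add: e)
    then show "((\<lambda>t. - ((a / t) ^ d)) has_real_derivative real d * a ^ d / t ^ Suc d) (at t)"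
      by (rule DERIV_cong) (use \<open>t > 0\<close> in \<open>simp add: e power_divide power2_eq_square\<close>)
  next
    have "((\<lambda>t. - ((a / t) ^ d)) \<longlongrightarrow> - ((0::real) ^ d)) at_top"
      by (intro tendsto_intros tendsto_divide_0[OF tendsto_const] filterlim_at_top_imp_at_infinity filterlim_ident)
    then show "((\<lambda>t. - ((a / t) ^ d)) \<longlongrightarrow> 0) at_top"
      using assms(2) by (metis minus_zero zero_power)
  qed (use assms in auto)
  then show ?thesis using assms by simp
qed

lemma sgn_borel_measurable [measurable]:
  "(sgn :: 'a::euclidean_space \<Rightarrow> 'a) \<in> borel_measurable borel"
  unfolding sgn_div_norm[abs_def] by measurable

lemma sets_cball_borel [measurable]: "cball (x :: 'a::euclidean_space) r \<in> sets borel"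
  by (intro borel_closed closed_cball)

lemma nn_integral_sphere_measure:
  fixes H :: "'a::euclidean_space \<Rightarrow> ennreal"
  assumes [measurable]: "H \<in> borel_measurable borel"
  shows "(\<integral>\<^sup>+\<omega>. H \<omega> \<partial>sphere_measure)
    = (\<integral>\<^sup>+x. ennreal (real DIM('a)) * indicator (cball 0 1 - {0}) x * H (sgn x) \<partial>lborel)"
  unfolding sphere_measure_def
  by (subst nn_integral_distr, simp, simp, subst nn_integral_density) simp_all

lemma sets_sphere_measure [simp, measurable_cong]: "sets sphere_measure = sets borel"
  by (simp add: sphere_measure_def)

lemma space_sphere_measure [simp]: "space sphere_measure = UNIV"
  by (simp add: sphere_measure_def)

text \<open>
  The surface measure is defined through the solid ball, so the right-hand side is an integral over a
  point \<open>x\<close> of the unit ball and a radius. Replacing the radius by \<open>|x| t\<close> removes the normalisation of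
  \<open>x\<close>, scaling \<open>y = t x\<close> turns the argument of \<open>g\<close> into \<open>y\<close>, and the remaining integral over \<open>t\<close> runs
  over the tail \<open>t \<ge> |y|\<close> and equals 1 by \<open>nn_integral_power_tail\<close>.
\<close>
lemma nn_integral_polar:
  fixes g :: "'a::euclidean_space \<Rightarrow> ennreal"
  assumes [measurable]: "g \<in> borel_measurable borel"
  shows "(\<integral>\<^sup>+x. g x \<partial>lborel)
    = (\<integral>\<^sup>+\<omega>. \<integral>\<^sup>+r. ennreal (r ^ (DIM('a) - 1)) * indicator {0<..} r * g (r *\<^sub>R \<omega>) \<partial>lborel \<partial>sphere_measure)"
proof -
  define d where "d = DIM('a)"
  obtain e where e: "d = Suc e" using DIM_positive[where 'a='a] by (cases d) (auto simp: d_def)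
  define H where "H \<omega> = (\<integral>\<^sup>+r. ennreal (r ^ e) * indicator {0<..} r * g (r *\<^sub>R \<omega>) \<partial>lborel)" for \<omega> :: 'a
  have [measurable]: "H \<in> borel_measurable borel"
    unfolding H_def by measurable
  define \<Phi> where "\<Phi> x t = ennreal (real d * norm x ^ d * t ^ e) * indicator {0<..} t
      * indicator (cball 0 1 - {0}) x * g (t *\<^sub>R x)" for x :: 'a and t :: real
  have [measurable]: "(\<lambda>z. \<Phi> (fst z) (snd z)) \<in> borel_measurable (borel \<Otimes>\<^sub>M borel)"
    unfolding \<Phi>_def by measurable
  have "(\<integral>\<^sup>+\<omega>. H \<omega> \<partial>sphere_measure)
    = (\<integral>\<^sup>+x. ennreal (real d) * indicator (cball 0 1 - {0}) x * H (sgn x) \<partial>lborel)"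
    by (simp add: nn_integral_sphere_measure d_def)
  also have "\<dots> = (\<integral>\<^sup>+x. \<integral>\<^sup>+t. \<Phi> x t \<partial>lborel \<partial>lborel)"
  proof (rule nn_integral_cong)
    fix x :: 'a
    show "ennreal (real d) * indicator (cball 0 1 - {0}) x * H (sgn x) = (\<integral>\<^sup>+t. \<Phi> x t \<partial>lborel)"
    proof (cases "x \<in> cball 0 1 - {0}")
      case True
      then have nx: "norm x > 0" by auto
      then have sx: "(norm x * t) *\<^sub>R sgn x = t *\<^sub>R x" for t
        by (simp add: sgn_div_norm)
      have "H (sgn x) = ennreal \<bar>norm x\<bar> * (\<integral>\<^sup>+t. ennreal ((0 + norm x * t) ^ e) * indicator {0<..} (0 + norm x * t)
          * g ((0 + norm x * t) *\<^sub>R sgn x) \<partial>lborel)"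
        unfolding H_def using nx by (intro nn_integral_real_affine) auto
      also have "\<dots> = ennreal (norm x) * (\<integral>\<^sup>+t. ennreal ((norm x * t) ^ e) * indicator {0<..} t * g (t *\<^sub>R x) \<partial>lborel)"
      proof -
        have "ennreal ((0 + norm x * t) ^ e) * indicator {0<..} (0 + norm x * t) * g ((0 + norm x * t) *\<^sub>R sgn x)
            = ennreal ((norm x * t) ^ e) * indicator {0<..} t * g (t *\<^sub>R x)" for t
          unfolding add_0_left sx using nx by (simp add: indicator_def zero_less_mult_iff)
        then show ?thesis by (simp only: abs_norm_cancel)
      qed
      also have "\<dots> = (\<integral>\<^sup>+t. ennreal (norm x) * (ennreal ((norm x * t) ^ e) * indicator {0<..} t * g (t *\<^sub>R x)) \<partial>lborel)"
        by (rule nn_integral_cmult[symmetric]) measurable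
      finally have "ennreal (real d) * H (sgn x)
         = (\<integral>\<^sup>+t. ennreal (real d) * (ennreal (norm x) * (ennreal ((norm x * t) ^ e) * indicator {0<..} t * g (t *\<^sub>R x))) \<partial>lborel)"
        by (simp add: nn_integral_cmult)
      also have "\<dots> = (\<integral>\<^sup>+t. \<Phi> x t \<partial>lborel)"
      proof (rule nn_integral_cong)
        fix t :: real
        have eq: "real d * norm x * (norm x * t) ^ e = real d * norm x ^ d * t ^ e"
          by (simp add: e power_mult_distrib)
        show "ennreal (real d) * (ennreal (norm x) * (ennreal ((norm x * t) ^ e) * indicator {0<..} t * g (t *\<^sub>R x))) = \<Phi> x t"
          using True by (cases "t > 0")
            (simp_all add: \<Phi>_def mult.assoc[symmetric] ennreal_mult[symmetric] eq)
      qed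
      finally show ?thesis using True by simp
    qed (simp add: \<Phi>_def)
  qed
  also have "\<dots> = (\<integral>\<^sup>+t. \<integral>\<^sup>+x. \<Phi> x t \<partial>lborel \<partial>lborel)"
    by (rule lborel_pair.Fubini'[symmetric]) (simp add: case_prod_beta')
  also have "\<dots> = (\<integral>\<^sup>+t. \<integral>\<^sup>+y. g y * (ennreal (real d * norm y ^ d / t ^ Suc d) * indicator {norm y..} t) * indicator (-{0}) y \<partial>lborel \<partial>lborel)"
  proof (rule nn_integral_cong)
    fix t :: real
    show "(\<integral>\<^sup>+x. \<Phi> x t \<partial>lborel)
      = (\<integral>\<^sup>+y. g y * (ennreal (real d * norm y ^ d / t ^ Suc d) * indicator {norm y..} t) * indicator (-{0}) y \<partial>lborel)"
    proof (cases "t > 0")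
      case True
      have "(\<integral>\<^sup>+x. \<Phi> x t \<partial>lborel) = ennreal (\<bar>1 / t\<bar> ^ DIM('a)) * (\<integral>\<^sup>+y. \<Phi> ((1 / t) *\<^sub>R y) t \<partial>lborel)"
        using True by (intro nn_integral_lborel_scale) (auto simp: \<Phi>_def)
      also have "\<dots> = (\<integral>\<^sup>+y. ennreal ((1 / t) ^ d) * \<Phi> ((1 / t) *\<^sub>R y) t \<partial>lborel)"
        using True by (subst nn_integral_cmult) (auto simp: \<Phi>_def d_def)
      also have "\<dots> = (\<integral>\<^sup>+y. g y * (ennreal (real d * norm y ^ d / t ^ Suc d) * indicator {norm y..} t) * indicator (-{0}) y \<partial>lborel)"
      proof (rule nn_integral_cong)
        fix y :: 'a
        show "ennreal ((1 / t) ^ d) * \<Phi> ((1 / t) *\<^sub>R y) t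
          = g y * (ennreal (real d * norm y ^ d / t ^ Suc d) * indicator {norm y..} t) * indicator (-{0}) y"
        proof (cases "y \<noteq> 0 \<and> norm y \<le> t")
          case True
          have "(1 / t) ^ d * (real d * (norm y / t) ^ d * t ^ e) = real d * norm y ^ d / t ^ Suc d"
            using \<open>t > 0\<close> by (simp add: e power_divide field_simps)
          then show ?thesis using True \<open>t > 0\<close>
            by (simp add: \<Phi>_def indicator_def mult.assoc[symmetric] ennreal_mult[symmetric] del: power_Suc)
               (simp add: mult.commute)
        qed (use \<open>t > 0\<close> in \<open>auto simp: \<Phi>_def indicator_def\<close>)
      qed
      finally show ?thesis .
    next
      case False
      then have zero: "indicator {norm y..} t * indicator (-{0}) y = (0 :: ennreal)" for y :: 'a
        by (cases "y = 0") (auto simp: indicator_def intro: less_le_trans[of 0 "norm y"])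
      then show ?thesis
        using False unfolding mult.assoc zero by (simp add: \<Phi>_def)
    qed
  qed
  also have "\<dots> = (\<integral>\<^sup>+y. \<integral>\<^sup>+t. g y * (ennreal (real d * norm y ^ d / t ^ Suc d) * indicator {norm y..} t) * indicator (-{0}) y \<partial>lborel \<partial>lborel)"
    by (rule lborel_pair.Fubini') (simp add: case_prod_beta' indicator_def)
  also have "\<dots> = (\<integral>\<^sup>+y. g y * indicator (-{0}) y \<partial>lborel)"
  proof (rule nn_integral_cong)
    fix y :: 'a
    show "(\<integral>\<^sup>+t. g y * (ennreal (real d * norm y ^ d / t ^ Suc d) * indicator {norm y..} t) * indicator (-{0}) y \<partial>lborel)
      = g y * indicator (-{0}) y"
      using nn_integral_power_tail[of "norm y" d] e
      by (cases "y = 0") (simp_all add: nn_integral_cmult)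
  qed
  also have "\<dots> = (\<integral>\<^sup>+y. g y \<partial>lborel)"
    by (intro nn_integral_cong_AE) (use AE_lborel_singleton[of "0::'a"] in \<open>auto elim!: eventually_mono\<close>)
  finally show ?thesis
    by (simp add: H_def e d_def[symmetric])
qed

lemma finite_measure_sphere_measure: "finite_measure (sphere_measure :: 'a::euclidean_space measure)"
proof (rule finite_measureI)
  have "emeasure (sphere_measure :: 'a measure) UNIV
     = (\<integral>\<^sup>+(x::'a). ennreal (real DIM('a)) * indicator (cball 0 1 - {0}) x \<partial>lborel)"
    using nn_integral_sphere_measure[of "\<lambda>_::'a. 1"] by simp
  also have "\<dots> \<le> ennreal (real DIM('a)) * emeasure lborel (cball (0::'a) 1)"
    by (subst nn_integral_cmult) (auto intro!: mult_left_mono emeasure_mono)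
  also have "\<dots> < \<infinity>"
    using emeasure_lborel_cball_finite[of "0::'a" 1] by (simp add: ennreal_mult_less_top)
  finally show "emeasure (sphere_measure :: 'a measure) (space sphere_measure) \<noteq> \<infinity>"
    by simp
qed

lemma AE_sphere_measure: "AE \<omega> in sphere_measure. norm (\<omega> :: 'a::euclidean_space) = 1"
  unfolding sphere_measure_def
  by (auto simp: AE_distr_iff AE_density norm_sgn indicator_def intro!: AE_I2)

section \<open>The Minkowski form and the future cone\<close>

lemma mink_prod_eq: "mink_prod x y = spatial x \<bullet> spatial y - x $ None * y $ None"
proof -
  have "mink_prod x y = (\<Sum>\<mu>\<in>UNIV. minkowski $ \<mu> $ \<mu> * x $ \<mu> * y $ \<mu>)"
    unfolding mink_prod_def
  proof (rule sum.cong[OF refl])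
    fix \<mu>
    show "(\<Sum>\<nu>\<in>UNIV. minkowski $ \<mu> $ \<nu> * x $ \<mu> * y $ \<nu>) = minkowski $ \<mu> $ \<mu> * x $ \<mu> * y $ \<mu>"
      by (subst sum.remove[of _ \<mu>]) (auto simp: minkowski_def intro!: sum.neutral)
  qed
  then show ?thesis
    by (simp add: sum_UNIV_option minkowski_def inner_vec_def)
qed

lemma mink_prod_matrix: "mink_prod x y = x \<bullet> (minkowski *v y)"
  by (simp add: mink_prod_def inner_vec_def matrix_vector_mult_def sum_distrib_left mult_ac)

lemma inner_transpose_matrix_vector:
  "x \<bullet> (transpose A *v y) = (A *v x) \<bullet> y" for A :: "real ^ 'n::finite ^ 'm::finite"
  by (metis dot_lmul_matrix inner_commute transpose_matrix_vector)

lemma mink_prod_lorentz: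
  fixes B :: "real ^ 'n::finite option ^ 'n option"
  assumes "transpose B ** minkowski ** B = minkowski"
  shows "mink_prod (B *v x) (B *v y) = mink_prod x y"
proof -
  have "mink_prod (B *v x) (B *v y) = x \<bullet> (transpose B *v (minkowski *v (B *v y)))"
    by (simp only: mink_prod_matrix inner_transpose_matrix_vector)
  also have "\<dots> = mink_prod x y"
    using assms by (simp add: mink_prod_matrix matrix_vector_mul_assoc matrix_mul_assoc)
  finally show ?thesis .
qed

lemma minkowski_involution: "minkowski ** minkowski = mat 1"
  unfolding vec_eq_iff
proof (intro allI)
  fix \<mu> \<nu> :: "'a option"
  have "(\<Sum>k\<in>UNIV. minkowski $ \<mu> $ k * minkowski $ k $ \<nu>) = minkowski $ \<mu> $ \<mu> * minkowski $ \<mu> $ \<nu>"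
    by (subst sum.remove[of _ \<mu>]) (auto simp: minkowski_def intro!: sum.neutral)
  then show "(minkowski ** minkowski) $ \<mu> $ \<nu> = mat 1 $ \<mu> $ \<nu>"
    by (auto simp: matrix_matrix_mult_def mat_def minkowski_def)
qed

lemma distr_lborel_lorentz:
  fixes B :: "real ^ 'n::finite option ^ 'n option"
  assumes "transpose B ** minkowski ** B = minkowski"
  shows "distr lborel borel ((*v) B) = lborel"
  by (rule lborel_form_preserving[OF assms minkowski_involution])

text \<open>
  The reversed Cauchy-Schwarz inequality: for future timelike vectors the product of the times dominates
  the product of the spatial lengths.
\<close>
lemma mink_prod_future_neg:
  assumes "0 < x $ None" "mink_prod x x < 0" "0 < y $ None" "mink_prod y y < 0"
  shows "mink_prod x y < 0"
proof -
  have "(norm (spatial x))\<^sup>2 < (x $ None)\<^sup>2" "(norm (spatial y))\<^sup>2 < (y $ None)\<^sup>2"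
    using assms(2,4) by (simp_all add: mink_prod_eq dot_square_norm flip: power2_eq_square)
  then have "norm (spatial x) < x $ None" "norm (spatial y) < y $ None"
    using assms(1,3) by (meson less_imp_le power2_less_imp_less)+
  then have "norm (spatial x) * norm (spatial y) < x $ None * y $ None"
    by (intro mult_strict_mono') auto
  then show ?thesis
    using norm_cauchy_schwarz[of "spatial x" "spatial y"] by (simp add: mink_prod_eq)
qed

lemma mink_prod_uminus [simp]: "mink_prod (- x) y = - mink_prod x y" "mink_prod x (- y) = - mink_prod x y"
  by (simp_all add: mink_prod_def sum_negf)

lemma timelike_time_nz: "mink_prod x x < 0 \<Longrightarrow> x $ None \<noteq> 0"
  using inner_ge_zero[of "spatial x"] by (intro notI) (simp add: mink_prod_eq)

text \<open>
  A form-preserving map sends the timelike vectors to timelike vectors and therefore either keeps or swaps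
  the two halves of the cone; one future vector \<open>a\<close> with future image decides which. If some future \<open>x\<close>
  had a past image, \<open>mink_prod_future_neg\<close> would give opposite signs to the product of \<open>a\<close> and \<open>x\<close> and
  to the product of their images.
\<close>
lemma future_lorentz_iff:
  fixes B :: "real ^ 'n::finite option ^ 'n option"
  assumes B: "transpose B ** minkowski ** B = minkowski"
    and a: "0 < a $ None" "mink_prod a a < 0" "0 < (B *v a) $ None"
    and x: "mink_prod x x < 0"
  shows "0 < (B *v x) $ None \<longleftrightarrow> 0 < x $ None"
proof -
  have *: "0 < (B *v x) $ None" if "0 < x $ None" "mink_prod x x < 0" for x
  proof (rule ccontr)
    assume neg: "\<not> 0 < (B *v x) $ None"
    have tl: "mink_prod (B *v x) (B *v x) < 0" using that B by (simp add: mink_prod_lorentz)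
    then have "0 < (- (B *v x)) $ None"
      using neg timelike_time_nz[OF tl] by simp
    then have "mink_prod (B *v a) (- (B *v x)) < 0"
      using a tl B by - (rule mink_prod_future_neg, auto simp: mink_prod_lorentz)
    moreover have "mink_prod a x < 0" using a(1,2) that by (rule mink_prod_future_neg)
    ultimately show False using B by (simp add: mink_prod_lorentz)
  qed
  show ?thesis
  proof
    assume "0 < (B *v x) $ None"
    show "0 < x $ None"
    proof (rule ccontr)
      assume "\<not> 0 < x $ None"
      then have "0 < (- x) $ None" using timelike_time_nz[OF x] by simp
      then have "0 < (B *v (- x)) $ None" using x by (intro *) auto
      then show False using \<open>0 < (B *v x) $ None\<close>
        by (simp add: matrix_vector_mult_def sum_negf)
    qed
  next
    assume "0 < x $ None"
    then show "0 < (B *v x) $ None" using x by (rule *)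
  qed
qed

section \<open>Lorentz invariance of the measure on the mass shell\<close>

lemma energy_pos: "c > 0 \<Longrightarrow> 0 < energy c p"
  unfolding energy_def by (intro real_sqrt_gt_zero add_pos_nonneg) auto

lemma energy_squared: "(energy c p)\<^sup>2 = c\<^sup>2 + (norm p)\<^sup>2"
  by (simp add: energy_def)

lemma continuous_on_energy [continuous_intros]:
  "continuous_on S f \<Longrightarrow> continuous_on S (\<lambda>x. energy c (f x))"
  unfolding energy_def by (intro continuous_intros)

lemma borel_measurable_energy [measurable]: "energy c \<in> borel_measurable borel"
  unfolding energy_def[abs_def] by measurable

lemma four_momentum_spacetime: "four_momentum c p = spacetime (energy c p) p"
  by (simp add: four_momentum_def spacetime_def)

lemma borel_measurable_four_momentum [measurable]: "four_momentum c \<in> borel_measurable borel"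
  unfolding four_momentum_spacetime[abs_def]
  by (intro borel_measurable_continuous_onI continuous_intros)

lemma borel_measurable_vec_nth [measurable (raw)]:
  fixes f :: "'a \<Rightarrow> real ^ 'n::finite"
  assumes "f \<in> borel_measurable M" shows "(\<lambda>x. f x $ i) \<in> borel_measurable M"
proof -
  have "(\<lambda>x::real ^ 'n. x $ i) \<in> borel_measurable borel"
    by (intro borel_measurable_continuous_onI continuous_intros)
  then show ?thesis using assms by (rule measurable_compose_rev)
qed

lemma borel_measurable_mink_prod [measurable (raw)]:
  assumes [measurable]: "f \<in> borel_measurable M" "g \<in> borel_measurable M"
  shows "(\<lambda>x. mink_prod (f x) (g x)) \<in> borel_measurable M"
  unfolding mink_prod_def by measurable

lemma borel_measurable_spacetime_pair [measurable (raw)]: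
  "f \<in> borel_measurable M \<Longrightarrow> g \<in> borel_measurable M \<Longrightarrow> (\<lambda>x. spacetime (f x) (g x)) \<in> borel_measurable M"
  using measurable_compose[OF _ borel_measurable_spacetime, of "\<lambda>x. (f x, g x)" M] by simp

text \<open>
  The region swept by the mass shells of mass at most 1.
\<close>
definition unit_mass_cone :: "(real ^ 'n::finite option) set" where
  "unit_mass_cone = {x. 0 < x $ None \<and> 0 < - mink_prod x x \<and> - mink_prod x x \<le> 1}"

lemma sets_unit_mass_cone [measurable]: "unit_mass_cone \<in> sets borel"
  unfolding unit_mass_cone_def by measurable

text \<open>
  At a fixed spatial part \<open>u\<close>, the mass \<open>m\<close> replaces the time \<open>t = sqrt (m\<^sup>2 + |u|\<^sup>2)\<close> as integration
  variable. The restriction \<open>u \<noteq> 0\<close> makes this substitution differentiable at \<open>m = 0\<close>.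
\<close>
lemma nn_integral_mass_shell_ray:
  fixes u :: "real ^ 'n::finite" and F :: "real \<Rightarrow> ennreal"
  assumes [measurable]: "F \<in> borel_measurable borel" and "u \<noteq> 0"
  shows "(\<integral>\<^sup>+t. indicator unit_mass_cone (spacetime t u) * F t \<partial>lborel)
    = (\<integral>\<^sup>+m. indicator {0<..1} m * ennreal (m / sqrt (m\<^sup>2 + (norm u)\<^sup>2)) * F (sqrt (m\<^sup>2 + (norm u)\<^sup>2)) \<partial>lborel)"
proof -
  define g where "g m = sqrt (m\<^sup>2 + (norm u)\<^sup>2)" for m
  define f where "f t = indicator unit_mass_cone (spacetime t u) * F t" for t
  have nu: "norm u > 0" using \<open>u \<noteq> 0\<close> by simp
  have gpos: "g m > 0" for m
    unfolding g_def using nu by (intro real_sqrt_gt_zero add_nonneg_pos) auto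
  have cone: "spacetime t u \<in> unit_mass_cone \<longleftrightarrow> 0 < t \<and> (norm u)\<^sup>2 < t\<^sup>2 \<and> t\<^sup>2 \<le> 1 + (norm u)\<^sup>2" for t
    by (auto simp: unit_mass_cone_def mink_prod_eq dot_square_norm simp flip: power2_eq_square)
  have [measurable]: "f \<in> borel_measurable borel"
    unfolding f_def by measurable
  have "(\<integral>\<^sup>+t. f t \<partial>lborel) = (\<integral>\<^sup>+t. f t * indicator {g 0..g 1} t \<partial>lborel)"
  proof (rule nn_integral_cong)
    fix t
    have "t \<in> {g 0..g 1}" if "spacetime t u \<in> unit_mass_cone"
    proof -
      have t: "0 < t" "(norm u)\<^sup>2 < t\<^sup>2" "t\<^sup>2 \<le> 1 + (norm u)\<^sup>2" using that cone by auto
      have "norm u \<le> t" by (rule power2_le_imp_le[OF less_imp_le[OF t(2)] less_imp_le[OF t(1)]])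
      moreover have "t \<le> sqrt (1 + (norm u)\<^sup>2)" by (rule real_le_rsqrt) (rule t)
      ultimately show ?thesis by (simp add: g_def)
    qed
    then show "f t = f t * indicator {g 0..g 1} t"
      by (auto simp: f_def indicator_def)
  qed
  also have "\<dots> = (\<integral>\<^sup>+m. f (g m) * ennreal (m / g m) * indicator {0..1} m \<partial>lborel)"
  proof (rule nn_integral_substitution_aux)
    fix m :: real assume "m \<in> {0..1}"
    have "m\<^sup>2 + (norm u)\<^sup>2 > 0" using nu by (intro add_nonneg_pos) auto
    then show "(g has_real_derivative m / g m) (at m)"
      unfolding g_def by (auto intro!: derivative_eq_intros simp: divide_simps)
    show "m / g m \<ge> 0" using \<open>m \<in> {0..1}\<close> gpos[of m] by simp
  next
    show "continuous_on {0..1} (\<lambda>m. m / g m)"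
      using gpos by (intro continuous_intros) (auto simp: g_def less_le intro!: continuous_intros)
  qed auto
  also have "\<dots> = (\<integral>\<^sup>+m. indicator {0<..1} m * ennreal (m / g m) * F (g m) \<partial>lborel)"
  proof (rule nn_integral_cong)
    fix m :: real
    show "f (g m) * ennreal (m / g m) * indicator {0..1} m = indicator {0<..1} m * ennreal (m / g m) * F (g m)"
    proof (cases "m \<in> {0<..1}")
      case True
      then have "spacetime (g m) u \<in> unit_mass_cone"
        unfolding cone using gpos[of m] by (simp add: g_def power_le_one)
      then show ?thesis using True by (simp add: f_def mult_ac)
    next
      case False
      then show ?thesis by (cases "m = 0") (auto simp: indicator_def)
    qed
  qed
  finally show ?thesis by (simp add: f_def g_def)
qed

text \<open>
  Mass and rescaled momentum serve as coordinates of the cone: the point with mass \<open>m\<close> over \<open>(m / c) p\<close> is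
  \<open>m / c\<close> times the four-momentum of \<open>p\<close>. Since the integrand depends only on the ray through the point,
  the integral over \<open>m\<close> splits off as a constant.
\<close>
lemma nn_integral_unit_mass_cone:
  fixes G :: "real ^ 'n::finite option \<Rightarrow> ennreal"
  assumes [measurable]: "G \<in> borel_measurable borel" and c: "c > 0"
  shows "(\<integral>\<^sup>+x. indicator unit_mass_cone x * G ((c / sqrt (- mink_prod x x)) *\<^sub>R x) \<partial>lborel)
    = (\<integral>\<^sup>+m. indicator {0<..1} m * ennreal (c * (m / c) ^ CARD('n)) \<partial>lborel)
      * (\<integral>\<^sup>+p. ennreal (1 / energy c p) * G (four_momentum c p) \<partial>lborel)"
proof -
  define e where "e m u = sqrt (m\<^sup>2 + (norm u)\<^sup>2)" for m :: real and u :: "real ^ 'n"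
  have [measurable]: "(\<lambda>z. e (fst z) (snd z)) \<in> borel_measurable (borel \<Otimes>\<^sub>M borel)"
    unfolding e_def by measurable
  define \<Psi> where "\<Psi> m u = indicator {0<..1} m * ennreal (m / e m u) * G ((c / m) *\<^sub>R spacetime (e m u) u)" for m u
  have [measurable]: "(\<lambda>z. \<Psi> (fst z) (snd z)) \<in> borel_measurable (borel \<Otimes>\<^sub>M borel)"
    unfolding \<Psi>_def by measurable
  have "(\<integral>\<^sup>+x. indicator unit_mass_cone x * G ((c / sqrt (- mink_prod x x)) *\<^sub>R x) \<partial>lborel)
    = (\<integral>\<^sup>+u. \<integral>\<^sup>+t. indicator unit_mass_cone (spacetime t u) *
        G ((c / sqrt (- mink_prod (spacetime t u) (spacetime t u))) *\<^sub>R spacetime t u) \<partial>lborel \<partial>lborel)"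
    by (rule nn_integral_spacetime) measurable
  also have "\<dots> = (\<integral>\<^sup>+u. \<integral>\<^sup>+m. \<Psi> m u \<partial>lborel \<partial>lborel)"
  proof (rule nn_integral_cong_AE, rule eventually_mono[OF AE_lborel_singleton[of 0]])
    fix u :: "real ^ 'n" assume "u \<noteq> 0"
    have "(\<integral>\<^sup>+t. indicator unit_mass_cone (spacetime t u) *
        G ((c / sqrt (- mink_prod (spacetime t u) (spacetime t u))) *\<^sub>R spacetime t u) \<partial>lborel)
      = (\<integral>\<^sup>+m. indicator {0<..1} m * ennreal (m / e m u) *
        G ((c / sqrt (- mink_prod (spacetime (e m u) u) (spacetime (e m u) u))) *\<^sub>R spacetime (e m u) u) \<partial>lborel)"
      unfolding e_def by (rule nn_integral_mass_shell_ray[OF _ \<open>u \<noteq> 0\<close>]) measurable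
    also have "\<dots> = (\<integral>\<^sup>+m. \<Psi> m u \<partial>lborel)"
    proof (rule nn_integral_cong)
      fix m :: real
      have "- mink_prod (spacetime (e m u) u) (spacetime (e m u) u) = m\<^sup>2"
        by (simp add: mink_prod_eq e_def power2_norm_eq_inner)
      then show "indicator {0<..1} m * ennreal (m / e m u) *
        G ((c / sqrt (- mink_prod (spacetime (e m u) u) (spacetime (e m u) u))) *\<^sub>R spacetime (e m u) u) = \<Psi> m u"
        by (auto simp: \<Psi>_def indicator_def)
    qed
    finally show "(\<integral>\<^sup>+t. indicator unit_mass_cone (spacetime t u) *
        G ((c / sqrt (- mink_prod (spacetime t u) (spacetime t u))) *\<^sub>R spacetime t u) \<partial>lborel)
      = (\<integral>\<^sup>+m. \<Psi> m u \<partial>lborel)" .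
  qed
  also have "\<dots> = (\<integral>\<^sup>+m. \<integral>\<^sup>+u. \<Psi> m u \<partial>lborel \<partial>lborel)"
    by (rule lborel_pair.Fubini') (simp add: case_prod_beta')
  also have "\<dots> = (\<integral>\<^sup>+m. indicator {0<..1} m * ennreal (c * (m / c) ^ CARD('n))
       * (\<integral>\<^sup>+p. ennreal (1 / energy c p) * G (four_momentum c p) \<partial>lborel) \<partial>lborel)"
  proof (rule nn_integral_cong)
    fix m :: real
    show "(\<integral>\<^sup>+u. \<Psi> m u \<partial>lborel) = indicator {0<..1} m * ennreal (c * (m / c) ^ CARD('n))
       * (\<integral>\<^sup>+p. ennreal (1 / energy c p) * G (four_momentum c p) \<partial>lborel)"
    proof (cases "m \<in> {0<..1}")
      case True
      then have m: "m > 0" by simp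
      have em: "e m ((m / c) *\<^sub>R p) = (m / c) * energy c p" for p
      proof -
        have "m\<^sup>2 + (norm ((m / c) *\<^sub>R p))\<^sup>2 = (m / c)\<^sup>2 * (c\<^sup>2 + (norm p)\<^sup>2)"
          using c m by (simp add: power_mult_distrib power_divide distrib_left)
        then show ?thesis
          unfolding e_def energy_def using c m by (simp add: real_sqrt_mult)
      qed
      have sp: "(c / m) *\<^sub>R spacetime ((m / c) * energy c p) ((m / c) *\<^sub>R p) = four_momentum c p" for p
        using c m by (simp add: vec_option_eq_iff four_momentum_spacetime vec_eq_iff)
      have "(\<integral>\<^sup>+u. \<Psi> m u \<partial>lborel)
        = ennreal (\<bar>m / c\<bar> ^ DIM(real ^ 'n)) * (\<integral>\<^sup>+p. \<Psi> m ((m / c) *\<^sub>R p) \<partial>lborel)"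
        using c m by (intro nn_integral_lborel_scale) (auto simp: \<Psi>_def e_def)
      also have "(\<integral>\<^sup>+p. \<Psi> m ((m / c) *\<^sub>R p) \<partial>lborel)
        = (\<integral>\<^sup>+p. ennreal c * (ennreal (1 / energy c p) * G (four_momentum c p)) \<partial>lborel)"
      proof (rule nn_integral_cong)
        fix p :: "real ^ 'n"
        have "m / ((m / c) * energy c p) = c * (1 / energy c p)"
          using c m energy_pos[OF c, of p] by (simp add: field_simps)
        then show "\<Psi> m ((m / c) *\<^sub>R p) = ennreal c * (ennreal (1 / energy c p) * G (four_momentum c p))"
          unfolding \<Psi>_def em sp using True c energy_pos[OF c, of p]
          by (simp only: ennreal_mult' mult.assoc) simp
      qed
      also have "\<dots> = ennreal c * (\<integral>\<^sup>+p. ennreal (1 / energy c p) * G (four_momentum c p) \<partial>lborel)"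
        by (rule nn_integral_cmult) measurable
      finally show ?thesis
        using True c m by (simp add: mult.assoc[symmetric] ennreal_mult[symmetric] mult.commute)
    qed (simp add: \<Psi>_def)
  qed
  also have "\<dots> = (\<integral>\<^sup>+m. indicator {0<..1} m * ennreal (c * (m / c) ^ CARD('n)) \<partial>lborel)
      * (\<integral>\<^sup>+p. ennreal (1 / energy c p) * G (four_momentum c p) \<partial>lborel)"
    by (rule nn_integral_multc) measurable
  finally show ?thesis .
qed

text \<open>
  By \<open>nn_integral_unit_mass_cone\<close> both sides, multiplied by the same constant, are Lebesgue integrals over
  the cone. They differ by the linear substitution \<open>x \<mapsto> B x\<close>, which preserves Lebesgue measure, the cone and
  the mass. The constant is finite and nonzero, hence cancels.
\<close>
lemma nn_integral_mass_shell_lorentz: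
  fixes B :: "real ^ 'n::finite option ^ 'n option" and G :: "real ^ 'n option \<Rightarrow> ennreal"
  assumes B: "transpose B ** minkowski ** B = minkowski"
    and a: "0 < a $ None" "mink_prod a a < 0" "0 < (B *v a) $ None"
    and [measurable]: "G \<in> borel_measurable borel" and c: "c > 0"
  shows "(\<integral>\<^sup>+p. ennreal (1 / energy c p) * G (B *v four_momentum c p) \<partial>lborel)
    = (\<integral>\<^sup>+p. ennreal (1 / energy c p) * G (four_momentum c p) \<partial>lborel)"
proof -
  define K where "K = (\<integral>\<^sup>+m. indicator {0<..1} m * ennreal (c * (m / c) ^ CARD('n)) \<partial>lborel)"
  have "K \<le> (\<integral>\<^sup>+m. ennreal (c * (1 / c) ^ CARD('n)) * indicator {0<..1::real} m \<partial>lborel)"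
    unfolding K_def using c
    by (intro nn_integral_mono) (auto simp: indicator_def intro!: ennreal_leI mult_left_mono power_mono divide_right_mono)
  also have "\<dots> < \<infinity>"
    by (simp add: nn_integral_cmult)
  finally have Kfin: "K \<noteq> \<infinity>" by simp
  have K0: "K \<noteq> 0"
  proof
    assume "K = 0"
    then have "AE m in lborel. indicator {0<..1} m * ennreal (c * (m / c) ^ CARD('n)) = 0"
      unfolding K_def by (subst (asm) nn_integral_0_iff_AE) auto
    then have "AE m in lborel. (m::real) \<notin> {0<..1}"
    proof eventually_elim
      case (elim m)
      then show ?case using c
        by (auto simp: indicator_def ennreal_eq_0_iff not_less mult_le_0_iff power_le_zero_eq divide_le_0_iff split: if_splits)
    qed
    then have "emeasure lborel {m \<in> space lborel. \<not> (m::real) \<notin> {0<..1}} = 0"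
      by (subst (asm) AE_iff_measurable[OF _ refl]) auto
    moreover have "{m \<in> space lborel. \<not> (m::real) \<notin> {0<..1}} = {0<..1}" by auto
    ultimately show False by simp
  qed
  have cone: "B *v x \<in> unit_mass_cone \<longleftrightarrow> x \<in> unit_mass_cone" for x
    using future_lorentz_iff[OF B a, of x] by (auto simp: unit_mass_cone_def mink_prod_lorentz[OF B])
  have "K * (\<integral>\<^sup>+p. ennreal (1 / energy c p) * G (four_momentum c p) \<partial>lborel)
    = (\<integral>\<^sup>+x. indicator unit_mass_cone x * G ((c / sqrt (- mink_prod x x)) *\<^sub>R x) \<partial>lborel)"
    unfolding K_def by (rule nn_integral_unit_mass_cone[symmetric]) (use c in auto)
  also have "\<dots> = (\<integral>\<^sup>+x. indicator unit_mass_cone x * G ((c / sqrt (- mink_prod x x)) *\<^sub>R x) \<partial>distr lborel borel ((*v) B))"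
    by (simp add: distr_lborel_lorentz[OF B])
  also have "\<dots> = (\<integral>\<^sup>+x. indicator unit_mass_cone x * G (B *v ((c / sqrt (- mink_prod x x)) *\<^sub>R x)) \<partial>lborel)"
    by (subst nn_integral_distr) (auto simp: indicator_def cone mink_prod_lorentz[OF B] scaleR_matrix_vector_assoc matrix_vector_mult_scaleR)
  also have "\<dots> = K * (\<integral>\<^sup>+p. ennreal (1 / energy c p) * G (B *v four_momentum c p) \<partial>lborel)"
    unfolding K_def by (rule nn_integral_unit_mass_cone) (use c in auto)
  finally show ?thesis
    using K0 Kfin by (simp add: ennreal_mult_cancel_left)
qed

section \<open>Coordinates for pairs of momenta in the center-of-momentum frame\<close>

text \<open>
  The energy of a pair of particles with momenta \<open>r \<omega>\<close> and \<open>- r \<omega> - w\<close>, whose total momentum is \<open>- w\<close>.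
\<close>
definition pair_energy :: "real \<Rightarrow> real ^ 'n::finite \<Rightarrow> real ^ 'n \<Rightarrow> real \<Rightarrow> real" where
  "pair_energy c \<omega> w r = energy c (r *\<^sub>R \<omega>) + energy c (- (r *\<^sub>R \<omega>) - w)"

text \<open>
  The derivative of \<open>pair_energy\<close> in \<open>r\<close>, in a form that is continuous in all variables and does not
  presuppose \<open>|\<omega>| = 1\<close>.
\<close>
definition pair_energy_rate :: "real \<Rightarrow> real ^ 'n::finite \<Rightarrow> real ^ 'n \<Rightarrow> real \<Rightarrow> real" where
  "pair_energy_rate c \<omega> w r = r * (\<omega> \<bullet> \<omega>) / energy c (r *\<^sub>R \<omega>)
     + (r * (\<omega> \<bullet> \<omega>) + \<omega> \<bullet> w) / energy c (- (r *\<^sub>R \<omega>) - w)"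

lemma energy_has_derivative_line:
  assumes "c > 0"
  shows "((\<lambda>r. energy c (r *\<^sub>R x + y)) has_real_derivative (r * (x \<bullet> x) + x \<bullet> y) / energy c (r *\<^sub>R x + y)) (at r)"
proof -
  have eq: "energy c (r *\<^sub>R x + y) = sqrt (c\<^sup>2 + (r\<^sup>2 * (x \<bullet> x) + 2 * r * (x \<bullet> y) + y \<bullet> y))" for r
    unfolding energy_def power2_norm_eq_inner
    by (simp add: inner_add_left inner_add_right power2_eq_square inner_commute algebra_simps)
  have pos: "0 < c\<^sup>2 + (r\<^sup>2 * (x \<bullet> x) + 2 * r * (x \<bullet> y) + y \<bullet> y)"
    using energy_pos[OF assms, of "r *\<^sub>R x + y"] unfolding eq by simp
  have "((\<lambda>r. sqrt (c\<^sup>2 + (r\<^sup>2 * (x \<bullet> x) + 2 * r * (x \<bullet> y) + y \<bullet> y))) has_real_derivative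
      (2 * r * (x \<bullet> x) + 2 * (x \<bullet> y)) * (inverse (sqrt (c\<^sup>2 + (r\<^sup>2 * (x \<bullet> x) + 2 * r * (x \<bullet> y) + y \<bullet> y))) / 2)) (at r)"
    using pos by (auto intro!: derivative_eq_intros simp: power2_eq_square)
  then show ?thesis
    unfolding eq by (rule DERIV_cong) (use pos in \<open>simp add: field_simps\<close>)
qed

lemma pair_energy_derivative:
  assumes "c > 0"
  shows "(pair_energy c \<omega> w has_real_derivative pair_energy_rate c \<omega> w r) (at r)"
proof -
  have neg: "energy c (- (r *\<^sub>R \<omega>) - w) = energy c (r *\<^sub>R \<omega> + w)" for r
    using norm_minus_cancel[of "r *\<^sub>R \<omega> + w"] by (simp add: energy_def)
  show ?thesis
    unfolding pair_energy_def[abs_def] pair_energy_rate_def neg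
    using DERIV_add[OF energy_has_derivative_line[OF assms, of \<omega> 0 r] energy_has_derivative_line[OF assms, of \<omega> w r]]
    by simp
qed

lemma pair_energy_rate_pos:
  assumes "c > 0" "norm \<omega> = 1" "norm w < r"
  shows "0 < pair_energy_rate c \<omega> w r"
proof -
  have "\<bar>\<omega> \<bullet> w\<bar> \<le> norm w" using Cauchy_Schwarz_ineq2[of \<omega> w] assms(2) by simp
  then have "0 < r * (\<omega> \<bullet> \<omega>)" "0 < r * (\<omega> \<bullet> \<omega>) + \<omega> \<bullet> w"
    using assms(2,3) norm_ge_zero[of w] by (auto simp: dot_square_norm)
  then show ?thesis
    unfolding pair_energy_rate_def
    by (intro add_pos_pos[OF divide_pos_pos divide_pos_pos] energy_pos[OF assms(1)])
qed

text \<open>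
  The energy is the Euclidean norm of the pair \<open>(c, x)\<close>.
\<close>
lemma energy_lipschitz: "\<bar>energy c x - energy c y\<bar> \<le> norm (x - y)"
proof -
  have "energy c z = norm (c, z)" for z :: "real ^ 'a"
    by (simp add: energy_def norm_prod_def)
  then show ?thesis
    using norm_triangle_ineq3[of "(c, x)" "(c, y)"] by (simp add: norm_prod_def)
qed

lemma pair_energy_close:
  "\<bar>pair_energy c \<omega> w r - 2 * energy c (r *\<^sub>R \<omega>)\<bar> \<le> norm w"
proof -
  have "energy c (- (r *\<^sub>R \<omega>)) = energy c (r *\<^sub>R \<omega>)" by (simp add: energy_def)
  then show ?thesis
    using energy_lipschitz[of c "- (r *\<^sub>R \<omega>) - w" "- (r *\<^sub>R \<omega>)"] by (simp add: pair_energy_def)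
qed

text \<open>
  For fixed first momentum \<open>u\<close> the substitution \<open>v = - u - w\<close> is a reflection and a translation; polar
  coordinates for \<open>u\<close> do the rest.
\<close>
lemma nn_integral_cm_coordinates:
  fixes g :: "(real ^ 'n::finite) \<times> (real ^ 'n) \<Rightarrow> ennreal"
  assumes [measurable]: "g \<in> borel_measurable borel"
  shows "(\<integral>\<^sup>+z. g z \<partial>lborel)
    = (\<integral>\<^sup>+(\<omega>, w, r). ennreal (r ^ (CARD('n) - 1)) * indicator {0<..} r * g (r *\<^sub>R \<omega>, - (r *\<^sub>R \<omega>) - w)
        \<partial>(sphere_measure \<Otimes>\<^sub>M (lborel \<Otimes>\<^sub>M lborel)))"
proof -
  interpret S: finite_measure "sphere_measure :: (real ^ 'n) measure"
    by (rule finite_measure_sphere_measure)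
  have [measurable]: "g \<in> borel_measurable (borel \<Otimes>\<^sub>M borel)"
    by (simp add: borel_prod)
  define H where "H u = (\<integral>\<^sup>+w. g (u, - u - w) \<partial>lborel)" for u
  have [measurable]: "H \<in> borel_measurable borel"
    unfolding H_def by measurable
  have "(\<integral>\<^sup>+z. g z \<partial>lborel) = (\<integral>\<^sup>+u. \<integral>\<^sup>+v. g (u, v) \<partial>lborel \<partial>lborel)"
    by (simp add: lborel_prod[symmetric] lborel.nn_integral_fst[symmetric])
  also have "\<dots> = (\<integral>\<^sup>+u. H u \<partial>lborel)"
  proof (rule nn_integral_cong)
    fix u :: "real ^ 'n"
    have "(\<integral>\<^sup>+v. g (u, v) \<partial>lborel) = ennreal (\<bar>-1\<bar> ^ DIM(real ^ 'n)) * (\<integral>\<^sup>+w. g (u, - u + (-1) *\<^sub>R w) \<partial>lborel)"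
      by (rule nn_integral_lborel_affine) auto
    then show "(\<integral>\<^sup>+v. g (u, v) \<partial>lborel) = H u"
      by (simp add: H_def)
  qed
  also have "\<dots> = (\<integral>\<^sup>+\<omega>. \<integral>\<^sup>+r. ennreal (r ^ (CARD('n) - 1)) * indicator {0<..} r * H (r *\<^sub>R \<omega>) \<partial>lborel \<partial>sphere_measure)"
    by (subst nn_integral_polar) auto
  also have "\<dots> = (\<integral>\<^sup>+\<omega>. \<integral>\<^sup>+r. \<integral>\<^sup>+w. ennreal (r ^ (CARD('n) - 1)) * indicator {0<..} r * g (r *\<^sub>R \<omega>, - (r *\<^sub>R \<omega>) - w) \<partial>lborel \<partial>lborel \<partial>sphere_measure)"
    unfolding H_def by (subst nn_integral_cmult) auto
  also have "\<dots> = (\<integral>\<^sup>+\<omega>. \<integral>\<^sup>+(w, r). ennreal (r ^ (CARD('n) - 1)) * indicator {0<..} r * g (r *\<^sub>R \<omega>, - (r *\<^sub>R \<omega>) - w) \<partial>(lborel \<Otimes>\<^sub>M lborel) \<partial>sphere_measure)"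
    by (intro nn_integral_cong, subst lborel_pair.nn_integral_snd[symmetric]) (auto simp: case_prod_beta')
  also have "\<dots> = (\<integral>\<^sup>+(\<omega>, w, r). ennreal (r ^ (CARD('n) - 1)) * indicator {0<..} r * g (r *\<^sub>R \<omega>, - (r *\<^sub>R \<omega>) - w)
        \<partial>(sphere_measure \<Otimes>\<^sub>M (lborel \<Otimes>\<^sub>M lborel)))"
    by (subst lborel_pair.nn_integral_fst[symmetric]) (auto simp: case_prod_beta')
  finally show ?thesis .
qed

lemma lborel_cm_coordinates:
  "(lborel :: ((real ^ 'n::finite) \<times> (real ^ 'n)) measure)
    = distr (density (sphere_measure \<Otimes>\<^sub>M (lborel \<Otimes>\<^sub>M lborel))
        (\<lambda>(\<omega>, w, r). ennreal (r ^ (CARD('n) - 1)) * indicator {0<..} r))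
      borel (\<lambda>(\<omega>, w, r). (r *\<^sub>R \<omega>, - (r *\<^sub>R \<omega>) - w))"
  (is "_ = ?D")
proof (rule measure_eqI)
  fix A :: "((real ^ 'n) \<times> (real ^ 'n)) set" assume "A \<in> sets lborel"
  then have [measurable]: "A \<in> sets borel" by simp
  have [measurable]: "(\<lambda>(\<omega> :: real ^ 'n, w, r::real). (r *\<^sub>R \<omega>, - (r *\<^sub>R \<omega>) - w))
      \<in> sphere_measure \<Otimes>\<^sub>M (lborel \<Otimes>\<^sub>M lborel) \<rightarrow>\<^sub>M borel"
    by (subst borel_prod[symmetric]) measurable
  have "emeasure ?D A = (\<integral>\<^sup>+z. indicator A z \<partial>?D)" by simp
  also have "\<dots> = (\<integral>\<^sup>+z. indicator A z \<partial>lborel)"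
    by (subst nn_integral_cm_coordinates, measurable, subst nn_integral_distr, measurable,
        subst nn_integral_density) (auto simp: case_prod_beta')
  also have "\<dots> = emeasure lborel A" by simp
  finally show "emeasure lborel A = emeasure ?D A" by simp
qed simp

text \<open>
  The energy of a momentum of length \<open>r\<close>, as a function of the radius alone.
\<close>
definition radial_energy :: "real \<Rightarrow> real \<Rightarrow> real" where "radial_energy c r = sqrt (c\<^sup>2 + r\<^sup>2)"

lemma energy_on_ray:
  assumes "norm \<omega> = 1" shows "energy c (r *\<^sub>R \<omega>) = radial_energy c r"
  unfolding energy_def radial_energy_def norm_scaleR assms by simp

lemma radial_energy_diff_squares: "radial_energy c x ^ 2 - radial_energy c y ^ 2 = (x - y) * (x + y)"
proof -
  have "(radial_energy c r)\<^sup>2 = c\<^sup>2 + r\<^sup>2" for r by (simp add: radial_energy_def)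
  then have "radial_energy c x ^ 2 - radial_energy c y ^ 2 = x\<^sup>2 - y\<^sup>2" by simp
  also have "\<dots> = (x - y) * (x + y)"
    by (simp add: power2_eq_square square_diff_square_factored mult.commute)
  finally show ?thesis .
qed

lemma radial_energy_pos: "c > 0 \<Longrightarrow> 0 < radial_energy c r"
  unfolding radial_energy_def by (intro real_sqrt_gt_zero add_pos_nonneg) auto

lemma radius_le_radial_energy: "\<bar>r\<bar> \<le> radial_energy c r"
  unfolding radial_energy_def by (simp add: real_le_rsqrt)

lemma radial_energy_mono: "0 \<le> x \<Longrightarrow> x \<le> y \<Longrightarrow> radial_energy c x \<le> radial_energy c y"
  unfolding radial_energy_def by (simp add: power_mono)

text \<open>
  An energy close to that of \<open>r0\<close> forces a radius close to \<open>r0\<close>, with an explicit rate: the difference of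
  the squared energies equals that of the squared radii.
\<close>
lemma radius_localized:
  assumes c: "c > 0" and r0: "r0 > 0" and r: "0 < r"
    and d: "\<bar>radial_energy c r - radial_energy c r0\<bar> \<le> \<delta>" "\<delta> \<le> radial_energy c r0"
  shows "\<bar>r - r0\<bar> \<le> 3 * radial_energy c r0 * \<delta> / r0"
proof -
  have "\<bar>r - r0\<bar> * r0 \<le> \<bar>r - r0\<bar> * (r + r0)"
    using r by (intro mult_left_mono) auto
  also have "\<dots> = \<bar>(r - r0) * (r + r0)\<bar>"
    using r r0 by (simp add: abs_mult)
  also have "(r - r0) * (r + r0) = (radial_energy c r - radial_energy c r0) * (radial_energy c r + radial_energy c r0)"
    unfolding radial_energy_diff_squares[of c r r0, symmetric] by (simp add: power2_eq_square algebra_simps)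
  also have "\<bar>\<dots>\<bar> = \<bar>radial_energy c r - radial_energy c r0\<bar> * (radial_energy c r + radial_energy c r0)"
    using radial_energy_pos[OF c, of r] radial_energy_pos[OF c, of r0] by (simp add: abs_mult)
  also have "\<dots> \<le> \<delta> * (3 * radial_energy c r0)"
    using d radial_energy_pos[OF c, of r] radial_energy_pos[OF c, of r0] by (intro mult_mono) auto
  finally show ?thesis using r0 by (simp add: field_simps)
qed

lemma radial_energy_gap_below:
  assumes c: "c > 0" and r0: "r0 > 0"
  shows "r0\<^sup>2 / (3 * radial_energy c r0) \<le> radial_energy c r0 - radial_energy c (r0 / 2)"
proof -
  define e where "e = radial_energy c r0"
  define e' where "e' = radial_energy c (r0 / 2)"
  have pos: "0 < e" "0 < e'" "e' \<le> e"
    using radial_energy_pos[OF c] radial_energy_mono[of "r0 / 2" r0 c] r0 by (auto simp: e_def e'_def)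
  have "3 / 4 * r0\<^sup>2 = (e - e') * (e + e')"
    using radial_energy_diff_squares[of c r0 "r0 / 2"] by (simp add: e_def e'_def power2_eq_square algebra_simps)
  also have "\<dots> \<le> (e - e') * (2 * e)"
    using pos by (intro mult_left_mono) auto
  finally have *: "3 / 4 * r0\<^sup>2 \<le> (e - e') * (2 * e)" .
  moreover have "(e - e') * (3 * e) = 3 / 2 * ((e - e') * (2 * e))" by simp
  ultimately have "r0\<^sup>2 \<le> (e - e') * (3 * e)"
    using zero_le_power2[of r0] by linarith
  then show ?thesis using pos unfolding e_def[symmetric] e'_def[symmetric] by (simp add: field_simps)
qed

lemma radial_energy_gap_above:
  assumes c: "c > 0" and r0: "r0 > 0"
  shows "r0\<^sup>2 / (3 * radial_energy c r0) \<le> radial_energy c (2 * r0) - radial_energy c r0"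
proof -
  define e where "e = radial_energy c r0"
  define e' where "e' = radial_energy c (2 * r0)"
  have pos: "0 < e" "0 < e'" "e \<le> e'"
    using radial_energy_pos[OF c] radial_energy_mono[of r0 "2 * r0" c] r0 by (auto simp: e_def e'_def)
  \<comment> \<open>Doubling the radius at most doubles the energy.\<close>
  have "e'\<^sup>2 \<le> (2 * e)\<^sup>2"
    by (simp add: e_def e'_def radial_energy_def power_mult_distrib)
  then have "e' \<le> 2 * e" by (rule power2_le_imp_le) (use pos in linarith)
  have "3 * r0\<^sup>2 = (e' - e) * (e' + e)"
    using radial_energy_diff_squares[of c "2 * r0" r0] by (simp add: e_def e'_def power2_eq_square algebra_simps)
  also have "\<dots> \<le> (e' - e) * (3 * e)"
    using pos \<open>e' \<le> 2 * e\<close> by (intro mult_left_mono) auto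
  finally have "r0\<^sup>2 \<le> (e' - e) * (3 * e)" using zero_le_power2[of r0] by linarith
  then show ?thesis using pos unfolding e_def[symmetric] e'_def[symmetric] by (simp add: field_simps)
qed

section \<open>The Dirac limit in the center-of-momentum frame\<close>

lemma norm_spacetime: "(norm (spacetime t w))\<^sup>2 = t\<^sup>2 + (norm w)\<^sup>2"
  unfolding power2_norm_eq_inner
  by (simp add: inner_vec_def sum_UNIV_option power2_eq_square)

lemma norm_spacetime_ge: "\<bar>t\<bar> \<le> norm (spacetime t w)" "norm w \<le> norm (spacetime t w)"
proof -
  have "\<bar>t\<bar>\<^sup>2 \<le> (norm (spacetime t w))\<^sup>2" "(norm w)\<^sup>2 \<le> (norm (spacetime t w))\<^sup>2"
    by (simp_all add: norm_spacetime)
  then show "\<bar>t\<bar> \<le> norm (spacetime t w)" "norm w \<le> norm (spacetime t w)"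
    by (meson norm_ge_zero power2_le_imp_le)+
qed

lemma continuous_on_pair_energy_rate [continuous_intros]:
  assumes "c > 0" "continuous_on A f" "continuous_on A g" "continuous_on A h"
  shows "continuous_on A (\<lambda>x. pair_energy_rate c (f x) (g x) (h x))"
  unfolding pair_energy_rate_def
  by (intro continuous_intros assms) (use energy_pos[OF assms(1)] in \<open>auto simp: less_le\<close>)

lemma borel_measurable_pair_energy [measurable (raw)]:
  assumes [measurable]: "f \<in> borel_measurable M" "g \<in> borel_measurable M" "h \<in> borel_measurable M"
  shows "(\<lambda>x. pair_energy c (f x) (g x) (h x)) \<in> borel_measurable M"
  unfolding pair_energy_def by measurable

lemma borel_measurable_pair_energy_rate [measurable (raw)]:
  assumes [measurable]: "f \<in> borel_measurable M" "g \<in> borel_measurable M" "h \<in> borel_measurable M"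
  shows "(\<lambda>x. pair_energy_rate c (f x) (g x) (h x)) \<in> borel_measurable M"
  unfolding pair_energy_rate_def by measurable

text \<open>
  A radius around the origin of momentum-energy space that is small enough for all estimates below at once:
  a defect of this size forces \<open>r\<close> into \<open>[r0/2, 2 r0]\<close>, keeps \<open>|w|\<close> below every such \<open>r\<close> (so that
  the pair energy is increasing in \<open>r\<close>), and is covered by the energies that \<open>r\<close> attains on this interval.
\<close>
definition localization_width :: "real \<Rightarrow> real \<Rightarrow> real" where
  "localization_width c r0 = r0\<^sup>2 / (6 * radial_energy c r0)"

lemma localization_width_bounds:
  assumes c: "c > 0" and r0: "r0 > 0"
  shows "0 < localization_width c r0" "localization_width c r0 < r0 / 2" "localization_width c r0 \<le> radial_energy c r0"
    "2 * localization_width c r0 \<le> radial_energy c r0 - radial_energy c (r0 / 2)"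
    "2 * localization_width c r0 \<le> radial_energy c (2 * r0) - radial_energy c r0"
    "3 * radial_energy c r0 * localization_width c r0 / r0 = r0 / 2"
proof -
  have e: "0 < radial_energy c r0" "r0 \<le> radial_energy c r0"
    using radial_energy_pos[OF c, of r0] radius_le_radial_energy[of r0 c] by auto
  show "0 < localization_width c r0" using e r0 by (simp add: localization_width_def)
  show s: "3 * radial_energy c r0 * localization_width c r0 / r0 = r0 / 2"
    using e r0 by (simp add: localization_width_def power2_eq_square)
  have "r0 * r0 \<le> r0 * radial_energy c r0" using e r0 by (intro mult_left_mono) auto
  moreover have "0 < r0 * radial_energy c r0" using e r0 by simp
  ultimately have "r0 * r0 < 3 * (r0 * radial_energy c r0)" by linarith
  then show lt: "localization_width c r0 < r0 / 2"
    using e r0 by (simp add: localization_width_def power2_eq_square divide_simps)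
  show "localization_width c r0 \<le> radial_energy c r0" using lt e r0 by linarith
  have "2 * localization_width c r0 = r0\<^sup>2 / (3 * radial_energy c r0)"
    using e by (simp add: localization_width_def)
  then show "2 * localization_width c r0 \<le> radial_energy c r0 - radial_energy c (r0 / 2)"
    "2 * localization_width c r0 \<le> radial_energy c (2 * r0) - radial_energy c r0"
    using radial_energy_gap_below[OF c r0] radial_energy_gap_above[OF c r0] by simp_all
qed

lemma pair_energy_localizes:
  assumes c: "c > 0" and r0: "r0 > 0" and \<omega>: "norm \<omega> = 1" and r: "0 < r"
    and z: "norm (spacetime (2 * radial_energy c r0 - pair_energy c \<omega> w r) w) < \<delta>" and \<delta>: "\<delta> \<le> localization_width c r0"
  shows "norm w < \<delta>" "\<bar>r - r0\<bar> \<le> 3 * radial_energy c r0 * \<delta> / r0"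
proof -
  let ?z = "spacetime (2 * radial_energy c r0 - pair_energy c \<omega> w r) w"
  show w: "norm w < \<delta>" using norm_spacetime_ge(2)[of w] z by (rule le_less_trans)
  have "\<bar>2 * radial_energy c r0 - pair_energy c \<omega> w r\<bar> < \<delta>" using norm_spacetime_ge(1) z by (rule le_less_trans)
  moreover have "\<bar>pair_energy c \<omega> w r - 2 * radial_energy c r\<bar> \<le> norm w"
    using pair_energy_close[of c \<omega> w r] by (simp add: energy_on_ray[OF \<omega>])
  ultimately have "\<bar>radial_energy c r - radial_energy c r0\<bar> \<le> \<delta>" using w by linarith
  moreover have "\<delta> \<le> radial_energy c r0" using \<delta> localization_width_bounds(3)[OF c r0] by linarith
  ultimately show "\<bar>r - r0\<bar> \<le> 3 * radial_energy c r0 * \<delta> / r0"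
    by (rule radius_localized[OF c r0 r])
qed

text \<open>
  For fixed \<open>w\<close>, the energy defect replaces \<open>r\<close> as integration variable. The energies reached for \<open>r\<close> in
  \<open>[r0/2, 2 r0]\<close> cover the support of \<open>E\<close>, so nothing of its mass is lost.
\<close>
lemma nn_integral_pair_energy_kernel:
  fixes E :: "real ^ 'n::finite option \<Rightarrow> real" and \<omega> :: "real ^ 'n"
  assumes c: "c > 0" and r0: "r0 > 0" and \<omega>: "norm \<omega> = 1"
    and [measurable]: "E \<in> borel_measurable borel"
    and supp: "\<And>z. localization_width c r0 \<le> norm z \<Longrightarrow> E z = 0"
  shows "(\<integral>\<^sup>+(w, r). indicator (ball 0 (localization_width c r0)) w * indicator {r0/2..2 * r0} r *
        (ennreal (E (spacetime (2 * radial_energy c r0 - pair_energy c \<omega> w r) w)) * ennreal (pair_energy_rate c \<omega> w r))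
        \<partial>(lborel \<Otimes>\<^sub>M lborel)) = (\<integral>\<^sup>+z. ennreal (E z) \<partial>lborel)"
proof -
  define \<delta> where "\<delta> = localization_width c r0"
  define W where "W = 2 * radial_energy c r0"
  have [measurable]: "ball 0 \<delta> \<in> sets (borel :: (real ^ 'n) measure)" by simp
  have "(\<integral>\<^sup>+(w, r). indicator (ball 0 \<delta>) w * indicator {r0/2..2 * r0} r *
        (ennreal (E (spacetime (W - pair_energy c \<omega> w r) w)) * ennreal (pair_energy_rate c \<omega> w r))
        \<partial>(lborel \<Otimes>\<^sub>M lborel))
     = (\<integral>\<^sup>+w. \<integral>\<^sup>+r. indicator (ball 0 \<delta>) w * indicator {r0/2..2 * r0} r *
        (ennreal (E (spacetime (W - pair_energy c \<omega> w r) w)) * ennreal (pair_energy_rate c \<omega> w r))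
        \<partial>lborel \<partial>lborel)"
    by (subst lborel.nn_integral_fst[symmetric]) (auto simp: case_prod_beta')
  also have "\<dots> = (\<integral>\<^sup>+w. \<integral>\<^sup>+t. ennreal (E (spacetime t w)) \<partial>lborel \<partial>lborel)"
  proof (rule nn_integral_cong)
    fix w :: "real ^ 'n"
    show "(\<integral>\<^sup>+r. indicator (ball 0 \<delta>) w * indicator {r0/2..2 * r0} r *
        (ennreal (E (spacetime (W - pair_energy c \<omega> w r) w)) * ennreal (pair_energy_rate c \<omega> w r)) \<partial>lborel)
      = (\<integral>\<^sup>+t. ennreal (E (spacetime t w)) \<partial>lborel)"
    proof (cases "norm w < \<delta>")
      case False
      then have "E (spacetime t w) = 0" for t
        using norm_spacetime_ge(2)[of w t] by (intro supp) (simp add: \<delta>_def)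
      then show ?thesis using False by simp
    next
      case True
      define g where "g = pair_energy c \<omega> w"
      have g2: "\<bar>g r - 2 * radial_energy c r\<bar> \<le> norm w" for r
        unfolding g_def using pair_energy_close[of c \<omega> w r] by (simp add: energy_on_ray[OF \<omega>])
      have range: "W - t \<in> {g (r0 / 2)..g (2 * r0)}" if "E (spacetime t w) \<noteq> 0" for t
      proof -
        have "\<bar>t\<bar> < \<delta>"
          using norm_spacetime_ge(1)[of t w] supp[of "spacetime t w"] that unfolding \<delta>_def
          by (metis le_less_trans not_le)
        then show ?thesis
          using True g2[of "r0 / 2"] g2[of "2 * r0"] localization_width_bounds(4,5)[OF c r0]
          unfolding W_def \<delta>_def atLeastAtMost_iff by linarith
      qed
      have "(\<integral>\<^sup>+t. ennreal (E (spacetime t w)) \<partial>lborel) = (\<integral>\<^sup>+t. ennreal (E (spacetime (W - t) w)) \<partial>lborel)"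
        by (subst nn_integral_real_affine[where c = "-1" and t = W]) auto
      also have "\<dots> = (\<integral>\<^sup>+t. ennreal (E (spacetime (W - t) w)) * indicator {g (r0 / 2)..g (2 * r0)} t \<partial>lborel)"
      proof (rule nn_integral_cong)
        fix t
        show "ennreal (E (spacetime (W - t) w))
          = ennreal (E (spacetime (W - t) w)) * indicator {g (r0 / 2)..g (2 * r0)} t"
          using range[of "W - t"] by (cases "E (spacetime (W - t) w) = 0") auto
      qed
      also have "\<dots> = (\<integral>\<^sup>+r. ennreal (E (spacetime (W - g r) w)) * ennreal (pair_energy_rate c \<omega> w r)
          * indicator {r0 / 2..2 * r0} r \<partial>lborel)"
      proof (rule nn_integral_substitution_aux)
        fix r assume "r \<in> {r0 / 2..2 * r0}"
        then have "norm w < r" using True localization_width_bounds(2)[OF c r0] unfolding \<delta>_def by auto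
        then show "0 \<le> pair_energy_rate c \<omega> w r" using pair_energy_rate_pos[OF c \<omega>] by (simp add: less_imp_le)
        show "(g has_real_derivative pair_energy_rate c \<omega> w r) (at r)"
          unfolding g_def by (rule pair_energy_derivative[OF c])
      next
        show "continuous_on {r0 / 2..2 * r0} (pair_energy_rate c \<omega> w)"
          by (intro continuous_intros c)
      qed (use r0 in auto)
      finally show ?thesis using True by (simp add: g_def mult_ac)
    qed
  qed
  also have "\<dots> = (\<integral>\<^sup>+z. ennreal (E z) \<partial>lborel)"
    by (rule nn_integral_spacetime[symmetric]) auto
  finally show ?thesis by (simp only: \<delta>_def W_def)
qed

lemma AE_sphere_pair:
  "AE z in (sphere_measure :: (real ^ 'n::finite) measure) \<Otimes>\<^sub>M (lborel \<Otimes>\<^sub>M lborel :: ((real ^ 'n) \<times> real) measure). norm (fst z) = 1"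
proof -
  interpret S: finite_measure "sphere_measure :: (real ^ 'n) measure"
    by (rule finite_measure_sphere_measure)
  interpret P: pair_sigma_finite "sphere_measure :: (real ^ 'n) measure" "lborel \<Otimes>\<^sub>M lborel :: ((real ^ 'n) \<times> real) measure"
    ..
  show ?thesis
  proof (rule P.AE_pair_measure)
    show "AE x in (sphere_measure :: (real ^ 'n) measure). AE y in (lborel \<Otimes>\<^sub>M lborel :: ((real ^ 'n) \<times> real) measure). norm (fst (x, y)) = 1"
      using AE_sphere_measure by eventually_elim simp
  qed measurable
qed

text \<open>
  In the coordinates \<open>(\<omega>, w, r)\<close> the integrand is \<open>\<phi> k \<cdot> \<psi>\<close>: the factor \<open>\<phi> k\<close> collects the kernel
  and the energy rate, the factor \<open>\<psi>\<close> the test function, the polar volume element and the reciprocal of the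
  energy rate. The measure \<open>N k\<close> with density \<open>\<phi> k\<close> has the surface measure as its image under
  \<open>(\<omega>, w, r) \<mapsto> \<omega>\<close>, by \<open>nn_integral_pair_energy_kernel\<close>. So the integral of \<open>\<psi>0\<close> over the sphere
  is an integral with respect to \<open>N k\<close> as well, and the two integrals can be compared pointwise: \<open>N k\<close> is
  concentrated where \<open>w\<close> is close to 0 and \<open>r\<close> to \<open>r0\<close>, and there \<open>\<psi>\<close> is uniformly close to \<open>\<psi>0\<close>.
  Only points with \<open>|\<omega>| = 1\<close> matter, although the surface measure lives on the whole space.
\<close>
lemma cm_delta_limit:
  fixes E :: "nat \<Rightarrow> real ^ 'n::finite option \<Rightarrow> real" and f :: "(real ^ 'n) \<times> (real ^ 'n) \<Rightarrow> real"
  assumes c: "c > 0" and r0: "r0 > 0"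
    and E_meas [measurable]: "\<And>k. E k \<in> borel_measurable borel"
    and E_nonneg: "\<And>k z. 0 \<le> E k z"
    and E_mass: "\<And>k. (\<integral>\<^sup>+z. ennreal (E k z) \<partial>lborel) = 1"
    and E_supp: "\<And>\<delta>. \<delta> > 0 \<Longrightarrow> \<forall>\<^sub>F k in sequentially. \<forall>z. \<delta> \<le> norm z \<longrightarrow> E k z = 0"
    and f: "continuous_on UNIV f"
  shows "(\<lambda>k. LINT z|lborel. E k (spacetime (2 * radial_energy c r0) 0 - four_momentum c (fst z) - four_momentum c (snd z)) * f z)
    \<longlonglongrightarrow> (LINT \<omega>|sphere_measure. f (r0 *\<^sub>R \<omega>, - (r0 *\<^sub>R \<omega>)) * (r0 ^ (CARD('n) - 1) * radial_energy c r0 / (2 * r0)))"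
proof -
  define S where "S = (sphere_measure :: (real ^ 'n) measure)"
  define Z where "Z = S \<Otimes>\<^sub>M (lborel \<Otimes>\<^sub>M lborel :: ((real ^ 'n) \<times> real) measure)"
  interpret S: finite_measure S
    unfolding S_def by (rule finite_measure_sphere_measure)
  have [measurable_cong, simp]: "sets S = sets borel" by (simp add: S_def)
  have sZ [measurable_cong]: "sets Z = sets (borel \<Otimes>\<^sub>M (borel \<Otimes>\<^sub>M borel))"
    unfolding Z_def by (intro sets_pair_measure_cong) auto
  have spZ [simp]: "space Z = UNIV" by (simp add: Z_def S_def space_pair_measure)
  have AEZ: "AE z in Z. norm (fst z) = 1"
    unfolding Z_def S_def by (rule AE_sphere_pair)
  have [measurable]: "f \<in> borel_measurable (borel \<Otimes>\<^sub>M borel)"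
    using borel_measurable_continuous_onI[OF f] by (simp add: borel_prod)
  define \<Delta> where "\<Delta> = localization_width c r0"
  define W where "W = 2 * radial_energy c r0"
  have \<Delta>: "\<Delta> > 0" "\<Delta> < r0 / 2" using localization_width_bounds[OF c r0] by (auto simp: \<Delta>_def)
  have [measurable]: "ball 0 \<Delta> \<in> sets (borel :: (real ^ 'n) measure)" by simp
  define defect where "defect = (\<lambda>(\<omega>::real ^ 'n, w, r). spacetime (W - pair_energy c \<omega> w r) w)"
  define rate where "rate = (\<lambda>(\<omega>::real ^ 'n, w, r). pair_energy_rate c \<omega> w r)"
  define X where "X = (\<lambda>(\<omega>::real ^ 'n, w, r). (r *\<^sub>R \<omega>, - (r *\<^sub>R \<omega>) - w))"
  define \<psi> where "\<psi> z = snd (snd z) ^ (CARD('n) - 1) * f (X z) / rate z" for z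
  define \<psi>0 where "\<psi>0 \<omega> = f (r0 *\<^sub>R \<omega>, - (r0 *\<^sub>R \<omega>)) * (r0 ^ (CARD('n) - 1) * radial_energy c r0 / (2 * r0))" for \<omega> :: "real ^ 'n"
  define \<phi> where "\<phi> k z = indicator (ball 0 \<Delta>) (fst (snd z)) * indicator {r0/2..2 * r0} (snd (snd z)) * (E k (defect z) * rate z)"
    for k z
  define N where "N k = density Z (\<lambda>z. ennreal (\<phi> k z))" for k
  have [measurable]: "defect \<in> borel_measurable Z" "rate \<in> borel_measurable Z" "X \<in> Z \<rightarrow>\<^sub>M borel \<Otimes>\<^sub>M borel"
    "X \<in> borel_measurable Z"
    unfolding defect_def rate_def X_def borel_prod[symmetric] by measurable
  have [measurable]: "\<psi> \<in> borel_measurable Z" "\<psi>0 \<in> borel_measurable S" "\<phi> k \<in> borel_measurable Z" for k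
    unfolding \<psi>_def \<psi>0_def \<phi>_def by measurable
  have rate_pos: "0 < rate (\<omega>, w, r)" if "norm \<omega> = 1" "norm w \<le> \<Delta>" "r0 / 2 \<le> r" for \<omega> w r
    unfolding rate_def using pair_energy_rate_pos[OF c that(1), of w r] that \<Delta> by simp
  have \<phi>_nonneg: "0 \<le> \<phi> k z" if "norm (fst z) = 1" for k z
    using that E_nonneg rate_pos[of "fst z" "fst (snd z)" "snd (snd z)"]
    by (auto simp: \<phi>_def indicator_def less_imp_le)
  have \<psi>_base: "\<psi> (\<omega>, 0, r0) = \<psi>0 \<omega>" if "norm \<omega> = 1" for \<omega>
  proof -
    have "energy c (- (r0 *\<^sub>R \<omega>)) = energy c (r0 *\<^sub>R \<omega>)" by (simp add: energy_def)
    then have "rate (\<omega>, 0, r0) = 2 * r0 / radial_energy c r0"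
      using that by (simp add: rate_def pair_energy_rate_def energy_on_ray dot_square_norm)
    then show ?thesis by (simp add: \<psi>_def \<psi>0_def X_def)
  qed
  have marginal: "distr (N k) S fst = S" if "\<forall>z. \<Delta> \<le> norm z \<longrightarrow> E k z = 0" for k
  proof (rule measure_eqI)
    fix A assume "A \<in> sets (distr (N k) S fst)"
    then have A [measurable]: "A \<in> sets borel" by simp
    have "emeasure (distr (N k) S fst) A = emeasure (N k) (fst -` A \<inter> space Z)"
      by (subst emeasure_distr) (auto simp: N_def)
    also have "\<dots> = (\<integral>\<^sup>+z. ennreal (\<phi> k z) * indicator (fst -` A \<inter> space Z) z \<partial>Z)"
      unfolding N_def by (rule emeasure_density) measurable
    also have "\<dots> = (\<integral>\<^sup>+z. ennreal (\<phi> k z) * indicator A (fst z) \<partial>Z)"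
      by (intro nn_integral_cong) (auto simp: indicator_def)
    also have "\<dots> = (\<integral>\<^sup>+\<omega>. \<integral>\<^sup>+y. ennreal (\<phi> k (\<omega>, y)) * indicator A \<omega> \<partial>(lborel \<Otimes>\<^sub>M lborel) \<partial>S)"
      unfolding Z_def by (subst lborel_pair.nn_integral_fst[symmetric]) (auto simp: Z_def[symmetric])
    also have "\<dots> = (\<integral>\<^sup>+\<omega>. indicator A \<omega> \<partial>S)"
    proof (rule nn_integral_cong_AE)
      show "AE \<omega> in S. (\<integral>\<^sup>+y. ennreal (\<phi> k (\<omega>, y)) * indicator A \<omega> \<partial>(lborel \<Otimes>\<^sub>M lborel)) = indicator A \<omega>"
        using AE_sphere_measure unfolding S_def
      proof eventually_elim
        fix \<omega> :: "real ^ 'n" assume \<omega>: "norm \<omega> = 1"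
        have "(\<integral>\<^sup>+y. ennreal (\<phi> k (\<omega>, y)) \<partial>(lborel \<Otimes>\<^sub>M lborel))
          = (\<integral>\<^sup>+(w, r). indicator (ball 0 \<Delta>) w * indicator {r0/2..2 * r0} r *
              (ennreal (E k (spacetime (W - pair_energy c \<omega> w r) w)) * ennreal (pair_energy_rate c \<omega> w r)) \<partial>(lborel \<Otimes>\<^sub>M lborel))"
          using E_nonneg
          by (intro nn_integral_cong) (auto simp: \<phi>_def defect_def rate_def indicator_def ennreal_mult')
        also have "\<dots> = 1"
          unfolding \<Delta>_def W_def using nn_integral_pair_energy_kernel[OF c r0 \<omega>, of "E k"] that E_mass[of k]
          by (simp add: \<Delta>_def)
        finally have one: "(\<integral>\<^sup>+y. ennreal (\<phi> k (\<omega>, y)) \<partial>(lborel \<Otimes>\<^sub>M lborel)) = 1" .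
        have "(\<lambda>y. ennreal (\<phi> k (\<omega>, y))) \<in> borel_measurable (lborel \<Otimes>\<^sub>M lborel)"
          by measurable
        then show "(\<integral>\<^sup>+y. ennreal (\<phi> k (\<omega>, y)) * indicator A \<omega> \<partial>(lborel \<Otimes>\<^sub>M lborel)) = indicator A \<omega>"
          using one by (simp add: nn_integral_multc)
      qed
    qed
    also have "\<dots> = emeasure S A" by simp
    finally show "emeasure (distr (N k) S fst) A = emeasure S A" .
  qed simp
  have I_eq: "(LINT z|lborel. E k (spacetime (2 * radial_energy c r0) 0 - four_momentum c (fst z) - four_momentum c (snd z)) * f z)
      = (LINT z|N k. \<psi> z)" if E0: "\<forall>z. \<Delta> \<le> norm z \<longrightarrow> E k z = 0" for k
  proof -
    define g where "g z = E k (spacetime W 0 - four_momentum c (fst z) - four_momentum c (snd z)) * f z" for z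
    have [measurable]: "g \<in> borel_measurable borel"
      unfolding g_def borel_prod[symmetric] by measurable
    define j where "j z = snd (snd z) ^ (CARD('n) - 1) * indicator {0<..} (snd (snd z))" for z :: "(real ^ 'n) \<times> (real ^ 'n) \<times> real"
    have [measurable]: "j \<in> borel_measurable Z" unfolding j_def by measurable
    have j_nonneg: "0 \<le> j z" for z by (simp add: j_def indicator_def)
    have gX: "g (X z) = E k (defect z) * f (X z)" for z
    proof -
      have "spacetime W 0 - four_momentum c (fst (X z)) - four_momentum c (snd (X z)) = defect z"
        by (simp add: X_def defect_def case_prod_beta' vec_option_eq_iff four_momentum_spacetime pair_energy_def vec_eq_iff)
      then show ?thesis by (simp add: g_def)
    qed
    have lb: "lborel = distr (density Z (\<lambda>z. ennreal (j z))) borel X"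
      unfolding lborel_cm_coordinates Z_def S_def X_def j_def
      by (intro arg_cong2[where f = "\<lambda>x y. distr x borel y"] arg_cong2[where f = density])
         (auto simp: case_prod_beta' indicator_def)
    have "(LINT z|lborel. g z) = (LINT z|density Z (\<lambda>z. ennreal (j z)). g (X z))"
      unfolding lb by (rule integral_distr) measurable
    also have "\<dots> = (LINT z|Z. j z *\<^sub>R g (X z))"
      by (rule integral_density) (use j_nonneg in \<open>auto simp: gX\<close>)
    also have "\<dots> = (LINT z|Z. \<phi> k z *\<^sub>R \<psi> z)"
    proof (rule integral_cong_AE)
      show "AE z in Z. j z *\<^sub>R g (X z) = \<phi> k z *\<^sub>R \<psi> z"
        using AEZ
      proof eventually_elim
        fix z :: "(real ^ 'n) \<times> (real ^ 'n) \<times> real" assume n1: "norm (fst z) = 1"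
        obtain \<omega> w r where z: "z = (\<omega>, w, r)" by (metis surj_pair)
        show "j z *\<^sub>R g (X z) = \<phi> k z *\<^sub>R \<psi> z"
        proof (cases "E k (defect z) = 0")
          case True
          then show ?thesis by (simp add: gX \<phi>_def)
        next
          case False
          \<comment> \<open>The kernel is nonzero only if the defect is small; then \<open>r\<close> and \<open>w\<close> lie where \<open>\<phi> k\<close> is not cut off.\<close>
          then have small: "norm (spacetime (2 * radial_energy c r0 - pair_energy c \<omega> w r) w) < localization_width c r0"
            using E0 by (auto simp: z defect_def W_def \<Delta>_def not_le[symmetric])
          show ?thesis
          proof (cases "0 < r")
            case True
            have "norm w < \<Delta>" "\<bar>r - r0\<bar> \<le> r0 / 2"
              using pair_energy_localizes[OF c r0 _ True small] n1 localization_width_bounds(6)[OF c r0]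
              by (auto simp: z \<Delta>_def)
            moreover from this have "r0 / 2 \<le> r" "r \<le> 2 * r0" using r0 by linarith+
            moreover from calculation have "rate (\<omega>, w, r) > 0" using n1 by (intro rate_pos) (auto simp: z)
            ultimately show ?thesis
              using True by (simp add: j_def gX \<phi>_def \<psi>_def z)
          next
            case False
            then show ?thesis using r0 by (auto simp: j_def \<phi>_def z)
          qed
        qed
      qed
    qed (auto simp: gX)
    also have "\<dots> = (LINT z|N k. \<psi> z)"
      unfolding N_def by (rule integral_density[symmetric]) (use AEZ \<phi>_nonneg in \<open>auto elim!: eventually_mono\<close>)
    finally show ?thesis by (simp only: g_def W_def)
  qed
  define K where "K = sphere (0::real ^ 'n) 1 \<times> cball (0::real ^ 'n) \<Delta> \<times> {r0 / 2..2 * r0}"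
  have "compact K" unfolding K_def by (intro compact_Times compact_sphere compact_cball compact_Icc)
  have "continuous_on K \<psi>"
  proof -
    have "continuous_on K (\<lambda>z. f (X z))"
      unfolding X_def case_prod_beta'
      by (rule continuous_on_compose2[OF f]) (auto intro!: continuous_intros)
    moreover have "continuous_on K rate"
      unfolding rate_def case_prod_beta' by (intro continuous_intros c)
    moreover have "rate z \<noteq> 0" if "z \<in> K" for z
      using that rate_pos[of "fst z" "fst (snd z)" "snd (snd z)"] by (auto simp: K_def)
    ultimately show ?thesis
      unfolding \<psi>_def by (intro continuous_intros) auto
  qed
  then have ucont: "uniformly_continuous_on K \<psi>"
    using \<open>compact K\<close> by (rule compact_uniformly_continuous)
  have cont0: "continuous_on (sphere 0 1) \<psi>0"
    unfolding \<psi>0_def by (intro continuous_intros continuous_on_compose2[OF f]) auto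
  then have "bounded (\<psi>0 ` sphere 0 1)"
    by (intro compact_imp_bounded compact_continuous_image compact_sphere)
  then obtain B where "\<forall>y \<in> \<psi>0 ` sphere 0 1. norm y \<le> B"
    unfolding bounded_iff by blast
  then have B: "\<bar>\<psi>0 \<omega>\<bar> \<le> B" if "norm \<omega> = 1" for \<omega> using that by simp
  define m where "m = measure S UNIV"
  have m0: "m \<ge> 0" by (simp add: m_def)
  show ?thesis
  proof (rule LIMSEQ_I)
    fix \<epsilon> :: real assume "\<epsilon> > 0"
    \<comment> \<open>The summand 1 avoids a division by the total mass \<open>m\<close> in case it were 0.\<close>
    define \<eta> where "\<eta> = \<epsilon> / (m + 1)"
    have \<eta>: "\<eta> > 0" "\<eta> * m < \<epsilon>"
      using \<open>\<epsilon> > 0\<close> m0 by (auto simp: \<eta>_def field_simps)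
    obtain d where d: "d > 0" "\<And>x x'. x \<in> K \<Longrightarrow> x' \<in> K \<Longrightarrow> dist x' x < d \<Longrightarrow> dist (\<psi> x') (\<psi> x) < \<eta>"
      using ucont \<eta>(1) unfolding uniformly_continuous_on_def by meson
    \<comment> \<open>A defect below \<open>\<delta>\<close> moves \<open>(w, r)\<close> away from \<open>(0, r0)\<close> by less than \<open>\<delta> q\<close>: the 1 accounts for \<open>w\<close>, the fraction for \<open>r\<close>.\<close>
    define q where "q = 1 + 3 * radial_energy c r0 / r0"
    have q: "q > 0" using radial_energy_pos[OF c, of r0] r0 by (simp add: q_def add_pos_pos)
    define \<delta> where "\<delta> = min \<Delta> (d / q)"
    have \<delta>: "\<delta> > 0" "\<delta> \<le> \<Delta>" "\<delta> * q \<le> d"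
      using d(1) q \<Delta> by (auto simp: \<delta>_def min_def field_simps)
    obtain k0 where k0: "\<And>k z. k \<ge> k0 \<Longrightarrow> \<delta> \<le> norm z \<Longrightarrow> E k z = 0"
      using E_supp[OF \<delta>(1)] unfolding eventually_sequentially by blast
    show "\<exists>k0. \<forall>k\<ge>k0. norm ((LINT z|lborel. E k (spacetime (2 * radial_energy c r0) 0 - four_momentum c (fst z) - four_momentum c (snd z)) * f z)
       - (LINT \<omega>|sphere_measure. f (r0 *\<^sub>R \<omega>, - (r0 *\<^sub>R \<omega>)) * (r0 ^ (CARD('n) - 1) * radial_energy c r0 / (2 * r0)))) < \<epsilon>"
    proof (intro exI allI impI)
      fix k assume "k0 \<le> k"
      then have Ek: "E k z = 0" if "\<delta> \<le> norm z" for z using k0 that by blast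
      then have E\<Delta>: "\<forall>z. \<Delta> \<le> norm z \<longrightarrow> E k z = 0" using \<delta>(2) by auto
      have AEN: "AE z in N k. norm (fst z) = 1 \<and> \<bar>\<psi> z - \<psi>0 (fst z)\<bar> \<le> \<eta>"
        unfolding N_def
      proof (subst AE_density)
        show "AE z in Z. 0 < ennreal (\<phi> k z) \<longrightarrow> norm (fst z) = 1 \<and> \<bar>\<psi> z - \<psi>0 (fst z)\<bar> \<le> \<eta>"
          using AEZ
        proof (eventually_elim, intro impI conjI)
          fix z :: "(real ^ 'n) \<times> (real ^ 'n) \<times> real" assume n1: "norm (fst z) = 1" and pos: "0 < ennreal (\<phi> k z)"
          obtain \<omega> w r where z: "z = (\<omega>, w, r)" by (metis surj_pair)
          have ne: "\<phi> k z \<noteq> 0" using pos by auto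
          then have r: "r0 / 2 \<le> r" "r \<le> 2 * r0" and "E k (defect z) \<noteq> 0"
            by (auto simp: \<phi>_def z indicator_def split: if_splits)
          then have "norm (defect z) < \<delta>" using Ek not_le by blast
          then have small: "norm (spacetime (2 * radial_energy c r0 - pair_energy c \<omega> w r) w) < \<delta>"
            by (simp add: z defect_def W_def)
          have loc: "norm w < \<delta>" "\<bar>r - r0\<bar> \<le> 3 * radial_energy c r0 * \<delta> / r0"
            using pair_energy_localizes[OF c r0 _ _ small] n1 r r0 \<delta>(2) by (auto simp: z \<Delta>_def)
          have "dist z (\<omega>, 0, r0) \<le> norm w + \<bar>r - r0\<bar>"
            using sqrt_sum_squares_le_sum_abs[of "norm w" "r - r0"] by (simp add: z dist_Pair_Pair dist_norm norm_Pair)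
          also have "\<dots> < \<delta> * q"
          proof -
            have "\<delta> * q = \<delta> + 3 * radial_energy c r0 * \<delta> / r0" by (simp add: q_def algebra_simps)
            then show ?thesis using loc by linarith
          qed
          finally have "dist z (\<omega>, 0, r0) < d" using \<delta>(3) by linarith
          then have "dist (\<psi> z) (\<psi> (\<omega>, 0, r0)) < \<eta>"
            using n1 loc r r0 \<delta> \<Delta> by (intro d(2)) (auto simp: K_def z)
          then show "\<bar>\<psi> z - \<psi>0 (fst z)\<bar> \<le> \<eta>"
            using \<psi>_base[of \<omega>] n1 by (simp add: z dist_real_def)
        qed
      qed measurable
      have [measurable_cong]: "sets (N k) = sets (borel \<Otimes>\<^sub>M (borel \<Otimes>\<^sub>M borel))" by (simp add: N_def sZ)
      have [measurable]: "\<psi> \<in> borel_measurable (N k)" "(\<lambda>z. \<psi>0 (fst z)) \<in> borel_measurable (N k)"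
        by (simp_all add: N_def)
      have spN: "space (N k) = UNIV" by (simp add: N_def)
      have massN: "emeasure (N k) UNIV = emeasure S UNIV"
      proof -
        have "emeasure (distr (N k) S fst) UNIV = emeasure (N k) UNIV"
          by (subst emeasure_distr) (auto simp: N_def)
        then show ?thesis by (simp add: marginal[OF E\<Delta>])
      qed
      interpret N: finite_measure "N k"
        by (rule finite_measureI) (simp add: spN massN S.emeasure_finite)
      have bounds: "AE z in N k. norm (\<psi>0 (fst z)) \<le> B" "AE z in N k. norm (\<psi> z) \<le> B + \<eta>"
      proof -
        have "norm (\<psi>0 (fst z)) \<le> B \<and> norm (\<psi> z) \<le> B + \<eta>"
          if "norm (fst z) = 1 \<and> \<bar>\<psi> z - \<psi>0 (fst z)\<bar> \<le> \<eta>" for z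
          using that B[of "fst z"] by auto
        then show "AE z in N k. norm (\<psi>0 (fst z)) \<le> B" "AE z in N k. norm (\<psi> z) \<le> B + \<eta>"
          by (blast intro: eventually_mono[OF AEN])+
      qed
      have int\<psi>0: "integrable (N k) (\<lambda>z. \<psi>0 (fst z))"
        by (rule N.integrable_const_bound[OF bounds(1)]) measurable
      have int\<psi>: "integrable (N k) \<psi>"
        by (rule N.integrable_const_bound[OF bounds(2)]) measurable
      have "(LINT \<omega>|S. \<psi>0 \<omega>) = (LINT \<omega>|distr (N k) S fst. \<psi>0 \<omega>)"
        by (simp only: marginal[OF E\<Delta>])
      also have "\<dots> = (LINT z|N k. \<psi>0 (fst z))"
        by (rule integral_distr) (auto simp: N_def)
      finally have "(LINT z|N k. \<psi> z) - (LINT \<omega>|S. \<psi>0 \<omega>) = (LINT z|N k. \<psi> z - \<psi>0 (fst z))"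
        using int\<psi> int\<psi>0 by simp
      also have "norm \<dots> \<le> (LINT z|N k. norm (\<psi> z - \<psi>0 (fst z)))"
        by (rule integral_norm_bound)
      also have "\<dots> \<le> (LINT z|N k. \<eta>)"
        proof (rule integral_mono_AE)
        show "AE z in N k. norm (\<psi> z - \<psi>0 (fst z)) \<le> \<eta>"
          by (rule eventually_mono[OF AEN]) simp
      qed (use int\<psi> int\<psi>0 in auto)
      also have "\<dots> = \<eta> * m"
        by (simp add: m_def measure_def massN spN)
      finally show "norm ((LINT z|lborel. E k (spacetime (2 * radial_energy c r0) 0 - four_momentum c (fst z) - four_momentum c (snd z)) * f z)
       - (LINT \<omega>|sphere_measure. f (r0 *\<^sub>R \<omega>, - (r0 *\<^sub>R \<omega>)) * (r0 ^ (CARD('n) - 1) * radial_energy c r0 / (2 * r0)))) < \<epsilon>"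
        using \<eta>(2) unfolding I_eq[OF E\<Delta>] S_def \<psi>0_def by linarith
    qed
  qed
qed

section \<open>The Dirac limit in a general frame\<close>

definition orthochronous :: "real ^ 'n::finite option ^ 'n option \<Rightarrow> bool" where
  "orthochronous B \<longleftrightarrow> transpose B ** minkowski ** B = minkowski \<and> 0 < (B *v axis None 1) $ None"

definition momentum_map :: "real ^ 'n::finite option ^ 'n option \<Rightarrow> real \<Rightarrow> real ^ 'n \<Rightarrow> real ^ 'n" where
  "momentum_map B c p = spatial (B *v four_momentum c p)"

lemma mink_prod_time_axis: "mink_prod (axis None 1) (axis None 1 :: real ^ 'n::finite option) < 0"
  by (simp add: mink_prod_eq axis_def spatial_def inner_vec_def)

lemma mink_prod_four_momentum: "mink_prod (four_momentum c p) (four_momentum c p) = - c\<^sup>2"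
  using energy_squared[of c p]
  by (simp add: mink_prod_eq four_momentum_spacetime dot_square_norm flip: power2_eq_square)

lemma orthochronous_four_momentum:
  assumes B: "orthochronous B" and c: "c > 0"
  shows "B *v four_momentum c p = four_momentum c (momentum_map B c p)"
proof -
  let ?x = "B *v four_momentum c p"
  note form = B[unfolded orthochronous_def, THEN conjunct1]
  note fut = B[unfolded orthochronous_def, THEN conjunct2]
  have "0 < ?x $ None"
    using future_lorentz_iff[OF form _ mink_prod_time_axis fut, of "four_momentum c p"] c energy_pos[OF c, of p]
    by (simp add: mink_prod_four_momentum axis_def) (simp add: four_momentum_spacetime)
  moreover have "(?x $ None)\<^sup>2 = c\<^sup>2 + (norm (spatial ?x))\<^sup>2"
    using mink_prod_lorentz[OF form, of "four_momentum c p" "four_momentum c p"]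
    by (simp add: mink_prod_four_momentum) (simp add: mink_prod_eq dot_square_norm flip: power2_eq_square)
  ultimately have "?x $ None = energy c (spatial ?x)"
    unfolding energy_def by (metis less_imp_le real_sqrt_unique)
  then show ?thesis
    by (simp add: vec_option_eq_iff four_momentum_spacetime momentum_map_def)
qed

lemma continuous_on_momentum_map [continuous_intros]:
  assumes "continuous_on S f" shows "continuous_on S (\<lambda>x. momentum_map B c (f x))"
  unfolding momentum_map_def four_momentum_spacetime
  by (intro continuous_on_spatial bounded_linear.continuous_on[OF matrix_vector_mul_bounded_linear]
      continuous_intros assms)

lemma borel_measurable_momentum_map [measurable]: "momentum_map B c \<in> borel_measurable borel"
  by (intro borel_measurable_continuous_onI continuous_intros)

text \<open>
  Lorentz invariance of \<open>dp / p\<^sup>0\<close>, applied to \<open>F\<close> times the time component: on the left this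
  factor cancels \<open>p\<^sup>0\<close>, on the right it produces the ratio of the energies.
\<close>
lemma nn_integral_momentum_map:
  fixes F :: "real ^ 'n::finite \<Rightarrow> ennreal"
  assumes B: "orthochronous B" and c: "c > 0" and [measurable]: "F \<in> borel_measurable borel"
  shows "(\<integral>\<^sup>+p. F p \<partial>lborel)
    = (\<integral>\<^sup>+u. ennreal (energy c (momentum_map B c u) / energy c u) * F (momentum_map B c u) \<partial>lborel)"
proof -
  note form = B[unfolded orthochronous_def, THEN conjunct1]
  note fut = B[unfolded orthochronous_def, THEN conjunct2]
  define G where "G x = ennreal (x $ None) * F (spatial x)" for x
  have [measurable]: "G \<in> borel_measurable borel" unfolding G_def by measurable
  have G: "ennreal (1 / energy c u) * G (four_momentum c p)
      = ennreal (energy c p / energy c u) * F p" for u p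
    using energy_pos[OF c, of u] energy_pos[OF c, of p]
    by (simp add: G_def four_momentum_spacetime mult.assoc[symmetric] ennreal_mult[symmetric])
  have "(\<integral>\<^sup>+u. ennreal (1 / energy c u) * G (B *v four_momentum c u) \<partial>lborel)
      = (\<integral>\<^sup>+u. ennreal (1 / energy c u) * G (four_momentum c u) \<partial>lborel)"
    by (rule nn_integral_mass_shell_lorentz[OF form _ mink_prod_time_axis fut]) (use c in \<open>auto simp: axis_def\<close>)
  moreover have "energy c u \<noteq> 0" for u :: "real ^ 'n"
    using energy_pos[OF c, of u] by simp
  ultimately show ?thesis
    by (simp add: orthochronous_four_momentum[OF B c] G)
qed

lemma lborel_momentum_map_pair:
  fixes B :: "real ^ 'n::finite option ^ 'n option"
  assumes B: "orthochronous B" and c: "c > 0"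
  defines "j \<equiv> \<lambda>u. energy c (momentum_map B c u) / energy c u"
  shows "lborel = distr (density lborel (\<lambda>z. ennreal (j (fst z) * j (snd z)))) borel
     (\<lambda>z. (momentum_map B c (fst z), momentum_map B c (snd z)))"
  (is "_ = ?D")
proof (rule measure_eqI)
  fix A :: "((real ^ 'n) \<times> (real ^ 'n)) set" assume "A \<in> sets lborel"
  then have A: "A \<in> sets borel" by simp
  then have [measurable]: "A \<in> sets (borel \<Otimes>\<^sub>M borel)" by (simp only: borel_prod)
  have [measurable]: "j \<in> borel_measurable borel" unfolding j_def by measurable
  have j0: "0 \<le> j u" for u
    using energy_pos[OF c, of "momentum_map B c u"] energy_pos[OF c, of u] by (simp add: j_def)
  have m: "(\<lambda>z. (momentum_map B c (fst z), momentum_map B c (snd z)))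
      \<in> borel \<Otimes>\<^sub>M borel \<rightarrow>\<^sub>M borel \<Otimes>\<^sub>M borel"
    by measurable
  have "emeasure lborel A = (\<integral>\<^sup>+u. \<integral>\<^sup>+v. indicator A (u, v) \<partial>lborel \<partial>lborel)"
    by (subst lborel_prod[symmetric], subst lborel.emeasure_pair_measure) (auto simp: borel_prod[symmetric])
  also have "\<dots> = (\<integral>\<^sup>+u. ennreal (j u) * (\<integral>\<^sup>+v. ennreal (j v) * indicator A (momentum_map B c u, momentum_map B c v) \<partial>lborel) \<partial>lborel)"
    unfolding j_def by (subst nn_integral_momentum_map[OF B c], measurable, subst nn_integral_momentum_map[OF B c], measurable)
  also have "\<dots> = (\<integral>\<^sup>+u. \<integral>\<^sup>+v. ennreal (j u * j v) * indicator A (momentum_map B c u, momentum_map B c v) \<partial>lborel \<partial>lborel)"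
    by (subst nn_integral_cmult[symmetric]) (auto simp: ennreal_mult j0 mult_ac)
  also have "\<dots> = (\<integral>\<^sup>+z. ennreal (j (fst z) * j (snd z)) * indicator A (momentum_map B c (fst z), momentum_map B c (snd z)) \<partial>lborel)"
    by (subst lborel_prod[symmetric], subst lborel.nn_integral_fst[symmetric]) auto
  also have "\<dots> = (\<integral>\<^sup>+z. indicator A z \<partial>?D)"
    using m A unfolding borel_prod
    by (subst nn_integral_distr, simp, simp, subst nn_integral_density) (auto simp: borel_prod[symmetric])
  also have "\<dots> = emeasure ?D A" using A by simp
  finally show "emeasure lborel A = emeasure ?D A" .
qed simp

lemma lorentz_form_injective:
  fixes B :: "real ^ 'n::finite option ^ 'n option"
  assumes "transpose B ** minkowski ** B = minkowski"
  shows "inj ((*v) B)"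
proof (rule injI)
  fix x y :: "real ^ 'n option" assume "B *v x = B *v y"
  then have "transpose B ** minkowski *v (B *v x) = transpose B ** minkowski *v (B *v y)"
    by simp
  then have "minkowski *v (minkowski *v x) = minkowski *v (minkowski *v y)"
    by (simp add: matrix_vector_mul_assoc assms)
  then show "x = y"
    by (simp add: matrix_vector_mul_assoc minkowski_involution)
qed

text \<open>
  The Lorentz transformation \<open>B\<close> carries the center-of-momentum frame to the frame of the observer. It maps
  four-momenta to four-momenta, so the defect becomes \<open>B\<close> applied to the defect in the center-of-momentum
  frame; the kernels \<open>D k\<close>, composed with \<open>B\<close>, keep their integral and still have shrinking supports because
  \<open>B\<close> is bounded below. The energy ratios of \<open>lborel_momentum_map_pair\<close> join the test function.
\<close>
lemma lab_delta_limit: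
  fixes D :: "nat \<Rightarrow> real ^ 'n::finite option \<Rightarrow> real" and f :: "(real ^ 'n) \<times> (real ^ 'n) \<Rightarrow> real"
    and B :: "real ^ 'n option ^ 'n option"
  assumes B: "orthochronous B" and c: "c > 0" and r0: "r0 > 0"
    and D_meas [measurable]: "\<And>k. D k \<in> borel_measurable borel"
    and D_nonneg: "\<And>k z. 0 \<le> D k z"
    and D_mass: "\<And>k. (\<integral>\<^sup>+z. ennreal (D k z) \<partial>lborel) = 1"
    and D_supp: "\<And>\<delta>. \<delta> > 0 \<Longrightarrow> \<forall>\<^sub>F k in sequentially. \<forall>z. \<delta> \<le> norm z \<longrightarrow> D k z = 0"
    and f: "continuous_on UNIV f"
  defines "T \<equiv> momentum_map B c"
  shows "(\<lambda>k. LINT z|lborel. D k (B *v spacetime (2 * radial_energy c r0) 0 - four_momentum c (fst z) - four_momentum c (snd z)) * f z)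
    \<longlonglongrightarrow> (LINT \<omega>|sphere_measure. energy c (T (r0 *\<^sub>R \<omega>)) * energy c (T (- (r0 *\<^sub>R \<omega>)))
       * (r0 ^ (CARD('n) - 1) / (2 * r0 * radial_energy c r0)) * f (T (r0 *\<^sub>R \<omega>), T (- (r0 *\<^sub>R \<omega>))))"
proof -
  note form = B[unfolded orthochronous_def, THEN conjunct1]
  have [measurable]: "T \<in> borel_measurable borel" unfolding T_def by measurable
  have contT: "continuous_on UNIV T" unfolding T_def by (intro continuous_intros)
  define j where "j u = energy c (T u) / energy c u" for u
  have [measurable]: "j \<in> borel_measurable borel" unfolding j_def by measurable
  have j0: "0 \<le> j u" for u
    using energy_pos[OF c, of "T u"] energy_pos[OF c, of u] by (simp add: j_def)
  have contj: "continuous_on UNIV j"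
    unfolding j_def by (intro continuous_intros contT) (use energy_pos[OF c] in \<open>auto simp: less_le\<close>)
  have [measurable]: "f \<in> borel_measurable (borel \<Otimes>\<^sub>M borel)"
    using borel_measurable_continuous_onI[OF f] by (simp add: borel_prod)
  define E where "E k z = D k (B *v z)" for k z
  define f' where "f' z = f (T (fst z), T (snd z)) * (j (fst z) * j (snd z))" for z
  have contf': "continuous_on UNIV f'"
    unfolding f'_def
    by (intro continuous_intros continuous_on_compose2[OF f] continuous_on_compose2[OF contT]
        continuous_on_compose2[OF contj]) auto
  have E_mass: "(\<integral>\<^sup>+z. ennreal (E k z) \<partial>lborel) = 1" for k
  proof -
    have "(\<integral>\<^sup>+z. ennreal (D k z) \<partial>lborel) = (\<integral>\<^sup>+z. ennreal (D k z) \<partial>distr lborel borel ((*v) B))"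
      by (simp add: distr_lborel_lorentz[OF form])
    also have "\<dots> = (\<integral>\<^sup>+z. ennreal (E k z) \<partial>lborel)"
      unfolding E_def by (rule nn_integral_distr) auto
    finally show ?thesis by (simp add: D_mass)
  qed
  obtain b where b: "b > 0" "\<And>x. b * norm x \<le> norm (B *v x)"
    using linear_inj_bounded_below_pos[OF matrix_vector_mul_linear lorentz_form_injective[OF form]]
    by (metis mult.commute)
  have E_supp: "\<forall>\<^sub>F k in sequentially. \<forall>z. \<delta> \<le> norm z \<longrightarrow> E k z = 0" if "\<delta> > 0" for \<delta>
  proof -
    have "b * \<delta> > 0" using that b by simp
    from D_supp[OF this] show ?thesis
    proof eventually_elim
      case (elim k)
      have "b * \<delta> \<le> norm (B *v z)" if "\<delta> \<le> norm z" for z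
        using that b by (meson mult_left_mono less_imp_le order_trans)
      then show ?case using elim by (simp add: E_def)
    qed
  qed
  have "(\<lambda>k. LINT z|lborel. E k (spacetime (2 * radial_energy c r0) 0 - four_momentum c (fst z) - four_momentum c (snd z)) * f' z)
    \<longlonglongrightarrow> (LINT \<omega>|sphere_measure. f' (r0 *\<^sub>R \<omega>, - (r0 *\<^sub>R \<omega>)) * (r0 ^ (CARD('n) - 1) * radial_energy c r0 / (2 * r0)))"
    by (rule cm_delta_limit[OF c r0 _ _ E_mass E_supp contf'])
       (auto simp: E_def D_nonneg)
  moreover have "(LINT z|lborel. D k (B *v spacetime (2 * radial_energy c r0) 0 - four_momentum c (fst z) - four_momentum c (snd z)) * f z)
    = (LINT z|lborel. E k (spacetime (2 * radial_energy c r0) 0 - four_momentum c (fst z) - four_momentum c (snd z)) * f' z)" for k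
  proof -
    define g where "g z = D k (B *v spacetime (2 * radial_energy c r0) 0 - four_momentum c (fst z) - four_momentum c (snd z)) * f z" for z
    have [measurable]: "g \<in> borel_measurable borel"
      unfolding g_def borel_prod[symmetric] by measurable
    have m [measurable]: "(\<lambda>z. (T (fst z), T (snd z))) \<in> borel_measurable borel"
      unfolding borel_prod[symmetric] by measurable
    have mj [measurable]: "(\<lambda>z. j (fst z) * j (snd z)) \<in> borel_measurable borel"
      unfolding borel_prod[symmetric] by measurable
    have gT: "g (T (fst z), T (snd z)) = E k (spacetime (2 * radial_energy c r0) 0 - four_momentum c (fst z) - four_momentum c (snd z)) * f (T (fst z), T (snd z))" for z
      by (simp add: g_def E_def T_def orthochronous_four_momentum[OF B c, symmetric] matrix_vector_mult_diff_distrib)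
    have "(LINT z|lborel. g z) = (LINT z|distr (density lborel (\<lambda>z. ennreal (j (fst z) * j (snd z)))) borel (\<lambda>z. (T (fst z), T (snd z))). g z)"
      using lborel_momentum_map_pair[OF B c] by (simp add: j_def T_def)
    also have "\<dots> = (LINT z|density lborel (\<lambda>z. ennreal (j (fst z) * j (snd z))). g (T (fst z), T (snd z)))"
      by (rule integral_distr) auto
    also have "\<dots> = (LINT z|lborel. (j (fst z) * j (snd z)) *\<^sub>R g (T (fst z), T (snd z)))"
      by (rule integral_density) (use mj j0 in auto)
    finally show ?thesis
      unfolding gT f'_def real_scaleR_def by (simp only: g_def mult_ac)
  qed
  moreover have "(LINT \<omega>|sphere_measure. f' (r0 *\<^sub>R \<omega>, - (r0 *\<^sub>R \<omega>)) * (r0 ^ (CARD('n) - 1) * radial_energy c r0 / (2 * r0)))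
    = (LINT \<omega>|sphere_measure. energy c (T (r0 *\<^sub>R \<omega>)) * energy c (T (- (r0 *\<^sub>R \<omega>)))
       * (r0 ^ (CARD('n) - 1) / (2 * r0 * radial_energy c r0)) * f (T (r0 *\<^sub>R \<omega>), T (- (r0 *\<^sub>R \<omega>))))"
  proof (rule integral_cong_AE)
    show "AE \<omega> in (sphere_measure :: (real ^ 'n) measure). f' (r0 *\<^sub>R \<omega>, - (r0 *\<^sub>R \<omega>)) * (r0 ^ (CARD('n) - 1) * radial_energy c r0 / (2 * r0))
      = energy c (T (r0 *\<^sub>R \<omega>)) * energy c (T (- (r0 *\<^sub>R \<omega>)))
       * (r0 ^ (CARD('n) - 1) / (2 * r0 * radial_energy c r0)) * f (T (r0 *\<^sub>R \<omega>), T (- (r0 *\<^sub>R \<omega>)))"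
      using AE_sphere_measure
    proof eventually_elim
      case (elim \<omega>)
      have "energy c (- (r0 *\<^sub>R \<omega>)) = radial_energy c r0" "energy c (r0 *\<^sub>R \<omega>) = radial_energy c r0"
        using energy_on_ray[OF elim, of c r0] by (simp_all add: energy_def)
      then show ?case
        using radial_energy_pos[OF c, of r0] r0 by (simp add: f'_def j_def field_simps)
    qed
  qed (simp_all add: f'_def)
  ultimately show ?thesis by simp
qed

section \<open>Products of Dirac sequences and uniqueness of the limit measure\<close>

lemma dirac_sequence_product:
  fixes d :: "'m::finite \<Rightarrow> nat \<Rightarrow> real \<Rightarrow> real"
  assumes "\<And>\<mu>. dirac_sequence (d \<mu>)"
  defines "D \<equiv> \<lambda>k (z :: real ^ 'm). \<Prod>\<mu>\<in>UNIV. d \<mu> k (z $ \<mu>)"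
  shows "D k \<in> borel_measurable borel" "0 \<le> D k z" "(\<integral>\<^sup>+z. ennreal (D k z) \<partial>lborel) = 1"
    and "\<delta> > 0 \<Longrightarrow> \<forall>\<^sub>F k in sequentially. \<forall>z. \<delta> \<le> norm z \<longrightarrow> D k z = 0"
proof -
  have cont: "continuous_on UNIV (d \<mu> k)" and nonneg: "0 \<le> d \<mu> k x" and int: "(d \<mu> k has_integral 1) UNIV"
    and supp: "\<epsilon> > 0 \<Longrightarrow> \<forall>\<^sub>F k in sequentially. \<forall>x. \<epsilon> \<le> \<bar>x\<bar> \<longrightarrow> d \<mu> k x = 0" for \<mu> k x \<epsilon>
    using assms(1)[of \<mu>] by (auto simp: dirac_sequence_def)
  have [measurable]: "d \<mu> k \<in> borel_measurable borel" for \<mu> k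
    by (rule borel_measurable_continuous_onI[OF cont])
  show "D k \<in> borel_measurable borel" unfolding D_def by measurable
  show "0 \<le> D k z" unfolding D_def by (intro prod_nonneg ballI nonneg)
  define ix where "ix b = inv (\<lambda>\<mu>::'m. axis \<mu> (1::real)) b" for b
  have inj: "inj (\<lambda>\<mu>::'m. axis \<mu> (1::real))"
    by (auto simp: inj_on_def axis_eq_axis)
  have ix: "ix (axis \<mu> 1) = \<mu>" for \<mu>
    unfolding ix_def by (rule inv_f_f[OF inj])
  have Basis: "Basis = (\<lambda>\<mu>::'m. axis \<mu> (1::real)) ` UNIV"
    by (auto simp: Basis_vec_def)
  have "(\<integral>\<^sup>+z. ennreal (D k z) \<partial>lborel)
      = (\<integral>\<^sup>+z. (\<Prod>b\<in>Basis. ennreal (d (ix b) k (z \<bullet> b))) \<partial>lborel)"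
    unfolding D_def Basis
    by (subst prod.reindex[OF inj]) (simp add: ix inner_axis prod_ennreal nonneg)
  also have "\<dots> = (\<Prod>b\<in>(Basis :: (real ^ 'm) set). \<integral>\<^sup>+x. ennreal (d (ix b) k x) \<partial>lborel)"
    by (rule nn_integral_lborel_prod) auto
  also have "\<dots> = 1"
    using nn_integral_has_integral_lborel[OF _ _ int] nonneg by (simp add: prod.neutral_const)
  finally show "(\<integral>\<^sup>+z. ennreal (D k z) \<partial>lborel) = 1" .
  assume "\<delta> > 0"
  define \<epsilon> where "\<epsilon> = \<delta> / CARD('m)"
  have "\<epsilon> > 0" using \<open>\<delta> > 0\<close> by (simp add: \<epsilon>_def)
  have "\<forall>\<^sub>F k in sequentially. \<forall>\<mu>. \<forall>x. \<epsilon> \<le> \<bar>x\<bar> \<longrightarrow> d \<mu> k x = 0"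
    by (intro eventually_all_finite supp[OF \<open>\<epsilon> > 0\<close>])
  then show "\<forall>\<^sub>F k in sequentially. \<forall>z. \<delta> \<le> norm z \<longrightarrow> D k z = 0"
  proof (rule eventually_mono, intro allI impI)
    fix k and z :: "real ^ 'm"
    assume *: "\<forall>\<mu> x. \<epsilon> \<le> \<bar>x\<bar> \<longrightarrow> d \<mu> k x = 0" and z: "\<delta> \<le> norm z"
    have "\<exists>\<mu>. \<epsilon> \<le> \<bar>z $ \<mu>\<bar>"
    proof (rule ccontr)
      assume "\<nexists>\<mu>. \<epsilon> \<le> \<bar>z $ \<mu>\<bar>"
      then have "(\<Sum>\<mu>\<in>UNIV. \<bar>z $ \<mu>\<bar>) < (\<Sum>\<mu>\<in>(UNIV :: 'm set). \<epsilon>)"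
        by (intro sum_strict_mono) (auto simp: not_le)
      also have "\<dots> = \<delta>" by (simp add: \<epsilon>_def)
      finally show False using norm_le_l1_cart[of z] z by simp
    qed
    then show "D k z = 0"
      using * unfolding D_def by (auto intro!: prod_zero)
  qed
qed

text \<open>
  Tent functions of height \<open>k + 1\<close> and width \<open>2 / (k + 1)\<close>; their existence is what makes the defining
  property of \<open>is_dirac_measure\<close> non-vacuous and the measure unique.
\<close>
lemma dirac_sequence_tent: "dirac_sequence (\<lambda>k x. max 0 (real (Suc k) - (real (Suc k))\<^sup>2 * \<bar>x\<bar>))"
  unfolding dirac_sequence_def
proof (intro conjI allI impI)
  fix k :: nat
  define r where "r = real (Suc k)"
  have r: "r > 0" by (simp add: r_def)
  let ?h = "\<lambda>x. max 0 (r - r\<^sup>2 * \<bar>x\<bar>)"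
  have right: "(?h has_integral 1 / 2) {0..1 / r}"
  proof -
    have "((\<lambda>x. r - r\<^sup>2 * x) has_integral (r * (1 / r) - r\<^sup>2 * (1 / r)\<^sup>2 / 2) - (r * 0 - r\<^sup>2 * 0\<^sup>2 / 2)) {0..1 / r}"
      using r by (intro fundamental_theorem_of_calculus)
        (auto intro!: derivative_eq_intros simp: has_real_derivative_iff_has_vector_derivative[symmetric])
    then have "((\<lambda>x. r - r\<^sup>2 * x) has_integral 1 / 2) {0..1 / r}"
      using r by (simp add: power2_eq_square)
    then show ?thesis
      by (rule has_integral_eq[rotated]) (use r in \<open>auto simp: power2_eq_square field_simps max_def\<close>)
  qed
  have left: "(?h has_integral 1 / 2) {- (1 / r)..0}"
    using right has_integral_reflect_real[of ?h "1 / 2" "1 / r" 0] by simp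
  have "(?h has_integral 1 / 2 + 1 / 2) {- (1 / r)..1 / r}"
    by (rule has_integral_combine[OF _ _ left right]) (use r in auto)
  then have "(?h has_integral 1) {- (1 / r)..1 / r}" by simp
  moreover have "?h x = 0" if "x \<notin> {- (1 / r)..1 / r}" for x
  proof -
    have "1 / r \<le> \<bar>x\<bar>" using that by auto
    then have "r\<^sup>2 * (1 / r) \<le> r\<^sup>2 * \<bar>x\<bar>" by (intro mult_left_mono) auto
    then show ?thesis using r by (simp add: power2_eq_square)
  qed
  ultimately show "((\<lambda>x. max 0 (real (Suc k) - (real (Suc k))\<^sup>2 * \<bar>x\<bar>)) has_integral 1) UNIV"
    unfolding r_def[symmetric] by (rule has_integral_on_superset) simp_all
next
  fix k :: nat
  show "continuous_on UNIV (\<lambda>x. max 0 (real (Suc k) - (real (Suc k))\<^sup>2 * \<bar>x\<bar>))"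
    by (intro continuous_intros)
next
  fix \<epsilon> :: real assume "\<epsilon> > 0"
  obtain k0 :: nat where k0: "1 / \<epsilon> < real k0" using reals_Archimedean2 by blast
  show "\<forall>\<^sub>F k in sequentially. \<forall>x. \<epsilon> \<le> \<bar>x\<bar> \<longrightarrow> max 0 (real (Suc k) - (real (Suc k))\<^sup>2 * \<bar>x\<bar>) = 0"
    unfolding eventually_sequentially
  proof (intro exI[of _ k0] allI impI)
    fix k x assume "k0 \<le> k" "\<epsilon> \<le> \<bar>x\<bar>"
    define r where "r = real (Suc k)"
    have "1 / \<epsilon> \<le> r" using k0 \<open>k0 \<le> k\<close> by (simp add: r_def)
    then have "1 \<le> r * \<epsilon>" using \<open>\<epsilon> > 0\<close> by (simp add: field_simps)
    also have "\<dots> \<le> r * \<bar>x\<bar>" using \<open>\<epsilon> \<le> \<bar>x\<bar>\<close> by (intro mult_left_mono) (auto simp: r_def)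
    finally have "r * 1 \<le> r * (r * \<bar>x\<bar>)" by (intro mult_left_mono) (auto simp: r_def)
    then show "max 0 (real (Suc k) - (real (Suc k))\<^sup>2 * \<bar>x\<bar>) = 0"
      unfolding r_def[symmetric] by (simp add: power2_eq_square)
  qed
qed simp

text \<open>
  The indicator of an open box is the pointwise limit of the continuous functions
  \<open>min 1 (n \<cdot> dist(x, complement))\<close>, which vanish outside the closed box. Dominated convergence shows that
  the two measures agree on boxes, and these generate the Borel sets.
\<close>
lemma radon_measure_eqI:
  fixes M M' :: "'a::euclidean_space measure"
  assumes sets: "sets M = sets borel" "sets M' = sets borel"
    and fin: "\<And>K. compact K \<Longrightarrow> emeasure M K < \<infinity>" "\<And>K. compact K \<Longrightarrow> emeasure M' K < \<infinity>"
    and eq: "\<And>f K. continuous_on UNIV f \<Longrightarrow> compact K \<Longrightarrow> (\<And>x. x \<notin> K \<Longrightarrow> f x = (0::real))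
      \<Longrightarrow> (LINT x|M. f x) = (LINT x|M'. f x)"
  shows "M = M'"
proof (rule measure_eqI_generator_eq[where E = "range (\<lambda>(a, b). box a b :: 'a set)"
      and A = "\<lambda>n::nat. box (- (real n *\<^sub>R One)) (real n *\<^sub>R One)" and \<Omega> = UNIV])
  show "Int_stable (range (\<lambda>(a, b). box a b :: 'a set))"
    by (auto simp: Int_stable_def box_Int_box)
  show "sets M = sigma_sets UNIV (range (\<lambda>(a, b). box a b :: 'a set))"
    "sets M' = sigma_sets UNIV (range (\<lambda>(a, b). box a b :: 'a set))"
    using sets by (simp_all add: borel_eq_box)
  have box_fin: "emeasure N (box a b) \<noteq> \<infinity>"
    if "sets N = sets borel" "\<And>K. compact K \<Longrightarrow> emeasure N K < \<infinity>" for N and a b :: 'a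
  proof -
    have "emeasure N (box a b) \<le> emeasure N (cbox a b)"
      using that(1) by (intro emeasure_mono box_subset_cbox) auto
    also have "\<dots> < \<infinity>" by (rule that(2)) simp
    finally show ?thesis by simp
  qed
  show "emeasure M (box (- (real n *\<^sub>R One)) (real n *\<^sub>R One)) \<noteq> \<infinity>" for n
    by (rule box_fin[OF sets(1) fin(1)])
  show "emeasure M X = emeasure M' X" if X_box: "X \<in> range (\<lambda>(a, b). box a b)" for X
  proof -
    obtain a b where X: "X = box a b" using X_box by auto
    have "- box a b \<noteq> {}" using bounded_box[of a b] not_bounded_UNIV by (metis Compl_empty_eq double_complement)
    define f where "f n x = min 1 (real n * infdist x (- box a b))" for n x
    have cont: "continuous_on UNIV (f n)" for n
      unfolding f_def by (intro continuous_intros)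
    have f0: "f n x = 0" if "x \<notin> cbox a b" for n x
    proof -
      have "x \<in> - box a b" using that box_subset_cbox by blast
      then show ?thesis by (simp add: f_def)
    qed
    have lim: "(\<lambda>n. LINT x|N. f n x) \<longlonglongrightarrow> measure N (box a b)"
      if "sets N = sets borel" "\<And>K. compact K \<Longrightarrow> emeasure N K < \<infinity>" for N
    proof -
      have [measurable_cong]: "sets N = sets borel" by fact
      have "space N = UNIV" using sets_eq_imp_space_eq[OF that(1)] by simp
      have [measurable]: "f n \<in> borel_measurable N" for n
        using borel_measurable_continuous_onI[OF cont] by measurable
      have "(\<lambda>n. LINT x|N. f n x) \<longlonglongrightarrow> (LINT x|N. indicator (box a b) x :: real)"
      proof (rule integral_dominated_convergence[where w = "indicator (cbox a b)"])
        show "integrable N (indicator (cbox a b) :: _ \<Rightarrow> real)"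
          using that(1) that(2)[of "cbox a b"] by (simp add: integrable_indicator_iff)
        show "AE x in N. (\<lambda>n. f n x) \<longlonglongrightarrow> indicator (box a b) x"
        proof (rule AE_I2)
          fix x
          show "(\<lambda>n. f n x) \<longlonglongrightarrow> indicator (box a b) x"
          proof (cases "x \<in> box a b")
            case False
            then show ?thesis by (simp add: f_def)
          next
            case True
            then have pos: "infdist x (- box a b) > 0"
              using \<open>- box a b \<noteq> {}\<close> open_box
              by (metis Compl_iff closed_Compl in_closed_iff_infdist_zero infdist_nonneg less_eq_real_def)
            obtain n0 :: nat where n0: "1 / infdist x (- box a b) < real n0" using reals_Archimedean2 by blast
            have "f n x = 1" if "n0 \<le> n" for n
            proof -
              have "1 / infdist x (- box a b) \<le> real n" using n0 that by simp
              then show ?thesis using pos by (simp add: f_def field_simps)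
            qed
            then have "\<forall>\<^sub>F n in sequentially. f n x = 1"
              unfolding eventually_sequentially by blast
            then show ?thesis using True by (simp add: tendsto_eventually)
          qed
        qed
        show "AE x in N. norm (f n x) \<le> indicator (cbox a b) x" for n
        proof (rule AE_I2)
          fix x
          have "0 \<le> f n x" "f n x \<le> 1" by (auto simp: f_def infdist_nonneg)
          then show "norm (f n x) \<le> indicator (cbox a b) x"
            using f0[of x n] by (cases "x \<in> cbox a b") auto
        qed
      qed measurable
      then show ?thesis using \<open>space N = UNIV\<close> by simp
    qed
    have "(LINT x|M. f n x) = (LINT x|M'. f n x)" for n
      by (rule eq[OF cont compact_cbox f0])
    then have "measure M (box a b) = measure M' (box a b)"
      using lim[OF sets(1) fin(1)] lim[OF sets(2) fin(2)] LIMSEQ_unique by simp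
    then show ?thesis
      using box_fin[OF sets(1) fin(1), of a b] box_fin[OF sets(2) fin(2), of a b]
      by (simp add: X emeasure_eq_ennreal_measure)
  qed
qed (use UN_box_eq_UNIV in auto)

lemma is_dirac_measure_unique:
  assumes M: "is_dirac_measure \<Phi> M" and M': "is_dirac_measure \<Phi> M'"
  shows "M = M'"
proof (rule radon_measure_eqI)
  fix f :: "'a \<Rightarrow> real" and K
  assume f: "continuous_on UNIV f" "compact K" "\<And>x. x \<notin> K \<Longrightarrow> f x = 0"
  let ?d = "\<lambda>_ k x. max 0 (real (Suc k) - (real (Suc k))\<^sup>2 * \<bar>x\<bar>)"
  have lim: "(\<lambda>k. LINT x|lborel. (\<Prod>\<mu>\<in>UNIV. ?d \<mu> k (\<Phi> x $ \<mu>)) * f x) \<longlonglongrightarrow> (LINT x|N. f x)"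
    if "is_dirac_measure \<Phi> N" for N
    using that[unfolded is_dirac_measure_def, THEN conjunct2, THEN conjunct2, rule_format, of ?d f]
      dirac_sequence_tent f by auto
  show "(LINT x|M. f x) = (LINT x|M'. f x)"
    using lim[OF M] lim[OF M'] by (rule LIMSEQ_unique)
qed (use M M' in \<open>auto simp: is_dirac_measure_def\<close>)

lemma dirac_measure_eqI: "is_dirac_measure \<Phi> M \<Longrightarrow> dirac_measure \<Phi> = M"
  unfolding dirac_measure_def by (rule the_equality) (auto intro: is_dirac_measure_unique)

section \<open>Collision kinematics\<close>

lemma proper_lorentz_matrix:
  assumes "proper_lorentz \<Lambda>" shows "transpose \<Lambda> ** minkowski ** \<Lambda> = minkowski"
  unfolding vec_eq_iff
proof (intro allI)
  fix \<mu> \<nu>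
  have "(transpose \<Lambda> ** minkowski ** \<Lambda>) $ \<mu> $ \<nu>
    = (\<Sum>\<tau>\<in>UNIV. \<Sum>\<kappa>\<in>UNIV. \<Lambda> $ \<kappa> $ \<mu> * minkowski $ \<kappa> $ \<tau> * \<Lambda> $ \<tau> $ \<nu>)"
    by (simp add: matrix_matrix_mult_def transpose_def sum_distrib_right)
  also have "\<dots> = (\<Sum>\<kappa>\<in>UNIV. \<Sum>\<tau>\<in>UNIV. \<Lambda> $ \<kappa> $ \<mu> * minkowski $ \<kappa> $ \<tau> * \<Lambda> $ \<tau> $ \<nu>)"
    by (rule sum.swap)
  finally show "(transpose \<Lambda> ** minkowski ** \<Lambda>) $ \<mu> $ \<nu> = minkowski $ \<mu> $ \<nu>"
    using assms by (simp add: proper_lorentz_def)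
qed

text \<open>
  The relation \<open>\<Lambda>\<^sup>T g \<Lambda> = g\<close> and \<open>g g = 1\<close> make \<open>g \<Lambda>\<^sup>T g\<close> the inverse of \<open>\<Lambda>\<close>.
\<close>
definition lorentz_inverse :: "real ^ 'n::finite option ^ 'n option \<Rightarrow> real ^ 'n option ^ 'n option" where
  "lorentz_inverse \<Lambda> = minkowski ** transpose \<Lambda> ** minkowski"

lemma lorentz_inverse:
  fixes \<Lambda> :: "real ^ 'n::finite option ^ 'n option"
  assumes "transpose \<Lambda> ** minkowski ** \<Lambda> = minkowski"
  shows "lorentz_inverse \<Lambda> ** \<Lambda> = mat 1" "\<Lambda> ** lorentz_inverse \<Lambda> = mat 1"
    "transpose (lorentz_inverse \<Lambda>) ** minkowski ** lorentz_inverse \<Lambda> = minkowski"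
proof -
  let ?B = "lorentz_inverse \<Lambda>"
  show left: "?B ** \<Lambda> = mat 1"
    unfolding lorentz_inverse_def by (metis assms matrix_mul_assoc minkowski_involution)
  then show right: "\<Lambda> ** ?B = mat 1"
    by (simp add: matrix_left_right_inverse)
  have "transpose ?B ** minkowski ** ?B = transpose ?B ** (transpose \<Lambda> ** minkowski ** \<Lambda>) ** ?B"
    by (simp only: assms)
  also have "\<dots> = transpose (\<Lambda> ** ?B) ** minkowski ** (\<Lambda> ** ?B)"
    by (simp only: matrix_transpose_mul matrix_mul_assoc)
  finally show "transpose ?B ** minkowski ** ?B = minkowski"
    by (simp add: right)
qed

lemma matrix_inv_minkowski: "matrix_inv minkowski = minkowski"
proof -
  have "\<exists>C. minkowski ** C = mat 1 \<and> C ** minkowski = mat 1"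
    using minkowski_involution by blast
  then have "minkowski ** matrix_inv minkowski = mat 1"
    unfolding matrix_inv_def by (rule someI2_ex) blast
  then show ?thesis
    by (metis matrix_mul_assoc matrix_mul_lid matrix_mul_rid minkowski_involution)
qed

lemma L_matrix_eq: "L_matrix \<Lambda> $ \<mu> $ \<kappa> = - (minkowski ** transpose \<Lambda>) $ \<mu> $ \<kappa>"
  by (simp add: L_matrix_def matrix_inv_minkowski matrix_matrix_mult_def transpose_def)

lemma minkowski_spacetime: "minkowski *v spacetime t x = spacetime (- t) x"
proof -
  have "(\<Sum>\<nu>\<in>UNIV. minkowski $ \<mu> $ \<nu> * spacetime t x $ \<nu>) = minkowski $ \<mu> $ \<mu> * spacetime t x $ \<mu>" for \<mu>
    by (subst sum.remove[of _ \<mu>]) (auto simp: minkowski_def intro!: sum.neutral)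
  then have "(minkowski *v spacetime t x) $ \<mu> = minkowski $ \<mu> $ \<mu> * spacetime t x $ \<mu>" for \<mu>
    by (simp add: matrix_vector_mult_def)
  then show ?thesis
    by (simp add: vec_option_eq_iff vec_eq_iff minkowski_def)
qed

lemma lorentz_inverse_L_matrix:
  "(lorentz_inverse \<Lambda> *v spacetime t x) $ \<mu> = L_matrix \<Lambda> $ \<mu> $ None * t - (\<Sum>j\<in>UNIV. L_matrix \<Lambda> $ \<mu> $ Some j * x $ j)"
proof -
  have "lorentz_inverse \<Lambda> *v spacetime t x = (minkowski ** transpose \<Lambda>) *v spacetime (- t) x"
    by (simp add: lorentz_inverse_def minkowski_spacetime flip: matrix_vector_mul_assoc)
  then show ?thesis
    by (simp add: L_matrix_eq matrix_vector_mult_def sum_UNIV_option sum_negf)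
qed

text \<open>
  The matrix \<open>L\<close> is the inverse Lorentz transformation with the sign of its spatial columns changed, so that
  the minus sign in front of the \<open>\<omega>\<close>-term of \<open>post_p4\<close> disappears.
\<close>
lemma post_p4_eq:
  "post_p4 \<Lambda> c p q \<omega> = lorentz_inverse \<Lambda> *v spacetime (sqrt (cm_energy2 c p q) / 2) ((rel_momentum c p q / 2) *\<^sub>R \<omega>)"
  "post_q4 \<Lambda> c p q \<omega> = lorentz_inverse \<Lambda> *v spacetime (sqrt (cm_energy2 c p q) / 2) (- ((rel_momentum c p q / 2) *\<^sub>R \<omega>))"
  by (simp_all add: vec_eq_iff post_p4_def post_q4_def lorentz_inverse_L_matrix sum_negf mult_ac)

lemma mink_prod_add: "mink_prod (x + y) z = mink_prod x z + mink_prod y z" "mink_prod z (x + y) = mink_prod z x + mink_prod z y"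
  and mink_prod_diff: "mink_prod (x - y) z = mink_prod x z - mink_prod y z" "mink_prod z (x - y) = mink_prod z x - mink_prod z y"
  and mink_prod_commute: "mink_prod x y = mink_prod y x"
  by (simp_all add: mink_prod_eq spatial_def inner_vec_def sum.distrib sum_subtractf algebra_simps)

text \<open>
  The energy is a strict contraction as a function of the momentum when \<open>c > 0\<close>.
\<close>
lemma relative_momentum_spacelike:
  assumes c: "c > 0" and "p \<noteq> q"
  shows "0 < mink_prod (four_momentum c p - four_momentum c q) (four_momentum c p - four_momentum c q)"
proof -
  have gt: "norm x < energy c x" for x :: "real ^ 'a"
    unfolding energy_def using c by (intro real_less_rsqrt) simp
  have "\<bar>energy c p - energy c q\<bar> * (energy c p + energy c q) = \<bar>(energy c p - energy c q) * (energy c p + energy c q)\<bar>"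
    using energy_pos[OF c, of p] energy_pos[OF c, of q] by (simp add: abs_mult)
  also have "(energy c p - energy c q) * (energy c p + energy c q) = (energy c p)\<^sup>2 - (energy c q)\<^sup>2"
    by (simp add: power2_eq_square algebra_simps)
  also have "\<dots> = (norm p - norm q) * (norm p + norm q)"
    unfolding energy_squared by (simp add: power2_eq_square algebra_simps)
  also have "\<bar>\<dots>\<bar> = \<bar>norm p - norm q\<bar> * (norm p + norm q)"
    by (simp add: abs_mult)
  also have "\<dots> \<le> norm (p - q) * (norm p + norm q)"
    by (intro mult_right_mono norm_triangle_ineq3) auto
  also have "\<dots> < norm (p - q) * (energy c p + energy c q)"
    using gt[of p] gt[of q] \<open>p \<noteq> q\<close> by (intro mult_strict_left_mono) auto
  finally have "\<bar>energy c p - energy c q\<bar> < norm (p - q)"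
    using energy_pos[OF c, of p] energy_pos[OF c, of q] by (simp add: mult_less_cancel_right)
  then have "\<bar>energy c p - energy c q\<bar>\<^sup>2 < (norm (p - q))\<^sup>2"
    by (intro power_strict_mono) auto
  moreover have "spatial (four_momentum c p - four_momentum c q) = p - q"
    by (simp add: vec_eq_iff four_momentum_spacetime)
  ultimately show ?thesis
    by (simp add: mink_prod_eq dot_square_norm power2_eq_square) (simp add: four_momentum_spacetime)
qed

lemma cm_energy2_eq:
  "cm_energy2 c p q = mink_prod (four_momentum c p - four_momentum c q) (four_momentum c p - four_momentum c q) + 4 * c\<^sup>2"
  by (simp add: cm_energy2_def mink_prod_add mink_prod_diff mink_prod_four_momentum mink_prod_commute[of "four_momentum c q"])

lemma rel_momentum_pos:
  assumes "c > 0" "p \<noteq> q"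
  shows "0 < rel_momentum c p q" "cm_energy2 c p q = (rel_momentum c p q)\<^sup>2 + 4 * c\<^sup>2"
  using relative_momentum_spacelike[OF assms] by (simp_all add: rel_momentum_def cm_energy2_eq)

lemma radial_energy_rel_momentum:
  assumes "c > 0" "p \<noteq> q"
  shows "2 * radial_energy c (rel_momentum c p q / 2) = sqrt (cm_energy2 c p q)"
proof -
  have "cm_energy2 c p q = 2\<^sup>2 * (c\<^sup>2 + (rel_momentum c p q / 2)\<^sup>2)"
    using rel_momentum_pos(2)[OF assms] by (simp add: power_divide)
  then have "sqrt (cm_energy2 c p q) = sqrt (2\<^sup>2) * sqrt (c\<^sup>2 + (rel_momentum c p q / 2)\<^sup>2)"
    by (simp only: real_sqrt_mult)
  then show ?thesis by (simp add: radial_energy_def)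
qed

lemma cm_vector_eq: "cm_vector \<Lambda> c p q = spatial (\<Lambda> *v (four_momentum c p - four_momentum c q))"
  by (simp add: vec_eq_iff cm_vector_def matrix_vector_mult_def)

text \<open>
  The total momentum is future timelike and is a positive multiple of the image of the time axis, so the
  inverse of \<open>\<Lambda>\<close> preserves the direction of time. The vectors \<open>p + q\<close> and \<open>p - q\<close> are Minkowski
  orthogonal because both momenta lie on the same mass shell; as \<open>\<Lambda>\<close> maps the former to the time axis, it
  maps the latter to a purely spatial vector, whose length must be the relative momentum.
\<close>
lemma cm_frame:
  fixes \<Lambda> :: "real ^ 'n::finite option ^ 'n option" and p q :: "real ^ 'n"
  assumes c: "c > 0" and pq: "p \<noteq> q" and \<Lambda>: "transpose \<Lambda> ** minkowski ** \<Lambda> = minkowski"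
    and cm: "\<Lambda> *v (four_momentum c p + four_momentum c q) = axis None (sqrt (cm_energy2 c p q))"
  shows "orthochronous (lorentz_inverse \<Lambda>)"
    and "lorentz_inverse \<Lambda> *v spacetime (sqrt (cm_energy2 c p q)) 0 = four_momentum c p + four_momentum c q"
    and "norm (cm_vector \<Lambda> c p q) = rel_momentum c p q"
proof -
  let ?P = "four_momentum c p + four_momentum c q" and ?B = "lorentz_inverse \<Lambda>"
  let ?d = "four_momentum c p - four_momentum c q" and ?s = "sqrt (cm_energy2 c p q)"
  have axis: "spacetime t 0 = axis None t" for t
    by (simp add: vec_option_eq_iff axis_def vec_eq_iff)
  have "0 < cm_energy2 c p q"
    using rel_momentum_pos(2)[OF c pq] c by (simp add: add_nonneg_pos)
  then have s: "?s > 0" by simp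
  have "?B *v (\<Lambda> *v ?P) = ?P"
    by (simp add: matrix_vector_mul_assoc lorentz_inverse[OF \<Lambda>])
  then show BP: "?B *v spacetime ?s 0 = ?P"
    by (simp add: cm axis)
  have "spacetime ?s (0 :: real ^ 'n) = ?s *\<^sub>R axis None 1"
    by (simp add: vec_option_eq_iff axis_def vec_eq_iff)
  then have "?s * (?B *v axis None 1) $ None = ?P $ None"
    using BP by (metis matrix_vector_mult_scaleR real_scaleR_def vector_scaleR_component)
  moreover have "0 < ?P $ None"
    using energy_pos[OF c, of p] energy_pos[OF c, of q] by (simp add: four_momentum_spacetime)
  ultimately have "0 < (?B *v axis None 1) $ None"
    using s by (metis zero_less_mult_pos)
  then show "orthochronous ?B"
    using lorentz_inverse(3)[OF \<Lambda>] by (simp add: orthochronous_def)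
  have "mink_prod (\<Lambda> *v ?d) (\<Lambda> *v ?P) = 0"
    unfolding mink_prod_lorentz[OF \<Lambda>]
    by (simp add: mink_prod_add mink_prod_diff mink_prod_four_momentum mink_prod_commute[of "four_momentum c q"])
  then have "(\<Lambda> *v ?d) $ None * ?s = 0"
    unfolding cm axis[symmetric] by (simp add: mink_prod_eq)
  then have "(\<Lambda> *v ?d) $ None = 0" using s by simp
  moreover have "mink_prod (\<Lambda> *v ?d) (\<Lambda> *v ?d) = (rel_momentum c p q)\<^sup>2"
    unfolding mink_prod_lorentz[OF \<Lambda>] using relative_momentum_spacelike[OF c pq] by (simp add: rel_momentum_def)
  ultimately have "(norm (cm_vector \<Lambda> c p q))\<^sup>2 = (rel_momentum c p q)\<^sup>2"
    by (simp add: mink_prod_eq cm_vector_eq dot_square_norm)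
  then show "norm (cm_vector \<Lambda> c p q) = rel_momentum c p q"
    using rel_momentum_pos(1)[OF c pq] by (simp add: power2_eq_iff_nonneg)
qed

lemma post_collisional:
  fixes \<Lambda> :: "real ^ 'n::finite option ^ 'n option" and p q \<omega> :: "real ^ 'n"
  assumes c: "c > 0" and pq: "p \<noteq> q" and \<Lambda>: "transpose \<Lambda> ** minkowski ** \<Lambda> = minkowski"
    and cm: "\<Lambda> *v (four_momentum c p + four_momentum c q) = axis None (sqrt (cm_energy2 c p q))"
    and \<omega>: "norm \<omega> = 1"
  defines "T \<equiv> momentum_map (lorentz_inverse \<Lambda>) c" and "r0 \<equiv> rel_momentum c p q / 2"
  shows "post_p4 \<Lambda> c p q \<omega> = four_momentum c (T (r0 *\<^sub>R \<omega>))"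
    and "post_q4 \<Lambda> c p q \<omega> = four_momentum c (T (- (r0 *\<^sub>R \<omega>)))"
    and "scattering_angle c p q (T (r0 *\<^sub>R \<omega>)) (T (- (r0 *\<^sub>R \<omega>))) = cm_angle \<Lambda> c p q \<omega>"
proof -
  let ?B = "lorentz_inverse \<Lambda>"
  note B = cm_frame(1)[OF c pq \<Lambda> cm]
  have "energy c (r0 *\<^sub>R \<omega>) = sqrt (cm_energy2 c p q) / 2"
    using radial_energy_rel_momentum[OF c pq] energy_on_ray[OF \<omega>, of c r0] by (simp add: r0_def)
  moreover from this have "energy c (- (r0 *\<^sub>R \<omega>)) = sqrt (cm_energy2 c p q) / 2"
    by (simp add: energy_def)
  ultimately show p4: "post_p4 \<Lambda> c p q \<omega> = four_momentum c (T (r0 *\<^sub>R \<omega>))"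
    and q4: "post_q4 \<Lambda> c p q \<omega> = four_momentum c (T (- (r0 *\<^sub>R \<omega>)))"
    unfolding T_def orthochronous_four_momentum[OF B c, symmetric] post_p4_eq r0_def[symmetric]
    unfolding four_momentum_spacetime by (simp_all only:)
  let ?d = "four_momentum c p - four_momentum c q"
  define \<rho> where "\<rho> = rel_momentum c p q"
  have \<rho>: "\<rho> > 0" using rel_momentum_pos(1)[OF c pq] by (simp add: \<rho>_def)
  have "post_p4 \<Lambda> c p q \<omega> - post_q4 \<Lambda> c p q \<omega> = ?B *v spacetime 0 (\<rho> *\<^sub>R \<omega>)"
    unfolding post_p4_eq matrix_vector_mult_diff_distrib[symmetric]
    by (rule arg_cong[where f = "(*v) ?B"]) (simp add: vec_option_eq_iff vec_eq_iff \<rho>_def)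
  then have "mink_prod ?d (four_momentum c (T (r0 *\<^sub>R \<omega>)) - four_momentum c (T (- (r0 *\<^sub>R \<omega>))))
     = mink_prod (\<Lambda> *v ?d) (\<Lambda> *v (?B *v spacetime 0 (\<rho> *\<^sub>R \<omega>)))"
    unfolding p4 q4 by (simp add: mink_prod_lorentz[OF \<Lambda>])
  also have "\<dots> = \<rho> * (cm_vector \<Lambda> c p q \<bullet> \<omega>)"
    by (simp add: matrix_vector_mul_assoc lorentz_inverse[OF \<Lambda>] mink_prod_eq cm_vector_eq)
  finally show "scattering_angle c p q (T (r0 *\<^sub>R \<omega>)) (T (- (r0 *\<^sub>R \<omega>))) = cm_angle \<Lambda> c p q \<omega>"
    unfolding scattering_angle_def cm_angle_def cm_frame(3)[OF c pq \<Lambda> cm] \<rho>_def[symmetric]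
    using \<rho> by (simp add: power2_eq_square field_simps)
qed

section \<open>The collision measure and the integral over the sphere\<close>

text \<open>
  The density \<open>p'\<^sup>0 q'\<^sup>0 r\<^sup>n\<^sup>-\<^sup>2 / \<surd>s\<close> of the Dirac product with respect to the surface
  measure, where \<open>\<surd>s = 2 radial_energy c r\<close>. The factor \<open>r\<^sup>n\<^sup>-\<^sup>1\<close> is the polar volume element.
\<close>
definition collision_density :: "real \<Rightarrow> real \<Rightarrow> real ^ 'n::finite option ^ 'n option \<Rightarrow> real ^ 'n \<Rightarrow> real" where
  "collision_density c r B \<omega> = energy c (momentum_map B c (r *\<^sub>R \<omega>)) * energy c (momentum_map B c (- (r *\<^sub>R \<omega>)))
     * (r ^ (CARD('n) - 1) / (2 * r * radial_energy c r))"

definition collision_sphere_measure ::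
  "real \<Rightarrow> real \<Rightarrow> real ^ 'n::finite option ^ 'n option \<Rightarrow> ((real ^ 'n) \<times> (real ^ 'n)) measure" where
  "collision_sphere_measure c r B =
     distr (density sphere_measure (\<lambda>\<omega>. ennreal (collision_density c r B \<omega>))) borel
       (\<lambda>\<omega>. (momentum_map B c (r *\<^sub>R \<omega>), momentum_map B c (- (r *\<^sub>R \<omega>))))"

lemma continuous_on_collision_density: "continuous_on S (collision_density c r B)"
  unfolding collision_density_def[abs_def] by (intro continuous_intros)

lemma borel_measurable_collision_density [measurable]: "collision_density c r B \<in> borel_measurable borel"
  by (intro borel_measurable_continuous_onI continuous_on_collision_density)

lemma collision_density_nonneg: "c > 0 \<Longrightarrow> r > 0 \<Longrightarrow> 0 \<le> collision_density c r B \<omega>"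
  unfolding collision_density_def
  by (intro mult_nonneg_nonneg divide_nonneg_nonneg zero_le_power less_imp_le[OF energy_pos] less_imp_le[OF radial_energy_pos]) auto

lemma borel_measurable_collision_chart [measurable]:
  "(\<lambda>\<omega>. (momentum_map B c (r *\<^sub>R \<omega>), momentum_map B c (- (r *\<^sub>R \<omega>)))) \<in> borel_measurable borel"
  by (intro borel_measurable_continuous_onI continuous_intros)

lemma integral_collision_sphere_measure:
  fixes f :: "(real ^ 'n::finite) \<times> (real ^ 'n) \<Rightarrow> real"
  assumes B: "orthochronous B" and c: "c > 0" and r: "r > 0"
  defines "X \<equiv> \<lambda>\<omega>. (momentum_map B c (r *\<^sub>R \<omega>), momentum_map B c (- (r *\<^sub>R \<omega>)))"
  shows "f \<in> borel_measurable borel \<Longrightarrow>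
      (LINT z|collision_sphere_measure c r B. f z) = (LINT \<omega>|sphere_measure. collision_density c r B \<omega> * f (X \<omega>))"
    and "integrable (collision_sphere_measure c r B) f \<Longrightarrow>
      integrable sphere_measure (\<lambda>\<omega>. collision_density c r B \<omega> * f (X \<omega>)) \<and>
      (LINT z|collision_sphere_measure c r B. f z) = (LINT \<omega>|sphere_measure. collision_density c r B \<omega> * f (X \<omega>))"
proof -
  have X [measurable]: "X \<in> borel_measurable borel" unfolding X_def by measurable
  show *: "(LINT z|collision_sphere_measure c r B. f z) = (LINT \<omega>|sphere_measure. collision_density c r B \<omega> * f (X \<omega>))"
    if [measurable]: "f \<in> borel_measurable borel"
  proof -
    have "(LINT z|collision_sphere_measure c r B. f z)
        = (LINT \<omega>|density sphere_measure (\<lambda>\<omega>. ennreal (collision_density c r B \<omega>)). f (X \<omega>))"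
      unfolding collision_sphere_measure_def X_def[symmetric] by (rule integral_distr) auto
    also have "\<dots> = (LINT \<omega>|sphere_measure. collision_density c r B \<omega> *\<^sub>R f (X \<omega>))"
      by (rule integral_density) (auto simp: collision_density_nonneg c r)
    finally show ?thesis by simp
  qed
  assume int: "integrable (collision_sphere_measure c r B) f"
  then have [measurable]: "f \<in> borel_measurable borel"
    using borel_measurable_integrable[OF int] by (simp add: collision_sphere_measure_def)
  have "integrable (density sphere_measure (\<lambda>\<omega>. ennreal (collision_density c r B \<omega>))) (\<lambda>\<omega>. f (X \<omega>))"
    using int unfolding collision_sphere_measure_def X_def[symmetric] by (subst (asm) integrable_distr_eq) auto
  then have "integrable sphere_measure (\<lambda>\<omega>. collision_density c r B \<omega> *\<^sub>R f (X \<omega>))"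
    by (subst (asm) integrable_density) (auto simp: collision_density_nonneg c r)
  then show "integrable sphere_measure (\<lambda>\<omega>. collision_density c r B \<omega> * f (X \<omega>)) \<and>
      (LINT z|collision_sphere_measure c r B. f z) = (LINT \<omega>|sphere_measure. collision_density c r B \<omega> * f (X \<omega>))"
    using * by simp
qed

lemma finite_measure_collision_sphere_measure:
  fixes B :: "real ^ 'n::finite option ^ 'n option"
  shows "finite_measure (collision_sphere_measure c r B)"
proof -
  interpret S: finite_measure "sphere_measure :: (real ^ 'n) measure"
    by (rule finite_measure_sphere_measure)
  have "bounded (collision_density c r B ` sphere 0 1)"
    by (intro compact_imp_bounded compact_continuous_image compact_sphere continuous_on_collision_density)
  then obtain b where "\<forall>y \<in> collision_density c r B ` sphere 0 1. norm y \<le> b"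
    unfolding bounded_iff by blast
  then have b: "collision_density c r B \<omega> \<le> b" if "norm \<omega> = 1" for \<omega>
    using that by (force dest: abs_le_D1)
  have "emeasure (collision_sphere_measure c r B) UNIV = (\<integral>\<^sup>+\<omega>. ennreal (collision_density c r B \<omega>) \<partial>sphere_measure)"
    unfolding collision_sphere_measure_def by (subst emeasure_distr) (auto simp: emeasure_density)
  also have "\<dots> \<le> (\<integral>\<^sup>+(\<omega> :: real ^ 'n). ennreal b \<partial>sphere_measure)"
    by (intro nn_integral_mono_AE eventually_mono[OF AE_sphere_measure] ennreal_leI b)
  also have "\<dots> < \<infinity>"
    using S.emeasure_finite[of UNIV, unfolded infinity_ennreal_def less_top]
    by (simp add: ennreal_mult_less_top)
  finally show ?thesis
    by (intro finite_measureI) (simp add: collision_sphere_measure_def)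
qed

lemma is_dirac_measure_collision_sphere_measure:
  fixes B :: "real ^ 'n::finite option ^ 'n option"
  assumes B: "orthochronous B" and c: "c > 0" and r: "r > 0"
    and P: "B *v spacetime (2 * radial_energy c r) 0 = four_momentum c p + four_momentum c q"
  shows "is_dirac_measure (conservation_defect c p q) (collision_sphere_measure c r B)"
  unfolding is_dirac_measure_def
proof (intro conjI allI impI)
  show "sets (collision_sphere_measure c r B) = sets borel" by (simp add: collision_sphere_measure_def)
  interpret finite_measure "collision_sphere_measure c r B" by (rule finite_measure_collision_sphere_measure)
  show "emeasure (collision_sphere_measure c r B) K < \<infinity>" for K
    using emeasure_finite[of K] by (simp only: infinity_ennreal_def less_top)
  fix d :: "'n option \<Rightarrow> nat \<Rightarrow> real \<Rightarrow> real" and f :: "(real ^ 'n) \<times> (real ^ 'n) \<Rightarrow> real"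
  assume "\<forall>\<mu>. dirac_sequence (d \<mu>)" and f: "continuous_on UNIV f"
  then have d: "\<And>\<mu>. dirac_sequence (d \<mu>)" by blast
  have "(\<lambda>k. LINT z|lborel. (\<Prod>\<mu>\<in>UNIV. d \<mu> k ((B *v spacetime (2 * radial_energy c r) 0 - four_momentum c (fst z) - four_momentum c (snd z)) $ \<mu>)) * f z)
    \<longlonglongrightarrow> (LINT \<omega>|sphere_measure. energy c (momentum_map B c (r *\<^sub>R \<omega>)) * energy c (momentum_map B c (- (r *\<^sub>R \<omega>)))
       * (r ^ (CARD('n) - 1) / (2 * r * radial_energy c r)) * f (momentum_map B c (r *\<^sub>R \<omega>), momentum_map B c (- (r *\<^sub>R \<omega>))))"
    using dirac_sequence_product[OF d] by (intro lab_delta_limit[OF B c r _ _ _ _ f])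
  then show "(\<lambda>k. LINT z|lborel. (\<Prod>\<mu>\<in>UNIV. d \<mu> k (conservation_defect c p q z $ \<mu>)) * f z)
    \<longlonglongrightarrow> (LINT z|collision_sphere_measure c r B. f z)"
    by (simp add: P conservation_defect_def case_prod_beta' collision_density_def
        integral_collision_sphere_measure(1)[OF B c r borel_measurable_continuous_onI[OF f]])
qed

text \<open>
  The collision measure is the explicit measure \<open>collision_sphere_measure\<close>, so both sides are integrals
  against the surface measure of functions that agree on the unit sphere: the energies \<open>p'\<^sup>0\<close> and \<open>q'\<^sup>0\<close>
  cancel, the powers of \<open>r\<^sub>0\<close> combine to \<open>r\<^sub>0\<^sup>n\<^sup>-\<^sup>1 r\<^sub>0\<^sup>3\<^sup>-\<^sup>n = r\<^sub>0\<^sup>2\<close>, and the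
  scattering angle is the angle between \<open>k\<close> and \<open>\<omega>\<close>.
\<close>
theorem theorem2:
  fixes c :: real and p q :: "real ^ 'n::finite"
    and \<Lambda> :: "real ^ 'n option ^ 'n option"
    and \<sigma> :: "real \<Rightarrow> real \<Rightarrow> real"
    and G :: "real ^ 'n \<Rightarrow> real ^ 'n \<Rightarrow> real ^ 'n \<Rightarrow> real ^ 'n \<Rightarrow> real"
  assumes "c > 0" and "CARD('n) \<ge> 2" and "p \<noteq> q"
    and "proper_lorentz \<Lambda>"
    and "\<Lambda> *v (four_momentum c p + four_momentum c q) = axis None (sqrt (cm_energy2 c p q))"
    and "integrable (collision_measure c p q)
           (\<lambda>(p', q'). 1 / energy c q' * (1 / energy c p') * transition_weight c \<sigma> p q p' q' * G p q p' q')"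
  shows "(is_dirac_measure (conservation_defect c p q) (collision_measure c p q)) \<and>
      (\<forall>\<omega>\<in>sphere 0 1.
           energy c (post_p \<Lambda> c p q \<omega>) = post_p4 \<Lambda> c p q \<omega> $ None \<and>
           energy c (post_q \<Lambda> c p q \<omega>) = post_q4 \<Lambda> c p q \<omega> $ None) \<and>
      (set_integrable sphere_measure (sphere 0 1)
           (\<lambda>\<omega>. moller_velocity c p q * \<sigma> (rel_momentum c p q) (cm_angle \<Lambda> c p q \<omega>)
                * G p q (post_p \<Lambda> c p q \<omega>) (post_q \<Lambda> c p q \<omega>))) \<and>
      (c / (energy c p * energy c q) *
           (LINT (p', q')|collision_measure c p q.
              1 / energy c q' * (1 / energy c p') * transition_weight c \<sigma> p q p' q' * G p q p' q')
         = (LINT \<omega>:sphere 0 1|sphere_measure.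
              moller_velocity c p q * \<sigma> (rel_momentum c p q) (cm_angle \<Lambda> c p q \<omega>)
                * G p q (post_p \<Lambda> c p q \<omega>) (post_q \<Lambda> c p q \<omega>)))"
proof -
  note c = assms(1) and pq = assms(3) and cm = assms(5)
  note \<Lambda> = proper_lorentz_matrix[OF assms(4)]
  define B where "B = lorentz_inverse \<Lambda>"
  define T where "T = momentum_map B c"
  define r0 where "r0 = rel_momentum c p q / 2"
  define M where "M = collision_sphere_measure c r0 B"
  define w where "w = collision_density c r0 B"
  define X where "X \<omega> = (T (r0 *\<^sub>R \<omega>), T (- (r0 *\<^sub>R \<omega>)))" for \<omega>
  have B: "orthochronous B" unfolding B_def by (rule cm_frame(1)[OF c pq \<Lambda> cm])
  have r0: "r0 > 0" using rel_momentum_pos(1)[OF c pq] by (simp add: r0_def)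
  have W: "2 * radial_energy c r0 = sqrt (cm_energy2 c p q)"
    unfolding r0_def by (rule radial_energy_rel_momentum[OF c pq])
  have "is_dirac_measure (conservation_defect c p q) M"
    unfolding M_def by (rule is_dirac_measure_collision_sphere_measure[OF B c r0])
      (simp add: W B_def cm_frame(2)[OF c pq \<Lambda> cm])
  then have dirac: "is_dirac_measure (conservation_defect c p q) (collision_measure c p q)"
    and coll: "collision_measure c p q = M"
    by (simp_all add: collision_measure_def dirac_measure_eqI)
  note post = post_collisional[OF c pq \<Lambda> cm, folded B_def, folded T_def r0_def]
  define H where "H = (\<lambda>(p', q'). 1 / energy c q' * (1 / energy c p') * transition_weight c \<sigma> p q p' q' * G p q p' q')"
  define F where "F \<omega> = moller_velocity c p q * \<sigma> (rel_momentum c p q) (cm_angle \<Lambda> c p q \<omega>)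
                * G p q (post_p \<Lambda> c p q \<omega>) (post_q \<Lambda> c p q \<omega>)" for \<omega>
  have "integrable M H" using assms(6) by (simp add: coll H_def)
  then have int: "integrable sphere_measure (\<lambda>\<omega>. w \<omega> * H (X \<omega>))"
    and LINT: "(LINT z|M. H z) = (LINT \<omega>|sphere_measure. w \<omega> * H (X \<omega>))"
    using integral_collision_sphere_measure[OF B c r0, of H] unfolding M_def w_def X_def T_def by auto
  have pointwise: "F \<omega> = c / (energy c p * energy c q) * (w \<omega> * H (X \<omega>))" if "norm \<omega> = 1" for \<omega>
  proof -
    have pp: "post_p \<Lambda> c p q \<omega> = T (r0 *\<^sub>R \<omega>)" "post_q \<Lambda> c p q \<omega> = T (- (r0 *\<^sub>R \<omega>))"
      unfolding post(1,2)[OF that] by (simp_all add: four_momentum_spacetime)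
    define k where "k = \<sigma> (rel_momentum c p q) (cm_angle \<Lambda> c p q \<omega>) * G p q (T (r0 *\<^sub>R \<omega>)) (T (- (r0 *\<^sub>R \<omega>)))"
    define s where "s = cm_energy2 c p q"
    have s: "sqrt s > 0" "sqrt s * sqrt s = s"
      using rel_momentum_pos(2)[OF c pq] c by (simp_all add: s_def add_nonneg_pos)
    have "r0 ^ (CARD('n) - 1) * r0 powi (3 - int CARD('n)) = r0 powi (int (CARD('n) - 1) + (3 - int CARD('n)))"
      by (subst power_int_add) (use r0 in simp, simp only: power_int_of_nat)
    also have "int (CARD('n) - 1) + (3 - int CARD('n)) = 2"
      using assms(2) by simp
    finally have pow: "r0 ^ (CARD('n) - 1) * r0 powi (3 - int CARD('n)) = r0 * r0"
      by (simp add: power2_eq_square)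
    have "w \<omega> * H (X \<omega>) = r0 ^ (CARD('n) - 1) / (2 * r0 * radial_energy c r0) * (1 / 2 * r0 powi (3 - int CARD('n)) * s) * k"
      using energy_pos[OF c, of "T (r0 *\<^sub>R \<omega>)"] energy_pos[OF c, of "T (- (r0 *\<^sub>R \<omega>))"]
      by (simp add: w_def collision_density_def H_def X_def transition_weight_def post(3)[OF that] k_def s_def
          flip: T_def r0_def)
    also have "\<dots> = (r0 ^ (CARD('n) - 1) * r0 powi (3 - int CARD('n))) * s / (2 * r0 * (2 * radial_energy c r0)) * k"
      by simp
    also have "\<dots> = r0 * sqrt s / 2 * k"
      unfolding pow W s_def[symmetric] using s r0 by (simp add: field_simps)
    finally have wH: "w \<omega> * H (X \<omega>) = r0 * sqrt s / 2 * k" .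
    show ?thesis
      unfolding F_def pp wH by (simp add: k_def moller_velocity_def r0_def s_def)
  qed
  have ind: "indicator (sphere 0 1) \<omega> *\<^sub>R F \<omega>
      = indicator (sphere 0 1) \<omega> *\<^sub>R (c / (energy c p * energy c q) * (w \<omega> * H (X \<omega>)))" for \<omega>
    using pointwise[of \<omega>] by (auto simp: indicator_def)
  have [measurable]: "sphere (0 :: real ^ 'n) 1 \<in> sets borel"
    by (intro borel_closed closed_sphere)
  have intF: "set_integrable sphere_measure (sphere 0 1) F"
    unfolding set_integrable_def ind
    by (rule integrable_mult_indicator) (use int in auto)
  have "(LINT \<omega>:sphere 0 1|sphere_measure. F \<omega>)
      = (LINT \<omega>|sphere_measure. c / (energy c p * energy c q) * (w \<omega> * H (X \<omega>)))"
    unfolding set_lebesgue_integral_def ind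
  proof (rule integral_cong_AE)
    show "AE \<omega> in sphere_measure. indicator (sphere 0 1) \<omega> *\<^sub>R (c / (energy c p * energy c q) * (w \<omega> * H (X \<omega>)))
        = c / (energy c p * energy c q) * (w \<omega> * H (X \<omega>))"
      using AE_sphere_measure by eventually_elim simp
  qed (use borel_measurable_integrable[OF int] in measurable)
  then have "c / (energy c p * energy c q) * (LINT z|M. H z) = (LINT \<omega>:sphere 0 1|sphere_measure. F \<omega>)"
    by (simp add: LINT)
  moreover have "energy c (post_p \<Lambda> c p q \<omega>) = post_p4 \<Lambda> c p q \<omega> $ None"
      "energy c (post_q \<Lambda> c p q \<omega>) = post_q4 \<Lambda> c p q \<omega> $ None" if "\<omega> \<in> sphere 0 1" for \<omega>
    using that post(1,2)[of \<omega>] by (simp_all add: four_momentum_spacetime)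
  ultimately show ?thesis
    using dirac intF unfolding H_def F_def coll by blast
qed

end
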